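(* Let $\mathfrak g$ be a simple Lie algebra over $\Bbbk$ with Coxeter number $\mathsf h$, and let $\vartheta$ be an inner automorphism of $\mathfrak g$ of finite order with Kac labels $p_0,p_1,\dots,p_l$. If $\vartheta$ is $\mathcal N$-regular and the order $|\vartheta|$ satisfies $|\vartheta|\le\mathsf h$, then $p_i\le1$ for all $i\in\{0,1,\dots,l\}$.
   Context: $\Bbbk$ is an algebraically closed field of characteristic $0$. Kac labels of inner periodic automorphisms. Let $\mathfrak g$ be simple, $l=\operatorname{rk}\mathfrak g$, $\mathfrak t$ a Cartan subalgebra, $\Delta$ the root system, $\Pi=\{\alpha_1,\dots,\alpha_l\}$ a set of simple roots, $\mathfrak g^\gamma$ the root space of $\gamma\in\Delta$, $\delta=\sum_{i=1}^l n_i\alpha_i$ the highest root, $\alpha_0=-\delta$, $n_0=1$. The Coxeter number is $\mathsf h=\sum_{i=0}^ln_i$. Write $[\gamma:\alpha_i]$ for the coefficient of $\alpha_i$ in $\gamma$. Let $\boldsymbol p=(p_0,\dots,p_l)\ne(0,\dots,0)$ be nonnegative integers with $\gcd(p_0,\dots,p_l)=1$, and put $m=\sum_{i=0}^l n_ip_i$. The automorphism $\vartheta(\boldsymbol p)$, of order $m$, is the inner automorphism acting trivially on $\mathfrak t$ and as multiplication by $\zeta^{d(\gamma)}$ on $\mathfrak g^\gamma$, where $d(\gamma)=\sum_{i=1}^l[\gamma:\alpha_i]p_i$ and $\zeta$ is a fixed primitive $m$-th root of unity; every inner automorphism of finite order is conjugate to one of this form, and the $p_i$ are its Kac labels. For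 an automorphism $\vartheta$ of order $m$, $\mathfrak g_i$ denotes the $\zeta^i$-eigenspace of $\vartheta$. $\vartheta$ is $\mathcal N$-regular if $\mathfrak g_1$ contains a regular nilpotent element of $\mathfrak g$. *)

theory Defs
  imports Complex_Main "HOL-Computational_Algebra.Polynomial"
begin

definition primitive_root_of_unity :: "nat \<Rightarrow> 'k::field \<Rightarrow> bool" where
  "primitive_root_of_unity m z \<longleftrightarrow> 0 < m \<and> z ^ m = 1 \<and> (\<forall>j. 0 < j \<and> j < m \<longrightarrow> z ^ j \<noteq> 1)"

text \<open>The Lie algebra is the whole type \<open>'g\<close>, a vector space over \<open>'k\<close> via \<open>scale\<close>.\<close>

locale lie_algebra = vector_space scale
  for scale :: "'k::field_char_0 \<Rightarrow> 'g::ab_group_add \<Rightarrow> 'g" (infixr \<open>*s\<close> 75) +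
  fixes lie :: "'g \<Rightarrow> 'g \<Rightarrow> 'g"
  assumes linear_lie_left: "Vector_Spaces.linear scale scale (\<lambda>x. lie x y)"
    and linear_lie_right: "Vector_Spaces.linear scale scale (lie x)"
    and lie_self: "lie x x = 0"
    and jacobi: "lie x (lie y z) + lie y (lie z x) + lie z (lie x y) = 0"
begin

definition ideal :: "'g set \<Rightarrow> bool" where
  "ideal I \<longleftrightarrow> subspace I \<and> (\<forall>x. \<forall>y\<in>I. lie x y \<in> I)"

definition subalgebra :: "'g set \<Rightarrow> bool" where
  "subalgebra S \<longleftrightarrow> subspace S \<and> (\<forall>x\<in>S. \<forall>y\<in>S. lie x y \<in> S)"

primrec lower_central :: "'g set \<Rightarrow> nat \<Rightarrow> 'g set" where
  "lower_central S 0 = S"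
| "lower_central S (Suc n) = span {lie x y | x y. x \<in> S \<and> y \<in> lower_central S n}"

definition nilpotent_subalgebra :: "'g set \<Rightarrow> bool" where
  "nilpotent_subalgebra S \<longleftrightarrow> subalgebra S \<and> (\<exists>n. lower_central S n = {0})"

definition normalizer :: "'g set \<Rightarrow> 'g set" where
  "normalizer S = {x. \<forall>y\<in>S. lie x y \<in> S}"

definition cartan_subalgebra :: "'g set \<Rightarrow> bool" where
  "cartan_subalgebra T \<longleftrightarrow> nilpotent_subalgebra T \<and> normalizer T = T"

definition centralizer :: "'g \<Rightarrow> 'g set" where
  "centralizer x = {y. lie x y = 0}"

definition regular :: "'g \<Rightarrow> bool" where
  "regular x \<longleftrightarrow> (\<forall>y. dim (centralizer x) \<le> dim (centralizer y))"

text \<open>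
  Nilpotency of an element means nilpotency of its adjoint operator; for a semisimple
  Lie algebra this is the usual notion.
\<close>

definition nilpotent_element :: "'g \<Rightarrow> bool" where
  "nilpotent_element x \<longleftrightarrow> (\<exists>n. \<forall>y. (lie x ^^ n) y = 0)"

definition lie_automorphism :: "('g \<Rightarrow> 'g) \<Rightarrow> bool" where
  "lie_automorphism f \<longleftrightarrow> Vector_Spaces.linear scale scale f \<and> bij f \<and>
     (\<forall>x y. f (lie x y) = lie (f x) (f y))"

text \<open>For nilpotent \<open>x\<close>, the (finite) exponential series of the adjoint operator of \<open>x\<close>.\<close>

definition exp_ad :: "'g \<Rightarrow> 'g \<Rightarrow> 'g" where
  "exp_ad x y = (\<Sum>i < (LEAST n. \<forall>z. (lie x ^^ n) z = 0). (1 / fact i) *s (lie x ^^ i) y)"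

text \<open>
  The group of inner automorphisms, generated by the exponentials of nilpotent elements.
  Closure under inverses is automatic, as \<open>exp_ad (- x)\<close> is inverse to \<open>exp_ad x\<close>.
\<close>

inductive_set inner_automorphisms :: "('g \<Rightarrow> 'g) set" where
  id: "id \<in> inner_automorphisms"
| step: "nilpotent_element x \<Longrightarrow> f \<in> inner_automorphisms \<Longrightarrow> exp_ad x \<circ> f \<in> inner_automorphisms"

definition finite_order :: "('g \<Rightarrow> 'g) \<Rightarrow> bool" where
  "finite_order f \<longleftrightarrow> (\<exists>n>0. f ^^ n = id)"

definition aut_order :: "('g \<Rightarrow> 'g) \<Rightarrow> nat" where
  "aut_order f = (LEAST n. 0 < n \<and> f ^^ n = id)"

text \<open>
  \<open>graded_part z f i\<close> is the component of degree \<open>i\<close> in the periodic grading of \<open>f\<close>; \<open>z\<close> is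
  meant to be a fixed primitive root of unity whose order is that of \<open>f\<close>.
\<close>

definition graded_part :: "'k \<Rightarrow> ('g \<Rightarrow> 'g) \<Rightarrow> nat \<Rightarrow> 'g set" where
  "graded_part z f i = {x. f x = z ^ i *s x}"

definition N_regular :: "'k \<Rightarrow> ('g \<Rightarrow> 'g) \<Rightarrow> bool" where
  "N_regular z f \<longleftrightarrow> (\<exists>e \<in> graded_part z f 1. nilpotent_element e \<and> regular e)"

text \<open>
  A linear functional on \<open>T\<close> is represented by the function on \<open>'g\<close> that agrees with it on \<open>T\<close>
  and vanishes outside \<open>T\<close>; this makes the representation unique.
\<close>

definition dual :: "'g set \<Rightarrow> ('g \<Rightarrow> 'k) set" where
  "dual T = {\<phi>. (\<forall>x\<in>T. \<forall>y\<in>T. \<phi> (x + y) = \<phi> x + \<phi> y) \<and> (\<forall>c. \<forall>x\<in>T. \<phi> (c *s x) = c * \<phi> x) \<and>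
     (\<forall>x. x \<notin> T \<longrightarrow> \<phi> x = 0)}"

definition root_space :: "'g set \<Rightarrow> ('g \<Rightarrow> 'k) \<Rightarrow> 'g set" where
  "root_space T \<gamma> = {x. \<forall>h\<in>T. lie h x = \<gamma> h *s x}"

definition roots :: "'g set \<Rightarrow> ('g \<Rightarrow> 'k) set" where
  "roots T = {\<gamma> \<in> dual T. \<gamma> \<noteq> (\<lambda>_. 0) \<and> root_space T \<gamma> \<noteq> {0}}"

text \<open>
  The family \<open>\<alpha> 1, \<dots>, \<alpha> (dim T)\<close> consists of roots, is a basis of the dual of \<open>T\<close>, and every root
  is an integral combination of it with coefficients of one sign. The value \<open>\<alpha> 0\<close> is not used.
\<close>

definition simple_roots :: "'g set \<Rightarrow> (nat \<Rightarrow> 'g \<Rightarrow> 'k) \<Rightarrow> bool" where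
  "simple_roots T \<alpha> \<longleftrightarrow>
     (\<forall>i\<in>{1..dim T}. \<alpha> i \<in> roots T) \<and>
     (\<forall>c. (\<forall>h\<in>T. (\<Sum>i=1..dim T. c i * \<alpha> i h) = 0) \<longrightarrow> (\<forall>i\<in>{1..dim T}. c i = 0)) \<and>
     (\<forall>\<gamma>\<in>roots T. \<exists>c :: nat \<Rightarrow> int.
        (\<forall>h\<in>T. \<gamma> h = (\<Sum>i=1..dim T. of_int (c i) * \<alpha> i h)) \<and>
        ((\<forall>i\<in>{1..dim T}. 0 \<le> c i) \<or> (\<forall>i\<in>{1..dim T}. c i \<le> 0)))"

end

locale simple_lie_algebra = lie_algebra scale lie
  for scale :: "'k::{alg_closed_field, field_char_0} \<Rightarrow> 'g::ab_group_add \<Rightarrow> 'g" (infixr \<open>*s\<close> 75)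
    and lie :: "'g \<Rightarrow> 'g \<Rightarrow> 'g" +
  assumes finite_dimensional: "\<exists>B. finite B \<and> span B = UNIV"
    and nonabelian: "\<exists>x y. lie x y \<noteq> 0"
    and ideal_trivial: "ideal I \<Longrightarrow> I = {0} \<or> I = UNIV"

locale based_simple_lie_algebra = simple_lie_algebra scale lie
  for scale :: "'k::{alg_closed_field, field_char_0} \<Rightarrow> 'g::ab_group_add \<Rightarrow> 'g" (infixr \<open>*s\<close> 75)
    and lie :: "'g \<Rightarrow> 'g \<Rightarrow> 'g" +
  fixes T :: "'g set" and \<alpha> :: "nat \<Rightarrow> 'g \<Rightarrow> 'k"
  assumes cartan: "cartan_subalgebra T"
    and simple_roots: "simple_roots T \<alpha>"
begin

definition rank :: nat where
  "rank = dim T"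

text \<open>The coefficients of a root in the simple roots; normalised to be 0 at unused indices.\<close>

definition root_coeff :: "('g \<Rightarrow> 'k) \<Rightarrow> nat \<Rightarrow> int" where
  "root_coeff \<gamma> = (THE c. (\<forall>h\<in>T. \<gamma> h = (\<Sum>i=1..rank. of_int (c i) * \<alpha> i h)) \<and>
     (\<forall>i. i \<notin> {1..rank} \<longrightarrow> c i = 0))"

definition highest_root :: "'g \<Rightarrow> 'k" where
  "highest_root = (THE \<delta>. \<delta> \<in> roots T \<and>
     (\<forall>\<gamma>\<in>roots T. \<forall>i\<in>{1..rank}. root_coeff \<gamma> i \<le> root_coeff \<delta> i))"

text \<open>The coefficients of the highest root are positive, so \<open>nat\<close> loses nothing.\<close>

definition mark :: "nat \<Rightarrow> nat" where
  "mark i = (if i = 0 then 1 else nat (root_coeff highest_root i))"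

definition coxeter_number :: nat where
  "coxeter_number = (\<Sum>i=0..rank. mark i)"

definition label_order :: "(nat \<Rightarrow> nat) \<Rightarrow> nat" where
  "label_order p = (\<Sum>i=0..rank. mark i * p i)"

definition label_degree :: "(nat \<Rightarrow> nat) \<Rightarrow> ('g \<Rightarrow> 'k) \<Rightarrow> int" where
  "label_degree p \<gamma> = (\<Sum>i=1..rank. root_coeff \<gamma> i * int (p i))"

text \<open>
  By the root space decomposition, at most one \<open>f\<close> satisfies \<open>kac_automorphism z p f\<close>.
\<close>

definition kac_automorphism :: "'k \<Rightarrow> (nat \<Rightarrow> nat) \<Rightarrow> ('g \<Rightarrow> 'g) \<Rightarrow> bool" where
  "kac_automorphism z p f \<longleftrightarrow> f \<in> inner_automorphisms \<and>
     (\<forall>h\<in>T. f h = h) \<and>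
     (\<forall>\<gamma>\<in>roots T. \<forall>x\<in>root_space T \<gamma>. f x = z powi label_degree p \<gamma> *s x)"

definition kac_labels :: "'k \<Rightarrow> (nat \<Rightarrow> nat) \<Rightarrow> ('g \<Rightarrow> 'g) \<Rightarrow> bool" where
  "kac_labels z p f \<longleftrightarrow>
     (\<exists>i\<in>{0..rank}. p i \<noteq> 0) \<and> Gcd (p ` {0..rank}) = 1 \<and>
     primitive_root_of_unity (label_order p) z \<and>
     (\<exists>g s. kac_automorphism z p g \<and> lie_automorphism s \<and> f \<circ> s = s \<circ> g)"

end

end

(*
The Killing form is nondegenerate, because the simple roots give an element rho of T with integral
eigenvalues; this yields the root space decomposition, reflections preserving the roots, and the
highest root.

Let m be the order, and suppose p i >= 2 for a label p i with mark n i. Every root of degree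
congruent to 1 modulo m has a multiple of n i as its coefficient at alpha i (0 if i = 0). So a
vector e of degree 1 is an eigenvector, of eigenvalue n i, of the element H of T with
alpha j (H) = n i * p j - [j = i] * m, and every root takes a value of at
most n i * (m - 2) at H. Choose a base that is nonnegative at H. If e is regular, every simple root of this base takes the value n i at H: otherwise e lies in the span u of
all positive root spaces but one simple one, and its adjoint operator maps the Borel subalgebra
into u, so that the centralizer of e has dimension greater than the rank. Hence the highest root of
this base takes the value n i * (h - 1) at H, where h is the Coxeter number, so that h < m.
*)

theory Submission
  imports Defs
begin

text \<open>The element H comes from the alcove. Let x be the point of \<open>T\<close> at which
  \<alpha> j takes the value p j / m, and x_i the vertex of the fundamental alcove at which \<alpha>
  j takes the value [j = i] / n i (the origin for i = 0); then H = n i * m * (x - x_i). The roots of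
  degree 1 modulo m are integral at x_i, because p i >= 2 keeps them off node i of the affine
  diagram.

  Two bases are in play: the marks and the Coxeter number belong to the given one, the regularity
  argument to one that is dominant for H. The base is changed by one simple reflection at a time,
  and what survives of the highest root is that the new simple roots, combined with the old marks,
  still give a root.

  \<open>T\<close> is given only as nilpotent and self-normalizing, so nothing is diagonalizable at
  the start. The Killing form enters through \<open>killing rho rho\<close>, a sum of squares of
  integers that are not all 0; the nilpotent part of each \<open>lie t\<close> is then orthogonal to
  everything and vanishes.\<close>

subsection \<open>Linear algebra over an algebraically closed field\<close>

locale fd_vector_space = finite_dimensional_vector_space scale Basis
  for scale :: "'a::field \<Rightarrow> 'b::ab_group_add \<Rightarrow> 'b" (infixr \<open>*s\<close> 75) and Basis
begin

abbreviation lin :: "('b \<Rightarrow> 'b) \<Rightarrow> bool" where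
  "lin f \<equiv> Vector_Spaces.linear scale scale f"

lemma linI:
  assumes "\<And>x y. f (x + y) = f x + f y" "\<And>c x. f (c *s x) = c *s f x"
  shows "lin f"
  using assms by (simp add: Vector_Spaces.linear_iff vector_space_axioms)

lemma lin_add: "lin f \<Longrightarrow> f (x + y) = f x + f y"
  and lin_scale: "lin f \<Longrightarrow> f (c *s x) = c *s f x"
  by (simp_all add: Vector_Spaces.linear_iff)

lemma lin_module_hom: "lin f \<Longrightarrow> module_hom scale scale f"
  by (simp add: module_hom_iff_linear)

lemma lin_zero: "lin f \<Longrightarrow> f 0 = 0"
  using lin_scale[of f 0 0] by simp

lemma lin_minus: "lin f \<Longrightarrow> f (- x) = - f x"
  using lin_scale[of f "-1" x] by simp

lemma lin_diff: "lin f \<Longrightarrow> f (x - y) = f x - f y"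
  using lin_add[of f x "-y"] lin_minus[of f y] by simp

lemma lin_sum: "lin f \<Longrightarrow> f (sum g S) = (\<Sum>a\<in>S. f (g a))"
  by (induction S rule: infinite_finite_induct) (simp_all add: lin_zero lin_add)

lemma lin_id: "lin (\<lambda>x. x)"
  by (rule linI) simp_all

lemma lin_comp: "lin f \<Longrightarrow> lin g \<Longrightarrow> lin (\<lambda>x. f (g x))"
  by (rule linI) (simp_all add: lin_add lin_scale)

lemma lin_plus: "lin f \<Longrightarrow> lin g \<Longrightarrow> lin (\<lambda>x. f x + g x)"
  by (rule linI) (simp_all add: lin_add lin_scale algebra_simps)

lemma lin_minus_fun: "lin f \<Longrightarrow> lin g \<Longrightarrow> lin (\<lambda>x. f x - g x)"
  by (rule linI) (simp_all add: lin_add lin_scale algebra_simps)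

lemma lin_scale_fun: "lin f \<Longrightarrow> lin (\<lambda>x. c *s f x)"
  by (rule linI) (simp_all add: lin_add lin_scale algebra_simps)

lemma lin_funpow: "lin f \<Longrightarrow> lin (f ^^ n)"
proof (induction n)
  case 0
  show ?case by (rule linI) simp_all
next
  case (Suc n)
  then show ?case by (auto intro!: linI simp: lin_add lin_scale)
qed

lemma span_image_invariant:
  assumes "lin f" "\<And>x. x \<in> S \<Longrightarrow> f x \<in> span R" "x \<in> span S"
  shows "f x \<in> span R"
  using assms(3)
proof (induction rule: span_induct_alt)
  case base
  then show ?case using assms(1) by (simp add: lin_zero span_zero)
next
  case (step c x y)
  then show ?case using assms by (simp add: lin_add lin_scale span_add span_scale)
qed

lemma lin_eq_on_span:
  assumes "lin f" "lin g" "\<And>x. x \<in> S \<Longrightarrow> f x = g x" "x \<in> span S"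
  shows "f x = g x"
  using assms(4)
proof (induction rule: span_induct_alt)
  case base
  then show ?case using assms by (simp add: lin_zero)
next
  case (step c x y)
  then show ?case using assms by (simp add: lin_add lin_scale)
qed

text \<open>Phrased for an indexed family, so that a repeated value already counts as a relation.
  Injectivity turns the finiteness of independent sets into bounds on the index set: eigenvalues,
  coweights and roots are counted in this way.\<close>

lemma independent_family:
  assumes "\<And>F c i. finite F \<Longrightarrow> F \<subseteq> I \<Longrightarrow> (\<Sum>i\<in>F. c i *s f i) = 0 \<Longrightarrow> i \<in> F \<Longrightarrow> c i = 0"
  shows "inj_on f I" "independent (f ` I)"
proof -
  show inj: "inj_on f I"
  proof (rule inj_onI, rule ccontr)
    fix i j assume ij: "i \<in> I" "j \<in> I" "f i = f j" "i \<noteq> j"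
    then have "(\<Sum>k\<in>{i, j}. (if k = i then 1 else - 1) *s f k) = 0" by simp
    then have "(if i = i then 1 else - 1 :: 'a) = 0"
      using assms[of "{i, j}" "\<lambda>k. if k = i then 1 else - 1" i] ij by blast
    then show False by simp
  qed
  show "independent (f ` I)"
    unfolding independent_explicit_finite_subsets
  proof (intro allI impI ballI)
    fix S u v
    assume S: "S \<subseteq> f ` I" "finite S" "(\<Sum>v\<in>S. u v *s v) = 0" "v \<in> S"
    obtain D where D: "D \<subseteq> I" "S = f ` D" "finite D"
      using finite_subset_image[OF S(2,1)] by blast
    obtain d where d: "d \<in> D" "v = f d" using S(4) D(2) by auto
    have "(\<Sum>i\<in>D. u (f i) *s f i) = 0"
      using S(3) sum.reindex[OF inj_on_subset[OF inj D(1)], of "\<lambda>v. u v *s v"] D(2) by simp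
    then show "u v = 0" using assms[OF D(3,1) _ d(1)] d(2) by simp
  qed
qed

text \<open>Collects the terms of a linear combination by the subspace they come from, so that each
  index occurs once and independence results for families of subspaces apply.\<close>

lemma span_Union_sum:
  assumes sub: "\<And>i. i \<in> I \<Longrightarrow> subspace (V i)" and x: "x \<in> span (\<Union>i\<in>I. V i)"
  obtains F f where "finite F" "F \<subseteq> I" "\<And>i. i \<in> F \<Longrightarrow> f i \<in> V i" "x = sum f F"
proof -
  have "\<exists>F f. finite F \<and> F \<subseteq> I \<and> (\<forall>i\<in>F. f i \<in> V i) \<and> x = sum f F"
    using x
  proof (induction rule: span_induct_alt)
    case base
    show ?case by (rule exI[of _ "{}"]) auto
  next
    case (step c x y)
    then obtain F f i where F: "finite F" "F \<subseteq> I" "\<forall>i\<in>F. f i \<in> V i" "y = sum f F"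
      and i: "i \<in> I" "x \<in> V i" by auto
    define g where "g = (\<lambda>j. if j = i then c *s x + (if i \<in> F then f i else 0) else f j)"
    have "f i \<in> V i" if "i \<in> F" using F that by auto
    then have gi: "g i \<in> V i"
      using sub[OF i(1)] i by (auto simp: g_def subspace_add subspace_scale)
    have "sum g (insert i F) = g i + sum g (F - {i})"
      using F by (simp add: sum.insert_remove)
    also have "sum g (F - {i}) = sum f (F - {i})"
      by (rule sum.cong) (auto simp: g_def)
    also have "g i + sum f (F - {i}) = c *s x + y"
      using F by (auto simp: g_def sum.remove algebra_simps)
    finally have "c *s x + y = sum g (insert i F)" by simp
    moreover have "\<forall>j\<in>insert i F. g j \<in> V j"
      using gi F by (auto simp: g_def)
    ultimately show ?case using F i by (intro exI[of _ "insert i F"] exI[of _ g]) auto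
  qed
  then show ?thesis using that by blast
qed

lemma last_nonzero:
  assumes "v \<noteq> 0" "\<exists>n. (A ^^ n) v = 0"
  obtains p where "(A ^^ p) v \<noteq> 0" "A ((A ^^ p) v) = 0"
proof -
  define n where "n = (LEAST n. (A ^^ n) v = 0)"
  have n: "(A ^^ n) v = 0" unfolding n_def using assms(2) by (rule LeastI_ex)
  then obtain p where p: "n = Suc p" using assms(1) by (cases n) auto
  then have "(A ^^ p) v \<noteq> 0" using not_less_Least[of p "\<lambda>n. (A ^^ n) v = 0"] by (simp add: n_def)
  then show ?thesis using n p by (intro that) auto
qed

lemma independent_Un:
  assumes C: "independent C" and int: "span C \<inter> span D = {0}"
  shows "independent D \<Longrightarrow> independent (C \<union> D)"
proof -
  assume D: "independent D"
  have "independent (C \<union> D')" if "D' \<subseteq> D" for D'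
    using finite_subset[OF that finiteI_independent[OF D]] that
  proof (induction D' rule: finite_induct)
    case (insert d D')
    have "d \<notin> span (C \<union> D')"
    proof
      assume "d \<in> span (C \<union> D')"
      then obtain x y where xy: "d = x + y" "x \<in> span C" "y \<in> span D'" by (auto simp: span_Un)
      have "y \<in> span D" "d \<in> span D" using xy(3) span_mono[of D' D] insert.prems span_base by auto
      then have "d - y \<in> span D" by (intro span_diff)
      then have "d = y" using xy int by auto
      then have "dependent (insert d D')"
        using xy(3) insert.hyps by (auto simp: dependent_def intro!: bexI[of _ d])
      then show False using D insert.prems dependent_mono by blast
    qed
    then show ?case using insert by (simp add: independent_insertI)
  qed (simp add: C)
  then show ?thesis by blast
qed

text \<open>Rank-nullity for the restriction to V: a basis of the kernel is extended to V, and f is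
  injective on the span of the added vectors.\<close>

lemma dim_kernel_bound:
  assumes f: "lin f" and V: "subspace V" and im: "\<And>x. x \<in> V \<Longrightarrow> f x \<in> U"
  shows "dim V \<le> dim {x \<in> V. f x = 0} + dim U"
proof -
  let ?K = "{x \<in> V. f x = 0}"
  obtain C where C: "C \<subseteq> ?K" "independent C" "?K \<subseteq> span C" "card C = dim ?K"
    by (rule basis_exists[of ?K]) blast
  obtain B where B: "C \<subseteq> B" "B \<subseteq> V" "independent B" "V \<subseteq> span B"
    using maximal_independent_subset_extend[of C V] C by blast
  have fin: "finite B" using B(3) by (rule finiteI_independent)
  have ker: "z = 0" if z: "z \<in> span (B - C)" "f z = 0" for z
  proof -
    have "z \<in> V" using z(1) span_mono[of "B - C" B] span_minimal[OF B(2) V] by blast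
    then have "z \<in> span C" using z(2) C(3) by blast
    \<comment> \<open>z lies in the spans of the disjoint parts C and B - C of one basis, so all its
      coordinates vanish.\<close>
    then have "representation B z = representation C z"
      by (rule representation_extend[OF B(3) _ B(1)])
    moreover have "representation B z = representation (B - C) z"
      by (rule representation_extend[OF B(3) z(1)]) blast
    ultimately have "representation B z b = 0" for b
      using representation_ne_zero[of C z b] representation_ne_zero[of "B - C" z b] by auto
    then show ?thesis
      using sum_representation_eq[OF B(3) _ fin, of z] z(1) span_mono[of "B - C" B] by auto
  qed
  have inj: "inj_on f (span (B - C))"
  proof (rule inj_onI)
    fix x y assume xy: "x \<in> span (B - C)" "y \<in> span (B - C)" "f x = f y"
    have "x - y = 0" by (rule ker[OF span_diff[OF xy(1,2)]]) (simp add: lin_diff[OF f] xy(3))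
    then show "x = y" by simp
  qed
  have "independent (f ` (B - C))"
    using module_hom.independent_injective_image[OF lin_module_hom[OF f] _ inj]
      independent_mono[OF B(3)] by blast
  then have "card (f ` (B - C)) \<le> dim U"
    using im B(2) by (intro independent_card_le_dim) auto
  moreover have "card (f ` (B - C)) = card (B - C)"
    using inj_on_subset[OF inj span_superset] by (rule card_image)
  moreover have "card (B - C) = card B - card C"
    using B(1) fin finite_subset by (intro card_Diff_subset) auto
  moreover have "card B = dim V" using B by (intro basis_card_eq_dim) auto
  ultimately show ?thesis using C(4) by simp
qed

section \<open>Polynomials in an operator\<close>

definition peval :: "('b \<Rightarrow> 'b) \<Rightarrow> 'a poly \<Rightarrow> 'b \<Rightarrow> 'b" where
  "peval A p v = (\<Sum>i\<le>degree p. coeff p i *s (A ^^ i) v)"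

lemma peval_bound: "degree p \<le> n \<Longrightarrow> peval A p v = (\<Sum>i\<le>n. coeff p i *s (A ^^ i) v)"
  unfolding peval_def
  by (rule sum.mono_neutral_left) (auto simp: coeff_eq_0)

lemma peval_linear_factor:
  assumes "lin A"
  shows "peval A ([:- c, 1:] * q) v = A (peval A q v) - c *s peval A q v"
proof -
  define n where "n = Suc (degree q)"
  have "degree ([:- c, 1:] * q) \<le> n"
    unfolding n_def using degree_mult_le[of "[:-c,1:]" q] by simp
  then have "peval A ([:- c, 1:] * q) v = (\<Sum>i\<le>n. coeff (pCons 0 q - smult c q) i *s (A ^^ i) v)"
    by (subst peval_bound[of _ n]) (simp_all add: algebra_simps)
  also have "\<dots> = (\<Sum>i\<le>n. coeff (pCons 0 q) i *s (A ^^ i) v) - c *s (\<Sum>i\<le>n. coeff q i *s (A ^^ i) v)"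
    by (simp add: sum_subtractf scale_sum_right scale_left_diff_distrib)
  also have "(\<Sum>i\<le>n. coeff q i *s (A ^^ i) v) = peval A q v"
    by (rule peval_bound[symmetric]) (simp add: n_def)
  also have "(\<Sum>i\<le>n. coeff (pCons 0 q) i *s (A ^^ i) v) = A (peval A q v)"
    unfolding n_def sum.atMost_Suc_shift
    using assms by (simp add: peval_def lin_sum lin_scale)
  finally show ?thesis .
qed

lemma peval_in_subspace:
  assumes "subspace U" "\<And>x. x \<in> U \<Longrightarrow> A x \<in> U" "v \<in> U"
  shows "peval A p v \<in> U"
proof -
  have "(A ^^ i) v \<in> U" for i
    by (induction i) (use assms in auto)
  then show ?thesis unfolding peval_def
    using assms(1) by (auto intro!: subspace_sum subspace_scale)
qed

section \<open>Generalized eigenspaces\<close>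

definition genspace :: "('b \<Rightarrow> 'b) \<Rightarrow> 'a \<Rightarrow> 'b set" where
  "genspace A c = {x. \<exists>n. ((\<lambda>y. A y - c *s y) ^^ n) x = 0}"

lemma lin_shift: "lin A \<Longrightarrow> lin (\<lambda>y. A y - c *s y)"
  by (intro lin_minus_fun lin_scale_fun lin_id)

lemma funpow_zero_mono: "lin f \<Longrightarrow> (f ^^ n) x = 0 \<Longrightarrow> n \<le> m \<Longrightarrow> (f ^^ m) x = 0"
  using lin_zero[OF lin_funpow[of f "m - n"]]
  by (metis comp_apply funpow_add le_add_diff_inverse2)

lemma genspaceE:
  assumes "x \<in> genspace A c"
  obtains n where "((\<lambda>y. A y - c *s y) ^^ n) x = 0"
  using assms by (auto simp: genspace_def)

lemma subspace_genspace:
  assumes "lin A" shows "subspace (genspace A c)"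
proof (rule subspaceI)
  let ?B = "\<lambda>y. A y - c *s y"
  have L: "lin (?B ^^ n)" for n by (intro lin_funpow lin_shift assms)
  show "0 \<in> genspace A c" by (auto simp: genspace_def intro!: exI[of _ 0])
  show "x + y \<in> genspace A c" if xy: "x \<in> genspace A c" "y \<in> genspace A c" for x y
  proof -
    from xy obtain n m where "(?B ^^ n) x = 0" "(?B ^^ m) y = 0" by (auto elim!: genspaceE)
    then have "(?B ^^ (max n m)) x = 0" "(?B ^^ (max n m)) y = 0"
      using funpow_zero_mono[OF lin_shift[OF assms]] by (metis max.cobounded1 max.cobounded2)+
    then show ?thesis by (auto simp: genspace_def lin_add[OF L] intro!: exI[of _ "max n m"])
  qed
  show "d *s x \<in> genspace A c" if "x \<in> genspace A c" for d x
    using that by (auto simp: genspace_def lin_scale[OF L])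
qed

lemma genspace_commute:
  assumes "lin B" "\<And>x. A (B x) = B (A x)" "x \<in> genspace A c"
  shows "B x \<in> genspace A c"
proof -
  obtain n where n: "((\<lambda>y. A y - c *s y) ^^ n) x = 0" using assms(3) by (rule genspaceE)
  have "((\<lambda>y. A y - c *s y) ^^ k) (B x) = B (((\<lambda>y. A y - c *s y) ^^ k) x)" for k
    by (induction k) (simp_all add: assms(2) lin_diff[OF assms(1)] lin_scale[OF assms(1)])
  then have "((\<lambda>y. A y - c *s y) ^^ n) (B x) = 0" using n lin_zero[OF assms(1)] by simp
  then show ?thesis unfolding genspace_def by blast
qed

lemma genspace_invariant:
  assumes "lin A" "x \<in> genspace A c" shows "A x \<in> genspace A c"
  using genspace_commute[OF assms(1) _ assms(2)] by simp

lemma genspace_shift_invariant: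
  assumes "lin A" "x \<in> genspace A c" shows "A x - d *s x \<in> genspace A c"
  using assms by (intro subspace_diff subspace_scale subspace_genspace genspace_invariant)

lemma genspace_inj:
  assumes A: "lin A" and x: "x \<in> genspace A c" and d: "d \<noteq> c" and 0: "A x = d *s x"
  shows "x = 0"
proof -
  have "((\<lambda>y. A y - c *s y) ^^ n) x = (d - c) ^ n *s x" for n
    using 0 by (induction n) (simp_all add: lin_scale[OF A] algebra_simps)
  moreover obtain n where "((\<lambda>y. A y - c *s y) ^^ n) x = 0" using x by (rule genspaceE)
  ultimately show ?thesis using d by auto
qed

text \<open>If (A - c)^n x = 0, then (A - c) x has a smaller exponent and stays in
  \<open>genspace A d\<close>, so it vanishes by induction; x is then an eigenvector for c inside
  \<open>genspace A d\<close>, which \<open>genspace_inj\<close> excludes.\<close>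

lemma genspace_disjoint:
  assumes A: "lin A" and x: "x \<in> genspace A c" "x \<in> genspace A d" and d: "d \<noteq> c"
  shows "x = 0"
proof -
  have "((\<lambda>y. A y - c *s y) ^^ n) x = 0 \<Longrightarrow> x \<in> genspace A d \<Longrightarrow> x = 0" for n x
  proof (induction n arbitrary: x)
    case (Suc n)
    from Suc.prems(1) have "((\<lambda>y. A y - c *s y) ^^ n) (A x - c *s x) = 0"
      by (simp add: funpow_Suc_right del: funpow.simps)
    from Suc.IH[OF this genspace_shift_invariant[OF A Suc.prems(2)]] have "A x = c *s x" by simp
    then show ?case using genspace_inj[OF A Suc.prems(2), of c] d by metis
  qed simp
  then show ?thesis using x by (auto elim: genspaceE)
qed

text \<open>Induction on the exponent. If y solves the equation for z = (A - c) x, then (A - d)(x -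
  y) = (A - c) x + (c - d) x - z = (c - d) x, so a multiple of x - y solves it for x.\<close>

lemma genspace_surj:
  assumes A: "lin A" and x: "x \<in> genspace A c" and d: "d \<noteq> c"
  shows "\<exists>y\<in>genspace A c. A y - d *s y = x"
proof -
  have "((\<lambda>y. A y - c *s y) ^^ n) x = 0 \<Longrightarrow> \<exists>y\<in>genspace A c. A y - d *s y = x" for n x
  proof (induction n arbitrary: x)
    case 0
    then show ?case using subspace_0[OF subspace_genspace[OF A]]
      by (intro bexI[of _ 0]) (simp_all add: lin_zero[OF A])
  next
    case (Suc n)
    define z where "z = A x - c *s x"
    have "((\<lambda>y. A y - c *s y) ^^ n) z = 0"
      using Suc.prems by (simp add: funpow_Suc_right z_def del: funpow.simps)
    from Suc.IH[OF this] obtain y where y: "y \<in> genspace A c" "A y - d *s y = z" by blast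
    have x: "x \<in> genspace A c" using Suc.prems by (auto simp: genspace_def intro!: exI[of _ "Suc n"])
    have "A (x - y) - d *s (x - y) = (c - d) *s x"
      using y(2) by (simp add: lin_diff[OF A] z_def algebra_simps)
    moreover have "A (k *s (x - y)) - d *s (k *s (x - y)) = k *s (A (x - y) - d *s (x - y))" for k
      by (subst lin_scale[OF A]) (simp add: scale_right_diff_distrib mult.commute)
    ultimately have "A (inverse (c - d) *s (x - y)) - d *s (inverse (c - d) *s (x - y)) = x"
      using d by simp
    then show ?case using x y(1) subspace_genspace[OF A]
      by (intro bexI[of _ "inverse (c - d) *s (x - y)"] subspace_scale subspace_diff)
  qed
  then show ?thesis using x by (auto elim: genspaceE)
qed

text \<open>A power of A - d that kills f d preserves every generalized eigenspace. By induction it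
  kills the other terms as well, which places each of them in two generalized eigenspaces at
  once.\<close>

lemma genspace_independent:
  assumes A: "lin A"
  shows "finite S \<Longrightarrow> (\<And>c. c \<in> S \<Longrightarrow> f c \<in> genspace A c) \<Longrightarrow> sum f S = 0 \<Longrightarrow> c \<in> S \<Longrightarrow> f c = 0"
proof (induction S arbitrary: f c rule: finite_induct)
  case (insert d S)
  let ?B = "\<lambda>y. A y - d *s y"
  have fd: "f d \<in> genspace A d" using insert.prems by simp
  obtain n where n: "(?B ^^ n) (f d) = 0" using fd by (rule genspaceE)
  have L: "lin (?B ^^ m)" for m by (intro lin_funpow lin_shift A)
  have inv: "(?B ^^ m) x \<in> genspace A c" if "x \<in> genspace A c" for m x c
    using that by (induction m) (auto intro: genspace_shift_invariant[OF A])
  have "(?B ^^ n) (sum f (insert d S)) = 0" using insert.prems(2) lin_zero[OF L] by simp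
  then have s: "(\<Sum>c\<in>S. (?B ^^ n) (f c)) = 0"
    using insert.hyps n by (simp add: lin_add[OF L] lin_sum[OF L])
  have z: "f c = 0" if c: "c \<in> S" for c
  proof -
    have "(?B ^^ n) (f c) = 0"
      using insert.IH[of "\<lambda>c. (?B ^^ n) (f c)", OF _ s c] inv insert.prems(1) by blast
    then have "f c \<in> genspace A d" by (auto simp: genspace_def)
    moreover have "c \<noteq> d" using c insert.hyps by auto
    ultimately show ?thesis using genspace_disjoint[OF A] insert.prems(1) c by blast
  qed
  then have "f d = 0" using insert.prems(2) insert.hyps by simp
  then show ?case using z insert.prems(3) by auto
qed simp

text \<open>A basis of a subspace on which A is triangular, stored with the diagonal entries as
  second components. The tail spans the smaller invariant subspace, so a flag grows at the head of
  the list and a given flag survives as a suffix.\<close>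

primrec flag :: "('b \<Rightarrow> 'b) \<Rightarrow> ('b \<times> 'a) list \<Rightarrow> bool" where
  "flag A [] \<longleftrightarrow> True"
| "flag A (p # ps) \<longleftrightarrow> flag A ps \<and> fst p \<notin> span (fst ` set ps) \<and>
     A (fst p) - snd p *s fst p \<in> span (fst ` set ps)"

lemma flag_basis:
  "flag A ps \<Longrightarrow> independent (fst ` set ps) \<and> distinct ps \<and> inj_on fst (set ps)"
proof (induction ps)
  case Nil
  then show ?case using independent_empty by simp
next
  case (Cons p ps)
  then have "fst p \<notin> fst ` set ps" using span_base[of "fst p" "fst ` set ps"] by auto
  then show ?case using Cons independent_insertI[of "fst p" "fst ` set ps"] by auto
qed

lemma flag_invariant:
  assumes "lin A"
  shows "flag A ps \<Longrightarrow> x \<in> span (fst ` set ps) \<Longrightarrow> A x \<in> span (fst ` set ps)"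
proof (induction ps arbitrary: x)
  case Nil
  then show ?case using assms by (simp add: lin_zero)
next
  case (Cons p ps)
  have sub: "span (fst ` set ps) \<subseteq> span (fst ` set (p # ps))" by (rule span_mono) auto
  have "A y \<in> span (fst ` set (p # ps))" if "y \<in> fst ` set (p # ps)" for y
  proof (cases "y = fst p")
    case True
    have "A (fst p) - snd p *s fst p \<in> span (fst ` set (p # ps))" using Cons.prems sub by auto
    moreover have "snd p *s fst p \<in> span (fst ` set (p # ps))" by (intro span_scale span_base) simp
    ultimately show ?thesis using True span_add[of "A (fst p) - snd p *s fst p" _ "snd p *s fst p"] by simp
  next
    case False
    then have "y \<in> span (fst ` set ps)" using that span_base by auto
    then show ?thesis using Cons sub by auto
  qed
  then show ?case using span_image_invariant[OF assms] Cons.prems(2) by blast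
qed

text \<open>With w = (A - c) v one has (A^2 - c^2) v = A w + c w, again in the smaller subspace.
  Applied to \<open>lie rho\<close>, this exhibits \<open>killing rho rho\<close> as a sum of
  squares.\<close>

lemma flag_square:
  assumes "lin A"
  shows "flag A ps \<Longrightarrow> flag (\<lambda>x. A (A x)) (map (\<lambda>p. (fst p, (snd p)\<^sup>2)) ps)"
proof (induction ps)
  case (Cons p ps)
  let ?w = "A (fst p) - snd p *s fst p"
  have w: "?w \<in> span (fst ` set ps)" using Cons.prems by simp
  have "A (A (fst p)) - (snd p)\<^sup>2 *s fst p = A ?w + snd p *s ?w"
    using assms by (simp add: lin_diff lin_scale algebra_simps power2_eq_square)
  also have "\<dots> \<in> span (fst ` set ps)"
    using w flag_invariant[OF assms _ w] Cons.prems by (auto intro: span_add span_scale)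
  finally show ?case using Cons by (simp add: image_image)
qed simp

text \<open>A repeated vector is treated separately, since the set of values does not record the
  repetition; without one, there are more vectors than the dimension.\<close>

lemma linear_relation:
  obtains c where "\<exists>i\<le>dimension. c i \<noteq> 0" "(\<Sum>i\<le>dimension. c i *s f i) = 0"
proof (cases "inj_on f {..dimension}")
  case False
  then obtain i j where ij: "i \<le> dimension" "j \<le> dimension" "i \<noteq> j" "f i = f j"
    by (auto simp: inj_on_def)
  have "(\<Sum>k\<le>dimension. (if k = i then 1 else if k = j then -1 else 0) *s f k)
      = (\<Sum>k\<in>{i,j}. (if k = i then 1 else if k = j then -1 else 0) *s f k)"
    by (rule sum.mono_neutral_right) (use ij in auto)
  also have "\<dots> = 0" using ij by simp
  finally show ?thesis using ij(1) by (intro that) auto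
next
  case True
  have "card (f ` {..dimension}) = Suc dimension" using True by (simp add: card_image)
  then have "dependent (f ` {..dimension})"
    using independent_card_le_dim[of "f ` {..dimension}" UNIV] dim_UNIV
    by (auto simp: dimension_def)
  then obtain u where u: "\<exists>v\<in>f ` {..dimension}. u v \<noteq> 0" "(\<Sum>v\<in>f ` {..dimension}. u v *s v) = 0"
    by (auto simp: dependent_finite)
  have "(\<Sum>i\<le>dimension. u (f i) *s f i) = 0"
    using u(2) by (simp add: sum.reindex[OF True])
  then show ?thesis using u(1) by (intro that[of "\<lambda>i. u (f i)"]) auto
qed

section \<open>The trace of an operator\<close>

definition trace :: "('b \<Rightarrow> 'b) \<Rightarrow> 'a" where
  "trace A = (\<Sum>b\<in>Basis. representation Basis (A b) b)"

lemma representation_lin: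
  assumes B: "independent B" "span B = UNIV" and C: "independent C" "span C = UNIV" and A: "lin A"
  shows "representation B (A v) b = (\<Sum>c\<in>C. representation C v c * representation B (A c) b)"
proof -
  have "finite C" using C finiteI_independent by simp
  then have "v = (\<Sum>c\<in>C. representation C v c *s c)"
    using sum_representation_eq[of C v C] C by simp
  then have "A v = A (\<Sum>c\<in>C. representation C v c *s c)" by (rule arg_cong)
  also have "\<dots> = (\<Sum>c\<in>C. representation C v c *s A c)"
    by (simp add: lin_sum[OF A] lin_scale[OF A])
  finally have "A v = (\<Sum>c\<in>C. representation C v c *s A c)" .
  then show ?thesis using B
    by (simp add: representation_sum representation_scale)
qed

text \<open>Each vector of \<open>Basis\<close> is expanded in B; after swapping the sums, the inner
  sum is the coordinate change back, read off from \<open>representation_lin\<close> for the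
  identity.\<close>

lemma trace_basis:
  assumes B: "independent B" "span B = UNIV" and A: "lin A"
  shows "trace A = (\<Sum>b\<in>B. representation B (A b) b)"
proof -
  note BB = independent_Basis span_Basis
  have "trace A = (\<Sum>b\<in>Basis. \<Sum>c\<in>B. representation B b c * representation Basis (A c) b)"
    unfolding trace_def
    by (intro sum.cong refl) (rule representation_lin[OF BB B A])
  also have "\<dots> = (\<Sum>c\<in>B. \<Sum>b\<in>Basis. representation Basis (A c) b * representation B b c)"
    by (subst sum.swap) (simp add: mult.commute)
  also have "\<dots> = (\<Sum>c\<in>B. representation B (A c) c)"
    by (intro sum.cong refl) (rule representation_lin[OF B BB lin_id, symmetric])
  finally show ?thesis .
qed

lemma trace_commute:
  assumes A: "lin A" and B: "lin B"
  shows "trace (\<lambda>x. A (B x)) = trace (\<lambda>x. B (A x))"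
proof -
  note BB = independent_Basis span_Basis
  have "trace (\<lambda>x. A (B x)) =
      (\<Sum>b\<in>Basis. \<Sum>c\<in>Basis. representation Basis (B b) c * representation Basis (A c) b)"
    unfolding trace_def
    by (intro sum.cong refl) (rule representation_lin[OF BB BB A])
  also have "\<dots> = (\<Sum>c\<in>Basis. \<Sum>b\<in>Basis. representation Basis (A c) b * representation Basis (B b) c)"
    by (subst sum.swap) (simp add: mult.commute)
  also have "\<dots> = trace (\<lambda>x. B (A x))"
    unfolding trace_def
    by (intro sum.cong refl) (rule representation_lin[OF BB BB B, symmetric])
  finally show ?thesis .
qed

lemma trace_plus: "trace (\<lambda>x. A x + B x) = trace A + trace B"
  by (simp add: trace_def representation_add independent_Basis span_Basis sum.distrib)

lemma trace_diff: "trace (\<lambda>x. A x - B x) = trace A - trace B"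
  by (simp add: trace_def representation_diff independent_Basis span_Basis sum_subtractf)

lemma trace_scale: "trace (\<lambda>x. c *s A x) = c * trace A"
  by (simp add: trace_def representation_scale independent_Basis span_Basis sum_distrib_left)

lemma flag_representation:
  assumes "flag A ps" "p \<in> set ps" "independent B" "fst ` set ps \<subseteq> B"
  shows "representation B (A (fst p)) (fst p) = snd p"
  using assms(1,2,4)
proof (induction ps)
  case (Cons q ps)
  show ?case
  proof (cases "p \<in> set ps")
    case True
    then show ?thesis using Cons by auto
  next
    case False
    then have p: "p = q" using Cons.prems by auto
    let ?w = "A (fst p) - snd p *s fst p"
    have w: "?w \<in> span (fst ` set ps)" and np: "fst p \<notin> span (fst ` set ps)"
      using Cons.prems p by auto
    have "representation B ?w = representation (fst ` set ps) ?w"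
      by (rule representation_extend) (use assms(3) w Cons.prems in auto)
    moreover have "representation (fst ` set ps) ?w (fst p) = 0"
      using np representation_ne_zero span_base by blast
    ultimately have 0: "representation B ?w (fst p) = 0" by simp
    have pB: "fst p \<in> B" using Cons.prems p by auto
    have "?w \<in> span B" using w Cons.prems(3) span_mono[of "fst ` set ps" B] by auto
    then have "representation B (?w + snd p *s fst p) (fst p)
        = representation B ?w (fst p) + snd p * representation B (fst p) (fst p)"
      using assms(3) pB by (subst representation_add) (auto simp: representation_scale span_base span_scale)
    then show ?thesis using 0 assms(3) pB by (simp add: representation_basis)
  qed
qed simp

lemma trace_flag:
  assumes A: "lin A" and f: "flag A ps" and s: "span (fst ` set ps) = UNIV"
  shows "trace A = (\<Sum>p\<in>set ps. snd p)"
proof -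
  note b = flag_basis[OF f]
  have "trace A = (\<Sum>b\<in>fst ` set ps. representation (fst ` set ps) (A b) b)"
    using trace_basis[OF _ s A] b by simp
  also have "\<dots> = (\<Sum>p\<in>set ps. representation (fst ` set ps) (A (fst p)) (fst p))"
    using b by (simp add: sum.reindex)
  also have "\<dots> = (\<Sum>p\<in>set ps. snd p)"
    by (intro sum.cong refl flag_representation[OF f]) (use b in auto)
  finally show ?thesis .
qed

end

section \<open>Eigenvectors over an algebraically closed field\<close>

locale acl_vector_space = fd_vector_space scale Basis
  for scale :: "'a::alg_closed_field \<Rightarrow> 'b::ab_group_add \<Rightarrow> 'b" (infixr \<open>*s\<close> 75) and Basis
begin

text \<open>Among the nonzero polynomials p with \<open>peval A p v\<close> in W take one of least
  degree. It is not constant, so it has a root d, and its cofactor q gives the eigenvector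
  \<open>peval A q v\<close> modulo W. Working modulo W replaces the passage to a quotient
  space.\<close>

lemma eigenvector_mod:
  assumes A: "lin A" and U: "subspace U" "\<And>x. x \<in> U \<Longrightarrow> A x \<in> U" and W: "subspace W"
    and "\<not> U \<subseteq> W"
  obtains v c where "v \<in> U" "v \<notin> W" "A v - c *s v \<in> W"
proof -
  obtain v where v: "v \<in> U" "v \<notin> W" using assms by auto
  define P where "P = (\<lambda>p. p \<noteq> 0 \<and> peval A p v \<in> W)"
  obtain c where c: "\<exists>i\<le>dimension. c i \<noteq> 0" "(\<Sum>i\<le>dimension. c i *s (A ^^ i) v) = 0"
    by (rule linear_relation)
  define p0 where "p0 = (\<Sum>i\<le>dimension. monom (c i) i)"
  have co: "coeff p0 j = (if j \<le> dimension then c j else 0)" for j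
    unfolding p0_def by (simp add: coeff_sum)
  have "degree p0 \<le> dimension" by (rule degree_le) (auto simp: co)
  then have "peval A p0 v = 0" using c(2) by (simp add: peval_bound co)
  moreover have "p0 \<noteq> 0" using c(1) co by (metis coeff_0)
  ultimately have "P p0" using subspace_0[OF W] by (simp add: P_def)
  then obtain p where p: "P p" "\<And>q. P q \<Longrightarrow> degree p \<le> degree q"
    using ex_has_least_nat[of P p0 degree] by auto
  have "degree p \<noteq> 0"
  proof
    assume "degree p = 0"
    then obtain a where a: "p = [:a:]" by (auto elim: degree_eq_zeroE)
    then have "a \<noteq> 0" and av: "a *s v \<in> W" using p(1) by (auto simp: P_def peval_def)
    have "inverse a *s (a *s v) \<in> W" by (rule subspace_scale[OF W av])
    then show False using v(2) \<open>a \<noteq> 0\<close> by simp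
  qed
  then obtain d where "poly p d = 0" using alg_closed_imp_poly_has_root[of p] by auto
  then obtain q where q: "p = [:- d, 1:] * q" by (auto simp: poly_eq_0_iff_dvd)
  have "q \<noteq> 0" using q p(1) by (auto simp: P_def)
  then have "degree p = Suc (degree q)" unfolding q by (subst degree_mult_eq) simp_all
  then have "\<not> P q" using p(2)[of q] by auto
  then have "peval A q v \<notin> W" using \<open>q \<noteq> 0\<close> by (simp add: P_def)
  moreover have "A (peval A q v) - d *s peval A q v \<in> W"
    using p(1) peval_linear_factor[OF A, of d q v] unfolding P_def q by (simp only: simp_thms)
  moreover have "peval A q v \<in> U" by (rule peval_in_subspace[OF U v(1)])
  ultimately show ?thesis by (intro that)
qed

text \<open>Take an invariant V strictly above W of least dimension. For each f, the vectors of V on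
  which f acts modulo W by a suitable scalar form such a subspace again, since F commutes; by
  minimality it is V. So every vector of V outside W is a common eigenvector modulo W.\<close>

lemma common_eigenvector_mod:
  assumes lin: "\<And>f. f \<in> F \<Longrightarrow> lin f"
    and comm: "\<And>f g x. f \<in> F \<Longrightarrow> g \<in> F \<Longrightarrow> f (g x) = g (f x)"
    and U: "subspace U" "\<And>f x. f \<in> F \<Longrightarrow> x \<in> U \<Longrightarrow> f x \<in> U"
    and W: "subspace W" "\<And>f x. f \<in> F \<Longrightarrow> x \<in> W \<Longrightarrow> f x \<in> W"
    and "W \<subset> U"
  obtains v c where "v \<in> U" "v \<notin> W" "\<And>f. f \<in> F \<Longrightarrow> f v - c f *s v \<in> W"
proof -
  define P where "P = (\<lambda>V. subspace V \<and> (\<forall>f\<in>F. \<forall>x\<in>V. f x \<in> V) \<and> W \<subset> V \<and> V \<subseteq> U)"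
  have "P U" using U assms by (auto simp: P_def)
  then obtain V where V: "P V" and min: "\<And>V'. P V' \<Longrightarrow> dim V \<le> dim V'"
    using ex_has_least_nat[of P U dim] by auto
  have "\<exists>c. \<forall>v\<in>V. f v - c *s v \<in> W" if f: "f \<in> F" for f
  proof -
    obtain v c where vc: "v \<in> V" "v \<notin> W" "f v - c *s v \<in> W"
      using eigenvector_mod[OF lin[OF f], of V W] V W f by (auto simp: P_def)
    define V' where "V' = {x \<in> V. f x - c *s x \<in> W}"
    have "P V'" unfolding P_def
    proof (intro conjI ballI)
      show "subspace V'"
      proof (rule subspaceI)
        show "0 \<in> V'" using V W lin_zero[OF lin[OF f]]
          by (auto simp: V'_def P_def subspace_0)
        show "x + y \<in> V'" if "x \<in> V'" "y \<in> V'" for x y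
        proof -
          have "f (x + y) - c *s (x + y) = (f x - c *s x) + (f y - c *s y)"
            by (simp add: lin_add[OF lin[OF f]] algebra_simps)
          then show ?thesis using that V W by (auto simp: V'_def P_def subspace_add)
        qed
        show "a *s x \<in> V'" if "x \<in> V'" for a x
        proof -
          have "f (a *s x) - c *s (a *s x) = a *s (f x - c *s x)"
            by (simp add: lin_scale[OF lin[OF f]] algebra_simps)
          then show ?thesis using that V W by (auto simp: V'_def P_def subspace_scale)
        qed
      qed
      show "g x \<in> V'" if "g \<in> F" "x \<in> V'" for g x
      proof -
        have "f (g x) - c *s g x = g (f x - c *s x)"
          using comm[OF f that(1)] by (simp add: lin_diff[OF lin[OF that(1)]] lin_scale[OF lin[OF that(1)]])
        then show ?thesis using that V W by (auto simp: V'_def P_def)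
      qed
      show "W \<subset> V'"
      proof
        show "W \<subseteq> V'" using V W f by (auto simp: V'_def P_def subspace_diff subspace_scale)
        show "W \<noteq> V'" using vc by (auto simp: V'_def)
      qed
      show "V' \<subseteq> U" using V by (auto simp: V'_def P_def)
    qed
    then have "V' = V"
      using subspace_dim_equal[of V' V] min[of V'] V by (auto simp: V'_def P_def)
    then show ?thesis by (auto simp: V'_def)
  qed
  then obtain c where c: "\<And>f v. f \<in> F \<Longrightarrow> v \<in> V \<Longrightarrow> f v - c f *s v \<in> W" by metis
  obtain v where "v \<in> V" "v \<notin> W" using V by (auto simp: P_def)
  moreover have "V \<subseteq> U" using V by (simp add: P_def)
  ultimately show ?thesis using that[of v c] c by blast
qed

text \<open>Starting from a given flag lets \<open>killing_rho\<close> prescribe one diagonal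
  entry.\<close>

lemma flag_extend:
  assumes A: "lin A"
  shows "flag A ps \<Longrightarrow> \<exists>qs. flag A (qs @ ps) \<and> span (fst ` set (qs @ ps)) = UNIV"
proof (induction "dimension - length ps" arbitrary: ps rule: less_induct)
  case less
  show ?case
  proof (cases "span (fst ` set ps) = UNIV")
    case True
    then show ?thesis using less.prems by (intro exI[of _ "[]"]) simp
  next
    case False
    then obtain v c where v: "v \<notin> span (fst ` set ps)" "A v - c *s v \<in> span (fst ` set ps)"
      using eigenvector_mod[OF A, of UNIV "span (fst ` set ps)"] by auto
    then have fl: "flag A ((v, c) # ps)" using less.prems by simp
    have "length ((v, c) # ps) = card (fst ` set ((v, c) # ps))"
      using flag_basis[OF fl] by (metis card_image distinct_card)
    also have "\<dots> \<le> dimension"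
      using flag_basis[OF fl] independent_card_le_dim[of "fst ` set ((v, c) # ps)" UNIV]
      by (simp add: dimension_def dim_UNIV)
    finally have "dimension - length ((v, c) # ps) < dimension - length ps" by simp
    from less.hyps[OF this fl] obtain qs where
      "flag A (qs @ (v, c) # ps)" "span (fst ` set (qs @ (v, c) # ps)) = UNIV" by blast
    then show ?thesis by (intro exI[of _ "qs @ [(v, c)]"]) simp
  qed
qed

text \<open>Modulo the smaller subspace, A multiplies each vector of a flag by its diagonal entry;
  nilpotency forces these entries to be 0.\<close>

lemma trace_nilpotent:
  assumes A: "lin A" and nil: "\<And>x. \<exists>n. (A ^^ n) x = 0"
  shows "trace A = 0"
proof -
  obtain ps where ps: "flag A ps" "span (fst ` set ps) = UNIV"
    using flag_extend[OF A, of "[]"] by auto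
  have "flag A ps \<Longrightarrow> p \<in> set ps \<Longrightarrow> snd p = 0" for p ps
  proof (induction ps)
    case (Cons q ps)
    show ?case
    proof (cases "p \<in> set ps")
      case True
      then show ?thesis using Cons by simp
    next
      case False
      then have pq: "p = q" using Cons.prems by simp
      let ?W = "span (fst ` set ps)"
      let ?v = "fst q" and ?c = "snd q"
      have v: "?v \<notin> ?W" "A ?v - ?c *s ?v \<in> ?W" using Cons.prems by auto
      have inv: "A x \<in> ?W" if "x \<in> ?W" for x using flag_invariant[OF A _ that] Cons.prems by simp
      have "(A ^^ n) ?v - ?c ^ n *s ?v \<in> ?W" for n
      proof (induction n)
        case (Suc n)
        have "(A ^^ Suc n) ?v - ?c ^ Suc n *s ?v
            = A ((A ^^ n) ?v - ?c ^ n *s ?v) + ?c ^ n *s (A ?v - ?c *s ?v)"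
          by (simp add: lin_diff[OF A] lin_scale[OF A] algebra_simps)
        then show ?case using inv[OF Suc.IH] v(2) by (auto intro: span_add span_scale)
      qed (simp add: span_zero)
      moreover obtain n where "(A ^^ n) ?v = 0" using nil by blast
      ultimately have "- (?c ^ n *s ?v) \<in> ?W" by (metis diff_0)
      then have "- (?c ^ n) *s ?v \<in> ?W" by simp
      then have "inverse (- (?c ^ n)) *s (- (?c ^ n) *s ?v) \<in> ?W" by (rule span_scale)
      then have "?c ^ n = 0" using v(1) by (cases "?c ^ n = 0") auto
      then show ?thesis using pq by simp
    qed
  qed simp
  then have "(\<Sum>p\<in>set ps. snd p) = 0" using ps by (intro sum.neutral) auto
  then show ?thesis using trace_flag[OF A ps] by simp
qed

text \<open>B = A - c maps the new vector v into the invariant span W of the tail. Either B has a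
  kernel on W, or by dimension it maps W onto W, and subtracting some w in W from v gives a vector
  killed by B.\<close>

lemma flag_eigenvector:
  assumes A: "lin A"
  shows "flag A ps \<Longrightarrow> p \<in> set ps \<Longrightarrow> \<exists>v. v \<noteq> 0 \<and> A v = snd p *s v"
proof (induction ps)
  case (Cons q ps)
  show ?case
  proof (cases "p \<in> set ps")
    case True
    then show ?thesis using Cons by simp
  next
    case False
    then have pq: "p = q" using Cons.prems by simp
    let ?W = "span (fst ` set ps)"
    let ?v = "fst q" and ?c = "snd q"
    let ?B = "\<lambda>y. A y - ?c *s y"
    have v: "?v \<notin> ?W" "?B ?v \<in> ?W" using Cons.prems by auto
    have B: "lin ?B" by (rule lin_shift[OF A])
    have inv: "?B ` ?W \<subseteq> ?W"
      using flag_invariant[OF A] Cons.prems by (auto intro: span_diff span_scale)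
    show ?thesis
    proof (cases "inj_on ?B ?W")
      case True
      interpret P: finite_dimensional_vector_space_pair_1 scale Basis scale ..
      have "dim (?B ` ?W) = dim ?W"
        using P.dim_image_eq[OF B, of ?W] True by (simp only: span_span)
      moreover have "subspace (?B ` ?W)"
        using module_hom.subspace_image[OF lin_module_hom[OF B]] by simp
      ultimately have "?B ` ?W = ?W"
        using subspace_dim_equal[of "?B ` ?W" ?W] inv by simp
      then obtain w where w: "w \<in> ?W" "?B ?v = ?B w" using v(2) by (metis (no_types, lifting) imageE)
      then have "?B (?v - w) = 0" using lin_diff[OF B, of ?v w] by simp
      moreover have "?v - w \<noteq> 0" using w v by auto
      ultimately show ?thesis using pq by (intro exI[of _ "?v - w"]) simp
    next
      case False
      then obtain x y where "x \<noteq> y" "?B x = ?B y" by (auto simp: inj_on_def)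
      then have "?B (x - y) = 0" "x - y \<noteq> 0" using lin_diff[OF B, of x y] by simp_all
      then show ?thesis using pq by (intro exI[of _ "x - y"]) simp
    qed
  qed
qed simp

text \<open>If the span were proper, there would be an eigenvector v modulo it. The components of (A
  - c) v for eigenvalues other than c are removed by changing v with \<open>genspace_surj\<close>;
  what remains lies in \<open>genspace A c\<close>, hence so does the corrected v.\<close>

lemma span_genspaces:
  assumes A: "lin A"
  shows "span (\<Union>c. genspace A c) = UNIV"
proof (rule ccontr)
  let ?G = "\<Union>c. genspace A c"
  assume "span ?G \<noteq> UNIV"
  then obtain v c where v: "v \<notin> span ?G" "A v - c *s v \<in> span ?G"
    using eigenvector_mod[OF A, of UNIV "span ?G"] by auto
  obtain F f where F: "finite F" "\<And>d. d \<in> F \<Longrightarrow> f d \<in> genspace A d" "A v - c *s v = sum f F"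
    using span_Union_sum[OF _ v(2)] subspace_genspace[OF A] by metis
  have "\<exists>y\<in>genspace A d. A y - c *s y = f d" if "d \<in> F" "d \<noteq> c" for d
    using genspace_surj[OF A F(2)[OF that(1)]] that(2) by auto
  then obtain g where g: "\<And>d. d \<in> F \<Longrightarrow> d \<noteq> c \<Longrightarrow> g d \<in> genspace A d \<and> A (g d) - c *s g d = f d"
    by metis
  define v' where "v' = v - sum g (F - {c})"
  have "A v' - c *s v' = (A v - c *s v) - (\<Sum>d\<in>F - {c}. A (g d) - c *s g d)"
    by (simp add: v'_def lin_diff[OF A] lin_sum[OF A] sum_subtractf scale_sum_right algebra_simps)
  also have "(\<Sum>d\<in>F - {c}. A (g d) - c *s g d) = sum f (F - {c})"
    by (rule sum.cong) (use g in auto)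
  also have "(A v - c *s v) - sum f (F - {c}) = (if c \<in> F then f c else 0)"
    using F(1,3) by (simp add: sum.remove)
  also have "\<dots> \<in> genspace A c" using F(2) subspace_0[OF subspace_genspace[OF A]] by auto
  finally obtain n where n: "((\<lambda>y. A y - c *s y) ^^ n) (A v' - c *s v') = 0"
    by (rule genspaceE)
  then have "((\<lambda>y. A y - c *s y) ^^ Suc n) v' = 0" by (simp add: funpow_Suc_right del: funpow.simps)
  then have "v' \<in> genspace A c" unfolding genspace_def by blast
  then have "v' \<in> span ?G" by (intro span_base) auto
  moreover have "sum g (F - {c}) \<in> span ?G" by (intro span_sum span_base) (use g in auto)
  ultimately have "v' + sum g (F - {c}) \<in> span ?G" by (rule span_add)
  then show False using v(1) by (simp add: v'_def)
qed

lemma finite_eigenvalues: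
  assumes A: "lin A"
  shows "finite {c. genspace A c \<noteq> {0}}"
proof -
  let ?C = "{c. genspace A c \<noteq> {0}}"
  have "\<exists>x. x \<in> genspace A c \<and> x \<noteq> 0" if "c \<in> ?C" for c
    using that subspace_0[OF subspace_genspace[OF A]] by auto
  then obtain f where f: "\<And>c. c \<in> ?C \<Longrightarrow> f c \<in> genspace A c \<and> f c \<noteq> 0" by metis
  have ind: "c i = 0" if "finite F" "F \<subseteq> ?C" "(\<Sum>i\<in>F. c i *s f i) = 0" "i \<in> F" for F c i
  proof -
    have "c j *s f j \<in> genspace A j" if "j \<in> F" for j
      using f[of j] that \<open>F \<subseteq> ?C\<close> by (intro subspace_scale subspace_genspace[OF A]) auto
    then have "c i *s f i = 0"
      using genspace_independent[OF A that(1) _ that(3,4)] by simp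
    moreover have "f i \<noteq> 0" using f[of i] that by blast
    ultimately show ?thesis by simp
  qed
  have "inj_on f ?C" and "independent (f ` ?C)"
    by (rule independent_family, fact ind)+
  then show ?thesis using finiteI_independent finite_imageD by blast
qed

lemma semisimple_part_exists:
  assumes A: "lin A"
  obtains S where "lin S" "\<And>c x. x \<in> genspace A c \<Longrightarrow> S x = c *s x"
proof -
  have "\<exists>F f. finite F \<and> (\<forall>c\<in>F. f c \<in> genspace A c) \<and> x = sum f F" for x
    using span_Union_sum[of UNIV "genspace A" x] subspace_genspace[OF A] span_genspaces[OF A]
    by (metis UNIV_I)
  then obtain F f where F: "\<And>x. finite (F x)" "\<And>x c. c \<in> F x \<Longrightarrow> f x c \<in> genspace A c"
      "\<And>x. x = sum (f x) (F x)" by metis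
  define S where "S = (\<lambda>x. \<Sum>c\<in>F x. c *s f x c)"
  \<comment> \<open>The value does not depend on the chosen decomposition: two decompositions,
    extended by 0 to a common index set, agree termwise by \<open>genspace_independent\<close>.
    Linearity follows by combining decompositions.\<close>
  have S: "S x = (\<Sum>c\<in>D. c *s g c)"
    if D: "finite D" "\<And>c. c \<in> D \<Longrightarrow> g c \<in> genspace A c" "x = sum g D" for x D g
  proof -
    define f' where "f' = (\<lambda>c. if c \<in> F x then f x c else 0)"
    define g' where "g' = (\<lambda>c. if c \<in> D then g c else 0)"
    have 0: "0 \<in> genspace A c" for c using subspace_0[OF subspace_genspace[OF A]] .
    have f1: "sum f' (F x \<union> D) = x"
      using F(3)[of x] sum.mono_neutral_right[of "F x \<union> D" "F x" f'] F(1)[of x] D(1)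
      by (auto simp: f'_def)
    have g1: "sum g' (F x \<union> D) = x"
      using D(3) sum.mono_neutral_right[of "F x \<union> D" "D" g'] F(1)[of x] D(1)
      by (auto simp: g'_def)
    have "f' c - g' c = 0" if "c \<in> F x \<union> D" for c
    proof (rule genspace_independent[OF A _ _ _ that, of "\<lambda>c. f' c - g' c"])
      show "finite (F x \<union> D)" using F(1) D(1) by simp
      show "f' c - g' c \<in> genspace A c" for c
        using F(2) D(2) 0 by (intro subspace_diff subspace_genspace[OF A]) (auto simp: f'_def g'_def)
      show "(\<Sum>c\<in>F x \<union> D. f' c - g' c) = 0" using f1 g1 by (simp add: sum_subtractf)
    qed
    then have eq: "(\<Sum>c\<in>F x \<union> D. c *s f' c) = (\<Sum>c\<in>F x \<union> D. c *s g' c)"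
      by (intro sum.cong) auto
    have "(\<Sum>c\<in>F x \<union> D. c *s f' c) = S x"
      using sum.mono_neutral_right[of "F x \<union> D" "F x" "\<lambda>c. c *s f' c"] F(1)[of x] D(1)
      by (auto simp: f'_def S_def)
    moreover have "(\<Sum>c\<in>F x \<union> D. c *s g' c) = (\<Sum>c\<in>D. c *s g c)"
      using sum.mono_neutral_right[of "F x \<union> D" "D" "\<lambda>c. c *s g' c"] F(1)[of x] D(1)
      by (auto simp: g'_def)
    ultimately show ?thesis using eq by simp
  qed
  have "lin S"
  proof (rule linI)
    fix x y
    define f' where "f' = (\<lambda>c. if c \<in> F x then f x c else 0)"
    define g' where "g' = (\<lambda>c. if c \<in> F y then f y c else 0)"
    let ?D = "F x \<union> F y"
    have fin: "finite ?D" using F(1) by simp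
    have 0: "0 \<in> genspace A c" for c using subspace_0[OF subspace_genspace[OF A]] .
    have f1: "x = sum f' ?D"
      using F(3)[of x] sum.mono_neutral_right[of ?D "F x" f'] fin by (auto simp: f'_def)
    have g1: "y = sum g' ?D"
      using F(3)[of y] sum.mono_neutral_right[of ?D "F y" g'] fin by (auto simp: g'_def)
    have f2: "f' c \<in> genspace A c" and g2: "g' c \<in> genspace A c" for c
      using F(2) 0 by (auto simp: f'_def g'_def)
    have "S (x + y) = (\<Sum>c\<in>?D. c *s (f' c + g' c))"
      by (rule S[OF fin]) (use f1 g1 f2 g2 in \<open>auto simp: sum.distrib subspace_add subspace_genspace[OF A]\<close>)
    also have "\<dots> = (\<Sum>c\<in>?D. c *s f' c) + (\<Sum>c\<in>?D. c *s g' c)"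
      by (simp add: sum.distrib scale_right_distrib)
    also have "(\<Sum>c\<in>?D. c *s f' c) = S x" by (rule S[OF fin f2 f1, symmetric])
    also have "(\<Sum>c\<in>?D. c *s g' c) = S y" by (rule S[OF fin g2 g1, symmetric])
    finally show "S (x + y) = S x + S y" .
  next
    fix a x
    have "a *s x = a *s sum (f x) (F x)" using F(3)[of x] by simp
    then have "S (a *s x) = (\<Sum>c\<in>F x. c *s (a *s f x c))"
      by (intro S[OF F(1)]) (auto simp: F(2) subspace_scale subspace_genspace[OF A] scale_sum_right)
    then show "S (a *s x) = a *s S x"
      by (simp add: S_def scale_sum_right mult.commute)
  qed
  moreover have "S x = c *s x" if "x \<in> genspace A c" for c x
    using S[of "{c}" "\<lambda>_. x" x] that by simp
  ultimately show ?thesis by (rule that)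
qed

end

subsection \<open>The Killing form\<close>

context simple_lie_algebra
begin

definition fd_basis :: "'g set" where
  "fd_basis = (SOME B. finite B \<and> independent B \<and> span B = UNIV)"

lemma fd_basis: "finite fd_basis" "independent fd_basis" "span fd_basis = UNIV"
proof -
  obtain S where S: "finite S" "span S = UNIV" using finite_dimensional by blast
  obtain B where B: "B \<subseteq> S" "independent B" "S \<subseteq> span B"
    using maximal_independent_subset[of S] by blast
  have "span S \<subseteq> span B" using B(3) by (simp add: span_minimal)
  then have "finite B \<and> independent B \<and> span B = UNIV"
    using B S finite_subset by auto
  then have "finite fd_basis \<and> independent fd_basis \<and> span fd_basis = UNIV"
    unfolding fd_basis_def by (rule someI)
  then show "finite fd_basis" "independent fd_basis" "span fd_basis = UNIV" by auto
qed

end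

sublocale simple_lie_algebra \<subseteq> acl_vector_space scale fd_basis
  by unfold_locales (simp_all add: fd_basis)

context simple_lie_algebra
begin

lemma lin_lie: "lin (lie x)"
  by (rule linear_lie_right)

lemma lin_lie_left: "lin (\<lambda>x. lie x y)"
  by (rule linear_lie_left)

lemmas lie_add_right = lin_add[OF lin_lie] and lie_scale_right = lin_scale[OF lin_lie]
  and lie_zero_right = lin_zero[OF lin_lie] and lie_sum_right = lin_sum[OF lin_lie]
  and lie_diff_right = lin_diff[OF lin_lie] and lie_minus_right = lin_minus[OF lin_lie]
  and lie_add_left = lin_add[OF lin_lie_left] and lie_scale_left = lin_scale[OF lin_lie_left]
  and lie_zero_left = lin_zero[OF lin_lie_left] and lie_sum_left = lin_sum[OF lin_lie_left]
  and lie_diff_left = lin_diff[OF lin_lie_left]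

lemma lie_anti: "lie x y = - lie y x"
proof -
  have "lie (x + y) (x + y) = 0" by (rule lie_self)
  then have "lie x y + lie y x = 0"
    unfolding lie_add_left lie_add_right by (simp add: lie_self add.commute)
  then show ?thesis by (rule eq_neg_iff_add_eq_0[THEN iffD2])
qed

lemma lie_derivation: "lie x (lie y z) = lie (lie x y) z + lie y (lie x z)"
proof -
  have "lie y (lie z x) = - lie y (lie x z)" "lie z (lie x y) = - lie (lie x y) z"
    using lie_anti[of z x] lie_anti[of z "lie x y"] by (simp_all add: lie_minus_right)
  then show ?thesis using jacobi[of x y z] by (simp add: algebra_simps)
qed

text \<open>The Leibniz rule reads (ad t - c - d) [x, y] = [(ad t - c) x, y] + [x, (ad t - d) y].
  Each summand has a smaller total exponent, so m + n applications suffice.\<close>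

lemma lie_genspace:
  assumes "x \<in> genspace (lie t) c" "y \<in> genspace (lie t) d"
  shows "lie x y \<in> genspace (lie t) (c + d)"
proof -
  let ?B = "\<lambda>c y. lie t y - c *s y"
  have "(?B c ^^ m) x = 0 \<Longrightarrow> (?B d ^^ n) y = 0 \<Longrightarrow> (?B (c + d) ^^ (m + n)) (lie x y) = 0" for m n
  proof (induction "m + n" arbitrary: m n x y)
    case 0
    then show ?case by (simp add: lie_zero_left)
  next
    case (Suc k)
    have L: "lin (?B (c + d) ^^ k)" by (intro lin_funpow lin_shift lin_lie)
    have *: "?B (c + d) (lie x y) = lie (?B c x) y + lie x (?B d y)"
      using lie_derivation[of t x y]
      by (simp add: lie_diff_left lie_diff_right lie_scale_left lie_scale_right algebra_simps)
    have "(?B (c + d) ^^ k) (lie (?B c x) y) = 0"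
    proof (cases m)
      case 0
      then have "x = 0" using Suc.prems by simp
      then show ?thesis by (simp add: lie_zero_left lie_zero_right lin_zero[OF L])
    next
      case (Suc m')
      have "(?B c ^^ m') (?B c x) = 0"
        using Suc.prems(1) Suc by (simp add: funpow_Suc_right del: funpow.simps)
      then show ?thesis using Suc.hyps(1)[of m' n "?B c x" y] Suc.hyps(2) Suc.prems(2) Suc by simp
    qed
    moreover have "(?B (c + d) ^^ k) (lie x (?B d y)) = 0"
    proof (cases n)
      case 0
      then have "y = 0" using Suc.prems by simp
      then show ?thesis by (simp add: lie_zero_right lin_zero[OF L])
    next
      case (Suc n')
      have "(?B d ^^ n') (?B d y) = 0"
        using Suc.prems(2) Suc by (simp add: funpow_Suc_right del: funpow.simps)
      then show ?thesis using Suc.hyps(1)[of m n' x "?B d y"] Suc.hyps(2) Suc.prems(1) Suc by simp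
    qed
    ultimately have "(?B (c + d) ^^ k) (?B (c + d) (lie x y)) = 0"
      unfolding * by (simp add: lin_add[OF L])
    then show ?case unfolding Suc.hyps(2)[symmetric]
      by (simp add: funpow_Suc_right del: funpow.simps)
  qed
  then show ?thesis using assms unfolding genspace_def by blast
qed

text \<open>The \<open>sl2\<close> computation: e maps f^(j+1) v to (j + 1) (c - j) f^j v. For the
  last nonzero power f^n v this image is 0 at j = n, and characteristic 0 leaves c = n.\<close>

lemma highest_weight_integral:
  assumes hf: "lie (lie e f) f = (- 2) *s f" and v: "v \<noteq> 0" "lie e v = 0" "lie (lie e f) v = c *s v"
    and nil: "\<exists>n. (lie f ^^ n) v = 0"
  obtains n :: nat where "c = of_nat n" "\<And>j. j \<le> n \<Longrightarrow> (lie f ^^ j) v \<noteq> 0"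
proof -
  let ?h = "lie e f"
  have h: "lie ?h ((lie f ^^ j) v) = (c - 2 * of_nat j) *s (lie f ^^ j) v" for j
  proof (induction j)
    case (Suc j)
    have "lie ?h ((lie f ^^ Suc j) v) = lie (lie ?h f) ((lie f ^^ j) v) + lie f (lie ?h ((lie f ^^ j) v))"
      using lie_derivation[of ?h f "(lie f ^^ j) v"] by simp
    also have "\<dots> = ((- 2) + (c - 2 * of_nat j)) *s (lie f ^^ Suc j) v"
      unfolding hf Suc lie_scale_left lie_scale_right scale_left_distrib by simp
    finally show ?case by (simp add: algebra_simps)
  qed (simp add: v)
  have e: "lie e ((lie f ^^ Suc j) v) = (of_nat (Suc j) * (c - of_nat j)) *s (lie f ^^ j) v" for j
  proof (induction j)
    case 0
    then show ?case using lie_derivation[of e f v] v by (simp add: lie_zero_right)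
  next
    case (Suc j)
    have "lie e ((lie f ^^ Suc (Suc j)) v)
        = lie ?h ((lie f ^^ Suc j) v) + lie f (lie e ((lie f ^^ Suc j) v))"
      using lie_derivation[of e f "(lie f ^^ Suc j) v"] by simp
    also have "\<dots> = ((c - 2 * of_nat (Suc j)) + of_nat (Suc j) * (c - of_nat j)) *s (lie f ^^ Suc j) v"
      unfolding h Suc by (simp add: lie_scale_right scale_left_distrib)
    also have "(c - 2 * of_nat (Suc j)) + of_nat (Suc j) * (c - of_nat j)
        = of_nat (Suc (Suc j)) * (c - of_nat (Suc j))"
      by (simp add: algebra_simps)
    finally show ?case .
  qed
  obtain n where n: "(lie f ^^ n) v \<noteq> 0" "lie f ((lie f ^^ n) v) = 0"
    by (rule last_nonzero[OF v(1) nil])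
  have "(of_nat (Suc n) * (c - of_nat n)) *s (lie f ^^ n) v = 0"
    using e[of n] n(2) by (simp add: lie_zero_right)
  then have "of_nat (Suc n) * (c - of_nat n) = 0" using n(1) by simp
  then have "c = of_nat n" using of_nat_neq_0[of n, where 'a = 'k] by (simp del: of_nat_Suc)
  moreover have "(lie f ^^ j) v \<noteq> 0" if "j \<le> n" for j
    using funpow_zero_mono[OF lin_lie _ that] n(1) by blast
  ultimately show ?thesis by (rule that)
qed

definition killing :: "'g \<Rightarrow> 'g \<Rightarrow> 'k" where
  "killing x y = trace (\<lambda>z. lie x (lie y z))"

lemma killing_add_left: "killing (x + y) z = killing x z + killing y z"
  by (simp add: killing_def lie_add_left trace_plus)

lemma killing_add_right: "killing x (y + z) = killing x y + killing x z"
  by (simp add: killing_def lie_add_left lie_add_right trace_plus)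

lemma killing_scale_left: "killing (c *s x) y = c * killing x y"
  by (simp add: killing_def lie_scale_left trace_scale)

lemma killing_scale_right: "killing x (c *s y) = c * killing x y"
  by (simp add: killing_def lie_scale_left lie_scale_right trace_scale)

lemma killing_zero_right: "killing x 0 = 0"
  using killing_scale_right[of x 0 0] by simp

lemma killing_sum_right: "killing x (sum f S) = (\<Sum>a\<in>S. killing x (f a))"
  by (induction S rule: infinite_finite_induct) (simp_all add: killing_zero_right killing_add_right)

lemma lie_lie: "lie (lie x y) z = lie x (lie y z) - lie y (lie x z)"
  by (simp add: lie_derivation[of x y z])

text \<open>Both sides are differences of traces of triple products; cyclicity of the trace
  identifies the terms that differ.\<close>

lemma killing_invariant: "killing (lie x y) z = killing x (lie y z)"
proof -
  have "killing (lie x y) z = trace (\<lambda>w. lie x (lie y (lie z w))) - trace (\<lambda>w. lie y (lie x (lie z w)))"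
    unfolding killing_def by (simp add: lie_lie trace_diff)
  also have "trace (\<lambda>w. lie y (lie x (lie z w))) = trace (\<lambda>w. lie x (lie z (lie y w)))"
    by (rule trace_commute[OF lin_lie lin_comp[OF lin_lie lin_lie]])
  also have "trace (\<lambda>w. lie x (lie y (lie z w))) - trace (\<lambda>w. lie x (lie z (lie y w)))
      = killing x (lie y z)"
    unfolding killing_def by (simp add: lie_lie lie_diff_right trace_diff)
  finally show ?thesis .
qed

text \<open>By invariance the radical of the form is an ideal; simplicity makes it 0 or everything,
  and the pair a, b excludes the latter.\<close>

lemma killing_nondegenerate:
  assumes "killing a b \<noteq> 0" and x: "\<And>y. killing x y = 0"
  shows "x = 0"
proof -
  let ?R = "{x. \<forall>y. killing x y = 0}"
  have "ideal ?R" unfolding ideal_def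
  proof (intro conjI allI ballI)
    show "subspace ?R"
      using killing_scale_left[of 0] by (intro subspaceI) (auto simp: killing_add_left killing_scale_left)
    show "lie x y \<in> ?R" if "y \<in> ?R" for x y
    proof -
      have "killing (lie y x) z = 0" for z using that by (simp add: killing_invariant)
      moreover have "killing (lie x y) z = (-1) * killing (lie y x) z" for z
        unfolding killing_scale_left[symmetric] using lie_anti[of x y] by simp
      ultimately show ?thesis by simp
    qed
  qed
  moreover have "?R \<noteq> UNIV" using assms(1) by blast
  ultimately have "?R = {0}" using ideal_trivial by blast
  then show ?thesis using x by blast
qed

section \<open>Automorphisms and regular elements\<close>

lemma inner_automorphism_linear: "f \<in> inner_automorphisms \<Longrightarrow> lin f"
proof (induction rule: inner_automorphisms.induct)
  case id
  then show ?case by (rule linI) simp_all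
next
  case (step x f)
  have "lin (exp_ad x)"
  proof (rule linI)
    fix y z c
    have L: "lin (lie x ^^ n)" for n by (intro lin_funpow lin_lie)
    show "exp_ad x (y + z) = exp_ad x y + exp_ad x z"
      unfolding exp_ad_def by (simp add: lin_add[OF L] scale_right_distrib sum.distrib)
    show "exp_ad x (c *s y) = c *s exp_ad x y"
      unfolding exp_ad_def by (simp add: lin_scale[OF L] scale_sum_right mult.commute)
  qed
  then show ?case using lin_comp[OF _ step.IH] by (simp add: comp_def)
qed

text \<open>s maps the centralizer of x onto that of s x, so the two have the same
  dimension.\<close>

lemma regular_automorphism:
  assumes s: "lie_automorphism s" and e: "regular (s x)" shows "regular x"
proof -
  have s': "lin s" "bij s" "\<And>x y. s (lie x y) = lie (s x) (s y)"
    using s by (auto simp: lie_automorphism_def)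
  have "centralizer (s x) = s ` centralizer x"
  proof (intro set_eqI iffI)
    fix y assume y: "y \<in> centralizer (s x)"
    obtain z where z: "y = s z" using s'(2) by (metis bij_pointE)
    then have "s (lie x z) = s 0" using y by (simp add: centralizer_def s'(3) lin_zero[OF s'(1)])
    then have "lie x z = 0" using s'(2) by (simp add: bij_def inj_eq)
    then show "y \<in> s ` centralizer x" using z by (auto simp: centralizer_def)
  next
    fix y assume "y \<in> s ` centralizer x"
    then show "y \<in> centralizer (s x)"
      using lin_zero[OF s'(1)] by (auto simp: centralizer_def simp flip: s'(3))
  qed
  moreover have "dim (s ` centralizer x) = dim (centralizer x)"
  proof -
    interpret P: finite_dimensional_vector_space_pair_1 scale fd_basis scale ..
    show ?thesis using s'(2) by (intro P.dim_image_eq[OF s'(1)]) (auto simp: bij_def inj_on_def)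
  qed
  ultimately show ?thesis using e by (simp add: regular_def)
qed

end

section \<open>Linear functionals and biorthogonal families\<close>

context lie_algebra
begin

lemma dual_add: "\<phi> \<in> dual T \<Longrightarrow> x \<in> T \<Longrightarrow> y \<in> T \<Longrightarrow> \<phi> (x + y) = \<phi> x + \<phi> y"
  and dual_scale: "\<phi> \<in> dual T \<Longrightarrow> x \<in> T \<Longrightarrow> \<phi> (c *s x) = c * \<phi> x"
  and dual_outside: "\<phi> \<in> dual T \<Longrightarrow> x \<notin> T \<Longrightarrow> \<phi> x = 0"
  by (auto simp: dual_def)

lemma dual_sum:
  assumes "\<phi> \<in> dual T" "subspace T" "\<And>i. i \<in> I \<Longrightarrow> f i \<in> T"
  shows "\<phi> (sum f I) = (\<Sum>i\<in>I. \<phi> (f i))"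
  using assms(3)
proof (induction I rule: infinite_finite_induct)
  case (insert i I)
  then have "sum f I \<in> T" using subspace_sum[OF assms(2)] by blast
  then show ?case using insert assms by (simp add: dual_add)
qed (use dual_scale[OF assms(1) subspace_0[OF assms(2)], of 0] in simp_all)

lemma dual_eqI:
  assumes "\<phi> \<in> dual T" "\<psi> \<in> dual T" "\<And>h. h \<in> T \<Longrightarrow> \<phi> h = \<psi> h"
  shows "\<phi> = \<psi>"
  using assms dual_outside by (metis ext)

lemma dual_zero: "(\<lambda>_. 0) \<in> dual T"
  by (simp add: dual_def)

lemma dual_plus: "\<phi> \<in> dual T \<Longrightarrow> \<psi> \<in> dual T \<Longrightarrow> (\<lambda>h. \<phi> h + \<psi> h) \<in> dual T"
  by (auto simp: dual_def algebra_simps)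

lemma dual_smult: "\<phi> \<in> dual T \<Longrightarrow> (\<lambda>h. c * \<phi> h) \<in> dual T"
  by (auto simp: dual_def algebra_simps)

lemma dual_sum_fun:
  assumes "\<And>i. i \<in> I \<Longrightarrow> \<phi> i \<in> dual T" shows "(\<lambda>h. \<Sum>i\<in>I. c i * \<phi> i h) \<in> dual T"
  using assms
  by (induction I rule: infinite_finite_induct) (simp_all add: dual_zero dual_plus dual_smult)

text \<open>Induction on n. Independence provides h at which the new functional differs from the
  combination of the earlier ones that agrees with it at all t j. Removing the components of h along
  the t j gives u, killed by the earlier functionals but not by the new one; a multiple of u is the
  new vector and also corrects the old ones.\<close>

lemma biorthogonal_exists:
  fixes n :: nat
  assumes T: "subspace T"
  shows "(\<And>i. i \<in> {1..n} \<Longrightarrow> \<alpha> i \<in> dual T) \<Longrightarrow>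
    (\<And>c i. \<forall>h\<in>T. (\<Sum>i=1..n. c i * \<alpha> i h) = 0 \<Longrightarrow> i \<in> {1..n} \<Longrightarrow> c i = 0) \<Longrightarrow>
    \<exists>t. \<forall>i\<in>{1..n}. t i \<in> T \<and> (\<forall>j\<in>{1..n}. \<alpha> j (t i) = (if j = i then 1 else 0))"
proof (induction n)
  case (Suc n)
  have *: "c i = 0" if "\<forall>h\<in>T. (\<Sum>i=1..n. c i * \<alpha> i h) = 0" "i \<in> {1..n}" for c i
  proof -
    have "(c(Suc n := 0)) i = 0"
    proof (rule Suc.prems(2))
      have "(\<Sum>i=1..n. (c(Suc n := 0)) i * \<alpha> i h) = (\<Sum>i=1..n. c i * \<alpha> i h)" for h
        by (rule sum.cong) auto
      then show "\<forall>h\<in>T. (\<Sum>i=1..Suc n. (c(Suc n := 0)) i * \<alpha> i h) = 0" using that by simp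
    qed (use that in auto)
    then show ?thesis using that(2) by (auto split: if_splits)
  qed
  have "\<exists>t. \<forall>i\<in>{1..n}. t i \<in> T \<and> (\<forall>j\<in>{1..n}. \<alpha> j (t i) = (if j = i then 1 else 0))"
    by (rule Suc.IH) (use Suc.prems(1) in simp, rule *)
  then obtain t where
    t: "\<And>i. i \<in> {1..n} \<Longrightarrow> t i \<in> T"
       "\<And>i j. i \<in> {1..n} \<Longrightarrow> j \<in> {1..n} \<Longrightarrow> \<alpha> j (t i) = (if j = i then 1 else 0)"
    by blast
  let ?a = "\<alpha> (Suc n)"
  have a: "?a \<in> dual T" using Suc.prems(1) by simp
  have "\<exists>h\<in>T. ?a h \<noteq> (\<Sum>j=1..n. ?a (t j) * \<alpha> j h)"
  proof (rule ccontr)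
    assume neg: "\<not> ?thesis"
    define c where "c = (\<lambda>j. if j = Suc n then -1 else ?a (t j))"
    have "(\<Sum>j=1..n. c j * \<alpha> j h) = (\<Sum>j=1..n. ?a (t j) * \<alpha> j h)" for h
      by (rule sum.cong) (auto simp: c_def)
    then have "\<forall>h\<in>T. (\<Sum>j=1..Suc n. c j * \<alpha> j h) = 0" using neg by (auto simp: c_def)
    then have "c (Suc n) = 0" by (rule Suc.prems(2)) simp
    then show False by (simp add: c_def)
  qed
  then obtain h where h: "h \<in> T" "?a h \<noteq> (\<Sum>j=1..n. ?a (t j) * \<alpha> j h)" by blast
  define u where "u = h - (\<Sum>j=1..n. \<alpha> j h *s t j)"
  have sT: "(\<Sum>j=1..n. \<alpha> j h *s t j) \<in> T"
    by (intro subspace_sum subspace_scale T t)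
  have uT: "u \<in> T" unfolding u_def by (intro subspace_diff T h sT)
  have val: "\<phi> u = \<phi> h - (\<Sum>j=1..n. \<alpha> j h * \<phi> (t j))" if "\<phi> \<in> dual T" for \<phi>
  proof -
    have "\<phi> h = \<phi> (u + (\<Sum>j=1..n. \<alpha> j h *s t j))" by (simp add: u_def)
    also have "\<dots> = \<phi> u + (\<Sum>j=1..n. \<phi> (\<alpha> j h *s t j))"
      using dual_add[OF that uT sT] dual_sum[OF that T, of "{1..n}" "\<lambda>j. \<alpha> j h *s t j"] t(1) T
      by (simp add: subspace_scale)
    also have "(\<Sum>j=1..n. \<phi> (\<alpha> j h *s t j)) = (\<Sum>j=1..n. \<alpha> j h * \<phi> (t j))"
      by (rule sum.cong) (auto simp: dual_scale[OF that] t)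
    finally show ?thesis by simp
  qed
  have au: "?a u \<noteq> 0" using val[OF a] h(2) by (simp add: mult.commute)
  have ju: "\<alpha> j u = 0" if "j \<in> {1..n}" for j
  proof -
    have "(\<Sum>i=1..n. \<alpha> i h * \<alpha> j (t i)) = (\<Sum>i=1..n. if i = j then \<alpha> j h else 0)"
      by (rule sum.cong) (use that t in auto)
    then show ?thesis using val[of "\<alpha> j"] that Suc.prems(1) by simp
  qed
  define s where "s = inverse (?a u) *s u"
  have sT: "s \<in> T" unfolding s_def by (intro subspace_scale T uT)
  have as: "?a s = 1" using au by (simp add: s_def dual_scale[OF a uT])
  have js: "\<alpha> j s = 0" if "j \<in> {1..n}" for j
    using ju[OF that] that Suc.prems(1)[of j] by (simp add: s_def dual_scale[OF _ uT])
  define t' where "t' = (\<lambda>i. if i = Suc n then s else t i + (- ?a (t i)) *s s)"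
  have v: "\<phi> (t' i) = (if i = Suc n then \<phi> s else \<phi> (t i) - ?a (t i) * \<phi> s)"
    if "\<phi> \<in> dual T" "i \<in> {1..Suc n}" for \<phi> i
  proof (cases "i = Suc n")
    case False
    then have "t i \<in> T" using t that by auto
    then show ?thesis using False dual_add[OF that(1), of "t i" "(- ?a (t i)) *s s"]
      dual_scale[OF that(1) sT, of "- ?a (t i)"] sT T subspace_scale[OF T sT, of "- ?a (t i)"]
      by (simp add: t'_def)
  qed (simp add: t'_def)
  show ?case
  proof (intro exI[of _ t'] ballI conjI)
    fix i assume i: "i \<in> {1..Suc n}"
    show "t' i \<in> T"
    proof (cases "i = Suc n")
      case False
      then have "t i \<in> T" using t i by auto
      then show ?thesis using False sT T by (auto simp: t'_def intro!: subspace_add subspace_scale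
        subspace_neg subspace_diff)
    qed (simp add: t'_def sT)
    fix j assume j: "j \<in> {1..Suc n}"
    show "\<alpha> j (t' i) = (if j = i then 1 else 0)"
      unfolding v[OF Suc.prems(1)[OF j] i]
      using as js i j t(2) by (cases "i = Suc n"; cases "j = Suc n") auto
  qed
qed simp

end

subsection \<open>The Cartan subalgebra and the roots\<close>

context based_simple_lie_algebra
begin

lemma subspace_T: "subspace T"
  and lie_T: "x \<in> T \<Longrightarrow> y \<in> T \<Longrightarrow> lie x y \<in> T"
  and normalizer_T: "(\<And>y. y \<in> T \<Longrightarrow> lie y x \<in> T) \<Longrightarrow> x \<in> T"
proof -
  have *: "nilpotent_subalgebra T" "normalizer T = T"
    using cartan by (auto simp: cartan_subalgebra_def)
  then have "subalgebra T" by (simp add: nilpotent_subalgebra_def)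
  then show s: "subspace T" and "x \<in> T \<Longrightarrow> y \<in> T \<Longrightarrow> lie x y \<in> T"
    by (auto simp: subalgebra_def)
  assume "\<And>y. y \<in> T \<Longrightarrow> lie y x \<in> T"
  then have "\<And>y. y \<in> T \<Longrightarrow> lie x y \<in> T"
    using lie_anti[of x] s by (auto intro: subspace_neg)
  then have "x \<in> normalizer T" by (simp add: normalizer_def)
  then show "x \<in> T" using * by simp
qed

lemma simple_root: "i \<in> {1..rank} \<Longrightarrow> \<alpha> i \<in> roots T"
  using simple_roots unfolding simple_roots_def rank_def by blast

lemma roots_dual: "\<gamma> \<in> roots T \<Longrightarrow> \<gamma> \<in> dual T"
  by (simp add: roots_def)

lemma roots_nonzero: "\<gamma> \<in> roots T \<Longrightarrow> \<gamma> \<noteq> (\<lambda>_. 0)"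
  by (simp add: roots_def)

lemma simple_dual: "i \<in> {1..rank} \<Longrightarrow> \<alpha> i \<in> dual T"
  using simple_root roots_dual by blast

lemma root_vector:
  assumes "\<gamma> \<in> roots T" obtains x where "x \<in> root_space T \<gamma>" "x \<noteq> 0"
proof -
  have "0 \<in> root_space T \<gamma>" by (simp add: root_space_def lie_zero_right)
  then show ?thesis using assms that by (auto simp: roots_def)
qed

section \<open>Coweights as coordinates on \<open>T\<close>\<close>

definition fundamental_coweight :: "nat \<Rightarrow> 'g" where
  "fundamental_coweight = (SOME t. \<forall>i\<in>{1..rank}. t i \<in> T \<and>
     (\<forall>j\<in>{1..rank}. \<alpha> j (t i) = (if j = i then 1 else 0)))"

abbreviation "\<omega> \<equiv> fundamental_coweight"

lemma coweight_T: "i \<in> {1..rank} \<Longrightarrow> \<omega> i \<in> T"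
  and simple_coweight: "i \<in> {1..rank} \<Longrightarrow> j \<in> {1..rank} \<Longrightarrow> \<alpha> j (\<omega> i) = (if j = i then 1 else 0)"
proof -
  have "\<exists>t. \<forall>i\<in>{1..rank}. t i \<in> T \<and> (\<forall>j\<in>{1..rank}. \<alpha> j (t i) = (if j = i then 1 else 0))"
  proof (rule biorthogonal_exists[OF subspace_T])
    fix c i assume "\<forall>h\<in>T. (\<Sum>i=1..rank. c i * \<alpha> i h) = 0" "i \<in> {1..rank}"
    then show "c i = 0" using simple_roots unfolding simple_roots_def rank_def by blast
  qed (rule simple_dual)
  then have *: "\<forall>i\<in>{1..rank}. \<omega> i \<in> T \<and> (\<forall>j\<in>{1..rank}. \<alpha> j (\<omega> i) = (if j = i then 1 else 0))"
    unfolding fundamental_coweight_def by (rule someI_ex)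
  then show "i \<in> {1..rank} \<Longrightarrow> \<omega> i \<in> T"
    "i \<in> {1..rank} \<Longrightarrow> j \<in> {1..rank} \<Longrightarrow> \<alpha> j (\<omega> i) = (if j = i then 1 else 0)"
    by blast+
qed

lemma dual_coweight_sum:
  assumes "\<phi> \<in> dual T" shows "\<phi> (\<Sum>i=1..rank. a i *s \<omega> i) = (\<Sum>i=1..rank. a i * \<phi> (\<omega> i))"
proof -
  have "\<phi> (\<Sum>i=1..rank. a i *s \<omega> i) = (\<Sum>i=1..rank. \<phi> (a i *s \<omega> i))"
    by (rule dual_sum[OF assms subspace_T]) (rule subspace_scale[OF subspace_T coweight_T])
  also have "\<dots> = (\<Sum>i=1..rank. a i * \<phi> (\<omega> i))"
    by (rule sum.cong[OF refl]) (rule dual_scale[OF assms coweight_T])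
  finally show ?thesis .
qed

lemma coweight_sum_T: "(\<Sum>i=1..rank. a i *s \<omega> i) \<in> T"
  by (intro subspace_sum subspace_scale subspace_T coweight_T)

lemma simple_coweight_sum:
  assumes "j \<in> {1..rank}" shows "\<alpha> j (\<Sum>i=1..rank. a i *s \<omega> i) = a j"
proof -
  have "\<alpha> j (\<Sum>i=1..rank. a i *s \<omega> i) = (\<Sum>i=1..rank. if i = j then a j else 0)"
    unfolding dual_coweight_sum[OF simple_dual[OF assms]]
    by (rule sum.cong) (use assms simple_coweight in auto)
  then show ?thesis using assms by simp
qed

text \<open>The coweights are independent, being biorthogonal to the simple roots, and there are
  \<open>dim T\<close> of them, so they span \<open>T\<close>.\<close>

lemma T_expand:
  assumes "x \<in> T" shows "x = (\<Sum>i=1..rank. \<alpha> i x *s \<omega> i)"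
proof -
  have coef: "c i = 0"
    if "finite F" "F \<subseteq> {1..rank}" "(\<Sum>i\<in>F. c i *s \<omega> i) = 0" "i \<in> F" for F c i
  proof -
    have "(\<Sum>i=1..rank. (if i \<in> F then c i else 0) *s \<omega> i) = (\<Sum>i\<in>F. c i *s \<omega> i)"
      using that(1,2) by (intro sum.mono_neutral_cong_right) auto
    then have "\<alpha> i (\<Sum>i=1..rank. (if i \<in> F then c i else 0) *s \<omega> i) = 0"
      using that(2-4) dual_scale[OF simple_dual subspace_0[OF subspace_T], of i 0] by auto
    then show ?thesis using that simple_coweight_sum[of i "\<lambda>i. if i \<in> F then c i else 0"] by auto
  qed
  have "inj_on \<omega> {1..rank}" "independent (\<omega> ` {1..rank})"
    by (rule independent_family, fact coef)+
  then have "T \<subseteq> span (\<omega> ` {1..rank})"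
    using coweight_T by (intro card_ge_dim_independent) (auto simp: card_image rank_def)
  then have "x \<in> span (\<omega> ` {1..rank})" using assms by blast
  then obtain u where u: "x = (\<Sum>v\<in>\<omega> ` {1..rank}. u v *s v)"
    by (auto simp: span_finite)
  then have x: "x = (\<Sum>i=1..rank. u (\<omega> i) *s \<omega> i)"
    using sum.reindex[OF \<open>inj_on \<omega> {1..rank}\<close>, of "\<lambda>v. u v *s v"] by simp
  have "u (\<omega> i) = \<alpha> i x" if "i \<in> {1..rank}" for i
    using simple_coweight_sum[OF that, of "\<lambda>i. u (\<omega> i)"] x by simp
  then show ?thesis using x by (metis (no_types, lifting) sum.cong)
qed

lemma T_zero: "x \<in> T \<Longrightarrow> (\<And>i. i \<in> {1..rank} \<Longrightarrow> \<alpha> i x = 0) \<Longrightarrow> x = 0"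
  by (subst T_expand) simp_all

text \<open>Elements of \<open>T\<close> act on a root vector by scalars, so a bracket of two of
  them acts by 0. Hence every simple root vanishes at the bracket, and the simple roots separate the
  points of \<open>T\<close>.\<close>

lemma T_abelian:
  assumes "x \<in> T" "y \<in> T" shows "lie x y = 0"
proof (rule T_zero)
  show "lie x y \<in> T" using assms by (rule lie_T)
  fix i assume i: "i \<in> {1..rank}"
  obtain v where v: "v \<in> root_space T (\<alpha> i)" "v \<noteq> 0" using root_vector[OF simple_root[OF i]] .
  have "\<alpha> i (lie x y) *s v = lie (lie x y) v"
    using v(1) \<open>lie x y \<in> T\<close> by (simp add: root_space_def)
  also have "\<dots> = 0"
    using v(1) assms by (simp add: lie_lie root_space_def lie_scale_right mult.commute)
  finally show "\<alpha> i (lie x y) = 0" using v(2) by simp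
qed

lemma lie_commute:
  assumes "x \<in> T" "y \<in> T" shows "lie x (lie y z) = lie y (lie x z)"
  using lie_derivation[of x y z] T_abelian[OF assms] by (simp add: lie_zero_left)

text \<open>Unpacks the description operator once. The coefficients are 0 outside {1..rank}, in
  particular at the affine index 0, so the sign condition extends to all indices.\<close>

lemma root_coeff:
  assumes "\<gamma> \<in> roots T"
  shows "\<And>h. h \<in> T \<Longrightarrow> \<gamma> h = (\<Sum>i=1..rank. of_int (root_coeff \<gamma> i) * \<alpha> i h)"
    and "\<And>i. i \<notin> {1..rank} \<Longrightarrow> root_coeff \<gamma> i = 0"
    and "(\<forall>i. 0 \<le> root_coeff \<gamma> i) \<or> (\<forall>i. root_coeff \<gamma> i \<le> 0)"
    and "\<And>c. (\<And>h. h \<in> T \<Longrightarrow> \<gamma> h = (\<Sum>i=1..rank. of_int (c i) * \<alpha> i h)) \<Longrightarrow>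
          i \<in> {1..rank} \<Longrightarrow> root_coeff \<gamma> i = c i"
proof -
  obtain c :: "nat \<Rightarrow> int" where c:
    "\<And>h. h \<in> T \<Longrightarrow> \<gamma> h = (\<Sum>i=1..rank. of_int (c i) * \<alpha> i h)"
    "(\<forall>i\<in>{1..rank}. 0 \<le> c i) \<or> (\<forall>i\<in>{1..rank}. c i \<le> 0)"
    using simple_roots assms unfolding simple_roots_def rank_def by blast
  have uniq: "of_int (d i) = \<gamma> (\<omega> i)"
    if "\<And>h. h \<in> T \<Longrightarrow> \<gamma> h = (\<Sum>i=1..rank. of_int (d i) * \<alpha> i h)" "i \<in> {1..rank}" for d :: "nat \<Rightarrow> int" and i
  proof -
    have "(\<Sum>j=1..rank. of_int (d j) * \<alpha> j (\<omega> i)) = (\<Sum>j=1..rank. if j = i then of_int (d i) else 0)"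
      by (rule sum.cong) (use simple_coweight that(2) in auto)
    then show ?thesis using that(1)[OF coweight_T[OF that(2)]] that(2) by simp
  qed
  let ?c = "\<lambda>i. if i \<in> {1..rank} then c i else 0"
  let ?P = "\<lambda>c. (\<forall>h\<in>T. \<gamma> h = (\<Sum>i=1..rank. of_int (c i) * \<alpha> i h)) \<and> (\<forall>i. i \<notin> {1..rank} \<longrightarrow> c i = 0)"
  have "root_coeff \<gamma> = ?c"
    unfolding root_coeff_def
  proof (rule the_equality)
    show "?P ?c" using c(1) by auto
    fix d assume d: "?P d"
    show "d = ?c"
    proof
      fix i
      show "d i = ?c i"
      proof (cases "i \<in> {1..rank}")
        case True
        have "(of_int (d i) :: 'k) = of_int (c i)"
          using uniq[of d, OF _ True] uniq[of c, OF _ True] c(1) d by metis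
        then show ?thesis using True by simp
      qed (use d in auto)
    qed
  qed
  then have *: "\<And>i. i \<in> {1..rank} \<Longrightarrow> root_coeff \<gamma> i = c i" "\<And>i. i \<notin> {1..rank} \<Longrightarrow> root_coeff \<gamma> i = 0"
    by auto
  show 1: "\<And>h. h \<in> T \<Longrightarrow> \<gamma> h = (\<Sum>i=1..rank. of_int (root_coeff \<gamma> i) * \<alpha> i h)"
    using c(1) * by simp
  show "\<And>i. i \<notin> {1..rank} \<Longrightarrow> root_coeff \<gamma> i = 0" by (rule *)
  show "(\<forall>i. 0 \<le> root_coeff \<gamma> i) \<or> (\<forall>i. root_coeff \<gamma> i \<le> 0)"
    using c(2) * by (metis order_refl)
  show "root_coeff \<gamma> i = d i" if "\<And>h. h \<in> T \<Longrightarrow> \<gamma> h = (\<Sum>i=1..rank. of_int (d i) * \<alpha> i h)"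
    "i \<in> {1..rank}" for d :: "nat \<Rightarrow> int"
    using uniq[OF that] uniq[OF 1 that(2)] by (metis of_int_eq_iff)
qed

section \<open>Heights of roots and the element \<open>rho\<close>\<close>

definition height :: "('g \<Rightarrow> 'k) \<Rightarrow> int" where
  "height \<gamma> = (\<Sum>i=1..rank. root_coeff \<gamma> i)"

text \<open>In classical terms half the sum of the positive coroots. The factor 1 matches the
  pattern of \<open>simple_coweight_sum\<close>.\<close>

definition rho :: 'g where
  "rho = (\<Sum>i=1..rank. 1 *s \<omega> i)"

lemma rho_T: "rho \<in> T"
  unfolding rho_def by (rule coweight_sum_T)

lemma simple_rho: "i \<in> {1..rank} \<Longrightarrow> \<alpha> i rho = 1"
  unfolding rho_def using simple_coweight_sum[of i "\<lambda>_. 1"] by simp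

lemma root_rho: "\<gamma> \<in> roots T \<Longrightarrow> \<gamma> rho = of_int (height \<gamma>)"
  by (simp add: root_coeff(1) rho_T simple_rho height_def)

lemma root_eqI:
  assumes "\<gamma> \<in> roots T" "\<mu> \<in> roots T" "\<And>i. i \<in> {1..rank} \<Longrightarrow> root_coeff \<gamma> i = root_coeff \<mu> i"
  shows "\<gamma> = \<mu>"
  using assms by (intro dual_eqI[of _ T]) (simp_all add: roots_dual root_coeff(1))

lemma root_coeff_nonzero:
  assumes "\<gamma> \<in> roots T" obtains i where "i \<in> {1..rank}" "root_coeff \<gamma> i \<noteq> 0"
proof (rule ccontr)
  note * = that
  assume "\<not> thesis"
  then have "root_coeff \<gamma> i = 0" if "i \<in> {1..rank}" for i using that *[of i] by blast
  then have "\<gamma> = (\<lambda>_. 0)"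
    using assms by (intro dual_eqI[of _ T]) (simp_all add: roots_dual root_coeff(1) dual_zero)
  then show False using assms roots_nonzero by blast
qed

text \<open>Coefficients of one sign cannot cancel in the sum. This is what makes \<open>rho\<close>
  regular: no root vanishes at it.\<close>

lemma height_nonzero:
  assumes "\<gamma> \<in> roots T" shows "height \<gamma> \<noteq> 0"
proof
  assume 0: "height \<gamma> = 0"
  obtain i where i: "i \<in> {1..rank}" "root_coeff \<gamma> i \<noteq> 0" by (rule root_coeff_nonzero[OF assms])
  show False using root_coeff(3)[OF assms]
  proof
    assume "\<forall>i. 0 \<le> root_coeff \<gamma> i"
    then show False using 0 i sum_nonneg_eq_0_iff[of "{1..rank}" "root_coeff \<gamma>"] by (auto simp: height_def)
  next
    assume "\<forall>i. root_coeff \<gamma> i \<le> 0"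
    then show False using 0 i sum_nonneg_eq_0_iff[of "{1..rank}" "\<lambda>i. - root_coeff \<gamma> i"]
      by (auto simp: height_def sum_negf)
  qed
qed

lemma root_rho_nonzero: "\<gamma> \<in> roots T \<Longrightarrow> \<gamma> rho \<noteq> 0"
  by (simp add: root_rho height_nonzero)

text \<open>The eigenvalue is automatically linear in t because x is nonzero. It is cut off outside
  \<open>T\<close> to fit the normal form of \<open>dual\<close>.\<close>

lemma eigenvector_root:
  assumes x: "x \<noteq> 0" "\<And>t. t \<in> T \<Longrightarrow> lie t x = c t *s x" and t: "t \<in> T" "c t \<noteq> 0"
  shows "(\<lambda>h. if h \<in> T then c h else 0) \<in> roots T"
    and "x \<in> root_space T (\<lambda>h. if h \<in> T then c h else 0)"
proof -
  have "c (s + u) *s x = (c s + c u) *s x" if "s \<in> T" "u \<in> T" for s u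
    using x(2)[of s] x(2)[of u] x(2)[of "s + u"] that subspace_add[OF subspace_T that]
    by (simp add: lie_add_left scale_left_distrib)
  then have add: "c (s + u) = c s + c u" if "s \<in> T" "u \<in> T" for s u
    using that x(1) by simp
  have sc: "c (a *s s) *s x = (a * c s) *s x" if "s \<in> T" for s a
    using x(2)[OF subspace_scale[OF subspace_T that], of a] x(2)[OF that] lie_scale_left[of a s x]
    by (simp only: scale_scale)
  have scale: "c (a *s s) = a * c s" if "s \<in> T" for s a
    by (rule scale_right_imp_eq[OF x(1) sc[OF that]])
  let ?\<gamma> = "\<lambda>h. if h \<in> T then c h else 0"
  have dual: "?\<gamma> \<in> dual T"
    unfolding dual_def using add scale subspace_add[OF subspace_T] subspace_scale[OF subspace_T] by auto
  show rs: "x \<in> root_space T ?\<gamma>"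
    using x(2) by (simp add: root_space_def)
  have "?\<gamma> t \<noteq> 0" using t by simp
  then have "?\<gamma> \<noteq> (\<lambda>_. 0)" by metis
  then show "?\<gamma> \<in> roots T"
    using dual rs x(1) unfolding roots_def by blast
qed

lemma centralizer_T: "(\<And>t. t \<in> T \<Longrightarrow> lie t x = 0) \<Longrightarrow> x \<in> T"
  using normalizer_T subspace_0[OF subspace_T] by simp

lemma rank_pos: "1 \<le> rank"
proof (rule ccontr)
  assume "\<not> 1 \<le> rank"
  then have "T \<subseteq> {0}" using T_expand by force
  then have "x \<in> T" for x by (intro centralizer_T) (auto simp: lie_zero_left)
  then show False using \<open>T \<subseteq> {0}\<close> nonabelian lie_zero_left by blast
qed

section \<open>Joint eigenvectors of \<open>T\<close> and nondegeneracy of the Killing form\<close>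

lemma T_operators:
  assumes "f \<in> lie ` T"
  shows "lin f" "g \<in> lie ` T \<Longrightarrow> f (g x) = g (f x)"
  using assms by (auto intro: lin_lie lie_commute)

text \<open>If the generalized null space were larger, it would contain a vector v outside
  \<open>T\<close> that is a joint eigenvector modulo \<open>T\<close>. If its weight is nonzero, v
  can be corrected to a true root vector, but no root vanishes at \<open>rho\<close>; if the weight
  is zero, v normalizes \<open>T\<close> and so lies in \<open>T\<close>.\<close>

lemma genspace_rho_zero: "genspace (lie rho) 0 = T"
proof (rule ccontr)
  let ?U = "genspace (lie rho) 0"
  assume ne: "?U \<noteq> T"
  have "x \<in> ?U" if "x \<in> T" for x
    using T_abelian[OF rho_T that] by (auto simp: genspace_def intro: exI[of _ 1])
  then have TU: "T \<subset> ?U" using ne by blast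
  have U: "subspace ?U" by (rule subspace_genspace[OF lin_lie])
  obtain v c' where v: "v \<in> ?U" "v \<notin> T" "\<And>f. f \<in> lie ` T \<Longrightarrow> f v - c' f *s v \<in> T"
  proof (rule common_eigenvector_mod[of "lie ` T" ?U T])
    show "f x \<in> ?U" if "f \<in> lie ` T" "x \<in> ?U" for f x
    proof -
      obtain t where t: "t \<in> T" "f = lie t" using \<open>f \<in> lie ` T\<close> by blast
      show ?thesis unfolding t(2)
        by (rule genspace_commute[OF lin_lie lie_commute[OF rho_T t(1)] that(2)])
    qed
    show "f x \<in> T" if "f \<in> lie ` T" "x \<in> T" for f x
      using that by (auto intro: lie_T)
  qed (use U subspace_T TU in \<open>auto simp: T_operators\<close>)
  define c where "c = (\<lambda>t. c' (lie t))"
  have c: "lie t v - c t *s v \<in> T" if "t \<in> T" for t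
    using v(3)[of "lie t"] that by (simp add: c_def)
  have "c t0 = 0" if t0: "t0 \<in> T" for t0
  proof (rule ccontr)
    assume nz: "c t0 \<noteq> 0"
    define w where "w = lie t0 v - c t0 *s v"
    have w: "w \<in> T" unfolding w_def by (rule c[OF t0])
    \<comment> \<open>t0 kills w because \<open>T\<close> is abelian, so adding w / c t0 makes v' an
      exact eigenvector of t0.\<close>
    define v' where "v' = v + inverse (c t0) *s w"
    have wT: "inverse (c t0) *s w \<in> T" by (rule subspace_scale[OF subspace_T w])
    have v'T: "v' \<notin> T"
      using v(2) subspace_diff[OF subspace_T, of v' "inverse (c t0) *s w"] wT by (auto simp: v'_def)
    then have v'0: "v' \<noteq> 0" using subspace_0[OF subspace_T] by auto
    have t0v: "lie t0 v' = c t0 *s v'"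
    proof -
      have "lie t0 v' = lie t0 v" using T_abelian[OF t0 wT] by (simp add: v'_def lie_add_right)
      moreover have "c t0 *s v' = c t0 *s v + w" using nz by (simp add: v'_def scale_right_distrib)
      ultimately show ?thesis by (simp add: w_def)
    qed
    have eig: "lie t v' = c t *s v'" if t: "t \<in> T" for t
    proof -
      \<comment> \<open>The error u for another t lies in \<open>T\<close>, so t0 kills it; but t0
        also multiplies it by c t0, which is not 0.\<close>
      define u where "u = lie t v' - c t *s v'"
      have "u = (lie t v - c t *s v) - (c t * inverse (c t0)) *s w"
        using T_abelian[OF t wT] by (simp add: u_def v'_def lie_add_right algebra_simps)
      then have "u \<in> T" using c[OF t] w subspace_T by (simp add: subspace_diff subspace_scale)
      then have "lie t0 u = 0" by (rule T_abelian[OF t0])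
      moreover have "lie t0 u = c t0 *s u"
        using lie_commute[OF t0 t, of v'] t0v
        by (simp add: u_def lie_diff_right lie_scale_right scale_right_diff_distrib mult.commute)
      ultimately show ?thesis using nz by (simp add: u_def)
    qed
    let ?\<gamma> = "\<lambda>h. if h \<in> T then c h else 0"
    have "?\<gamma> \<in> roots T" using eigenvector_root(1)[OF v'0 eig t0 nz] .
    then have "c rho \<noteq> 0" using root_rho_nonzero[of ?\<gamma>] rho_T by simp
    moreover have "v' \<in> ?U" using v(1) wT TU U by (auto simp: v'_def intro: subspace_add)
    ultimately have "v' = 0"
      using genspace_inj[OF lin_lie, of v' rho 0 "c rho"] eig[OF rho_T] by blast
    then show False using v'0 by blast
  qed
  then have "lie t v \<in> T" if "t \<in> T" for t using c[OF that] that by simp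
  then show False using normalizer_T v(2) by blast
qed

text \<open>The eigenspace is stable under \<open>T\<close> and so contains a joint eigenvector of
  \<open>T\<close>. Its weight is 0 or a root, and a root takes its height at
  \<open>rho\<close>.\<close>

lemma rho_eigenvalue:
  assumes "lie rho x = c *s x" "x \<noteq> 0"
  shows "\<exists>n::int. c = of_int n"
proof -
  let ?U = "{x. lie rho x = c *s x}"
  obtain v c' where v: "v \<in> ?U" "v \<notin> {0}" "\<And>f. f \<in> lie ` T \<Longrightarrow> f v - c' f *s v \<in> {0}"
  proof (rule common_eigenvector_mod[of "lie ` T" ?U "{0}"])
    show "subspace ?U"
      by (rule subspaceI) (auto simp: lie_zero_right lie_add_right lie_scale_right algebra_simps)
    show "f x \<in> ?U" if "f \<in> lie ` T" "x \<in> ?U" for f x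
      using that lie_commute[OF rho_T] by (auto simp: lie_scale_right)
    show "{0} \<subset> ?U" using assms by (auto simp: lie_zero_right)
    show "f x \<in> {0}" if "f \<in> lie ` T" "x \<in> {0}" for f x
      using that by (auto simp: lie_zero_right)
  qed (use T_operators in \<open>auto simp: subspace_0\<close>)
  have eig: "lie t v = c' (lie t) *s v" if "t \<in> T" for t using v(3)[of "lie t"] that by simp
  have c: "c = c' (lie rho)" using v(1,2) eig[OF rho_T] by simp
  show ?thesis
  proof (cases "\<forall>t\<in>T. c' (lie t) = 0")
    case True
    then show ?thesis using c rho_T by (intro exI[of _ 0]) simp
  next
    case False
    then obtain t where "t \<in> T" "c' (lie t) \<noteq> 0" by blast
    then have "(\<lambda>h. if h \<in> T then c' (lie h) else 0) \<in> roots T"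
      using eigenvector_root(1)[of v "\<lambda>t. c' (lie t)"] eig v(2) by blast
    from root_rho[OF this] show ?thesis using c rho_T by auto
  qed
qed

text \<open>A flag for \<open>lie rho\<close> has integer diagonal entries, so the trace of the
  square is a sum of squares of integers. Starting the flag with a root vector of \<alpha> 1 makes
  one entry 1, and in characteristic 0 the sum is not 0.\<close>

lemma killing_rho: "killing rho rho \<noteq> 0"
proof -
  have 1: "(1::nat) \<in> {1..rank}" using rank_pos by simp
  obtain x where x: "x \<in> root_space T (\<alpha> 1)" "x \<noteq> 0" using root_vector[OF simple_root[OF 1]] .
  then have "lie rho x = 1 *s x" using rho_T simple_rho[OF 1] by (simp add: root_space_def)
  then have "flag (lie rho) [(x, 1)]" using x(2) by simp
  from flag_extend[OF lin_lie this] obtain qs where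
    qs: "flag (lie rho) (qs @ [(x, 1)])" "span (fst ` set (qs @ [(x, 1)])) = UNIV" by blast
  define ps where "ps = qs @ [(x, 1 :: 'k)]"
  have ps: "flag (lie rho) ps" "span (fst ` set ps) = UNIV" "(x, 1) \<in> set ps"
    using qs by (simp_all add: ps_def)
  let ?sq = "\<lambda>p::'g \<times> 'k. (fst p, (snd p)\<^sup>2)"
  have "\<exists>n::int. snd p = of_int n" if "p \<in> set ps" for p
    using flag_eigenvector[OF lin_lie ps(1) that] rho_eigenvalue by blast
  then obtain n :: "'g \<times> 'k \<Rightarrow> int" where n: "\<And>p. p \<in> set ps \<Longrightarrow> snd p = of_int (n p)" by metis
  have "killing rho rho = (\<Sum>p\<in>set (map ?sq ps). snd p)"
    unfolding killing_def
    by (rule trace_flag[OF lin_comp[OF lin_lie lin_lie] flag_square[OF lin_lie ps(1)]])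
      (use ps(2) in \<open>simp add: image_image\<close>)
  also have "\<dots> = (\<Sum>p\<in>set ps. (snd p)\<^sup>2)"
  proof -
    have "inj_on ?sq (set ps)" using flag_basis[OF ps(1)] by (auto simp: inj_on_def)
    then show ?thesis by (simp add: sum.reindex)
  qed
  also have "\<dots> = of_int (\<Sum>p\<in>set ps. (n p)\<^sup>2)" using n by simp
  finally have eq: "killing rho rho = of_int (\<Sum>p\<in>set ps. (n p)\<^sup>2)" .
  have "n (x, 1) = 1" using n[OF ps(3)] by simp
  then have "0 < (\<Sum>p\<in>set ps. (n p)\<^sup>2)"
    by (intro sum_pos2[OF _ ps(3)]) auto
  then show ?thesis unfolding eq of_int_eq_0_iff by simp
qed

lemma killing_zero: "(\<And>y. killing x y = 0) \<Longrightarrow> x = 0"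
  using killing_nondegenerate[OF killing_rho] .

section \<open>Semisimple and nilpotent parts of \<open>lie t\<close>\<close>

lemma semisimple_part_derivation:
  assumes S: "lin S" "\<And>c x. x \<in> genspace (lie t) c \<Longrightarrow> S x = c *s x"
  shows "S (lie x y) = lie (S x) y + lie x (S y)"
proof -
  let ?G = "\<Union>c. genspace (lie t) c"
  have xy: "S (lie x y) = lie (S x) y + lie x (S y)"
    if "x \<in> genspace (lie t) c" "y \<in> genspace (lie t) d" for x y c d
    using S(2)[OF lie_genspace[OF that]] S(2)[OF that(1)] S(2)[OF that(2)]
    by (simp add: lie_scale_left lie_scale_right scale_left_distrib)
  have L1: "lin (\<lambda>x. S (lie x y))" "lin (\<lambda>x. lie (S x) y + lie x (S y))" for y
    by (rule lin_comp[OF S(1) lin_lie_left],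
        rule lin_plus[OF lin_comp[OF lin_lie_left S(1)] lin_lie_left])
  have L2: "lin (\<lambda>y. S (lie x y))" "lin (\<lambda>y. lie (S x) y + lie x (S y))" for x
    by (rule lin_comp[OF S(1) lin_lie],
        rule lin_plus[OF lin_lie lin_comp[OF lin_lie S(1)]])
  have 1: "S (lie x y) = lie (S x) y + lie x (S y)" if "y \<in> ?G" for x y
    by (rule lin_eq_on_span[OF L1, of ?G])
      (use xy that span_genspaces[OF lin_lie] in auto)
  show ?thesis
    by (rule lin_eq_on_span[OF L2, of ?G])
      (use 1 span_genspaces[OF lin_lie] in auto)
qed

lemma semisimple_part_commute:
  assumes S: "lin S" "\<And>c x. x \<in> genspace A c \<Longrightarrow> S x = c *s x"
    and A: "lin A" and B: "lin B" "\<And>x. A (B x) = B (A x)"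
  shows "S (B x) = B (S x)"
proof (rule lin_eq_on_span[OF lin_comp[OF S(1) B(1)] lin_comp[OF B(1) S(1)]])
  show "x \<in> span (\<Union>c. genspace A c)" using span_genspaces[OF A] by simp
  fix y assume "y \<in> (\<Union>c. genspace A c)"
  then obtain c where c: "y \<in> genspace A c" by blast
  then have "B y \<in> genspace A c" by (rule genspace_commute[where A = A and B = B, OF B])
  then show "S (B y) = B (S y)" using S(2) c by (simp add: lin_scale[OF B(1)])
qed

lemma nilpotent_part_nilpotent:
  assumes S: "lin S" "\<And>c x. x \<in> genspace A c \<Longrightarrow> S x = c *s x" and A: "lin A"
  shows "\<exists>n. ((\<lambda>x. A x - S x) ^^ n) x = 0"
proof -
  let ?N = "\<lambda>x. A x - S x"
  have N: "lin ?N" by (intro lin_minus_fun A S)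
  have "y \<in> genspace ?N 0" if y: "y \<in> genspace A c" for y c
  proof -
    have "(?N ^^ n) y = ((\<lambda>y. A y - c *s y) ^^ n) y \<and> (?N ^^ n) y \<in> genspace A c" for n
    proof (induction n)
      case (Suc n)
      then show ?case using genspace_shift_invariant[OF A] S(2) by auto
    qed (simp add: y)
    then show ?thesis using y by (auto simp: genspace_def)
  qed
  then have "span (\<Union>c. genspace A c) \<subseteq> genspace ?N 0"
    using subspace_genspace[OF N] by (intro span_minimal) auto
  then have "x \<in> genspace ?N 0" using span_genspaces[OF A] by auto
  then show ?thesis by (auto simp: genspace_def)
qed

text \<open>Each application of P moves the eigenvalue by c. In characteristic 0 the values d + n *
  c are distinct, so one of them is not among the finitely many eigenvalues of A.\<close>

lemma shift_nilpotent:
  assumes A: "lin A" and P: "lin P" and c: "c \<noteq> 0"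
    and shift: "\<And>d x. x \<in> genspace A d \<Longrightarrow> P x \<in> genspace A (d + c)"
  shows "\<exists>n. (P ^^ n) x = 0"
proof -
  have "y \<in> genspace P 0" if y: "y \<in> genspace A d" for y d
  proof -
    have mem: "(P ^^ n) y \<in> genspace A (d + of_nat n * c)" for n
    proof (induction n)
      case (Suc n)
      from shift[OF this] show ?case by (simp add: algebra_simps)
    qed (simp add: y)
    have "inj (\<lambda>n. d + of_nat n * c)" using c by (auto simp: inj_def)
    then have "infinite (range (\<lambda>n. d + of_nat n * c))" using finite_imageD infinite_UNIV_nat by blast
    then obtain n where "genspace A (d + of_nat n * c) = {0}"
      using finite_eigenvalues[OF A] finite_subset by (metis (mono_tags, lifting) mem_Collect_eq rangeE subsetI)
    then have "(P ^^ n) y = 0" using mem[of n] by auto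
    then show ?thesis by (auto simp: genspace_def)
  qed
  then have "span (\<Union>c. genspace A c) \<subseteq> genspace P 0"
    using subspace_genspace[OF P] by (intro span_minimal) auto
  then have "x \<in> genspace P 0" using span_genspaces[OF A] by auto
  then show ?thesis by (auto simp: genspace_def)
qed

text \<open>
  The nilpotent part \<open>N\<close> of \<open>ad t\<close> is a derivation, so that \<open>killing (N x) y\<close> is the trace of
  \<open>N \<circ> ad [x, y]\<close>. Such traces vanish, because \<open>N \<circ> ad z\<close> is nilpotent when \<open>z\<close> lies in \<open>T\<close> or
  in another generalized eigenspace of \<open>ad rho\<close>.
\<close>

lemma T_diagonalizable:
  assumes t: "t \<in> T" and x: "x \<in> genspace (lie t) c"
  shows "lie t x = c *s x"
proof -
  obtain S where S: "lin S" "\<And>c x. x \<in> genspace (lie t) c \<Longrightarrow> S x = c *s x"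
    by (rule semisimple_part_exists[OF lin_lie[of t]]) blast
  define N where "N = (\<lambda>x. lie t x - S x)"
  have N: "lin N" unfolding N_def by (intro lin_minus_fun lin_lie S)
  have nil: "\<exists>n. (N ^^ n) x = 0" for x
    unfolding N_def by (rule nilpotent_part_nilpotent[OF S lin_lie])
  have comm: "N (lie z x) = lie z (N x)" if "z \<in> T" for z x
    using semisimple_part_commute[OF S lin_lie lin_lie lie_commute[OF t that]] lie_commute[OF t that]
    by (simp add: N_def lie_diff_right)
  have "trace (\<lambda>x. N (lie z x)) = 0" if z: "z \<in> genspace (lie rho) d" for z d
  proof (rule trace_nilpotent[OF lin_comp[OF N lin_lie]])
    fix x
    show "\<exists>n. ((\<lambda>x. N (lie z x)) ^^ n) x = 0"
    proof (cases "d = 0")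
      case True
      then have zT: "z \<in> T" using z genspace_rho_zero by simp
      have Nz: "(N ^^ n) (lie z x) = lie z ((N ^^ n) x)" for n x
        by (induction n) (simp_all add: comm[OF zT])
      have pow: "((\<lambda>x. N (lie z x)) ^^ n) x = (lie z ^^ n) ((N ^^ n) x)" for n
      proof (induction n)
        case (Suc n)
        have zN: "(lie z ^^ k) (N y) = N ((lie z ^^ k) y)" for k y
          by (induction k) (simp_all add: comm[OF zT])
        show ?case using Suc by (simp add: comm[OF zT] zN)
      qed simp
      obtain n where "(N ^^ n) x = 0" using nil by blast
      then show ?thesis using pow[of n] lin_zero[OF lin_funpow[OF lin_lie]] by auto
    next
      case False
      show ?thesis
      proof (rule shift_nilpotent[OF lin_lie[of rho] lin_comp[OF N lin_lie] False])
        fix e y assume y: "y \<in> genspace (lie rho) e"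
        have "lie z y \<in> genspace (lie rho) (e + d)"
          using lie_genspace[OF z y] by (simp add: add.commute)
        then show "N (lie z y) \<in> genspace (lie rho) (e + d)"
          by (rule genspace_commute[where A = "lie rho" and B = N, OF N comm[OF rho_T, symmetric]])
      qed
    qed
  qed
  then have tr: "trace (\<lambda>x. N (lie z x)) = 0" for z
  proof -
    have "z \<in> span (\<Union>c. genspace (lie rho) c)" using span_genspaces[OF lin_lie] by simp
    then show ?thesis
    proof (induction rule: span_induct_alt)
      case base
      show ?case using trace_scale[of 0 "\<lambda>x. x"] by (simp add: lie_zero_left lin_zero[OF N])
    next
      case (step a z w)
      then obtain c where "z \<in> genspace (lie rho) c" by blast
      then have "trace (\<lambda>x. N (lie z x)) = 0"
        using \<open>\<And>z d. z \<in> genspace (lie rho) d \<Longrightarrow> trace (\<lambda>x. N (lie z x)) = 0\<close> by blast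
      then show ?case using step(2)
        by (simp add: lie_add_left lie_scale_left lin_add[OF N] lin_scale[OF N] trace_plus trace_scale)
    qed
  qed
  have der: "N (lie x y) = lie (N x) y + lie x (N y)" for x y
    unfolding N_def
    using lie_derivation[of t x y] semisimple_part_derivation[where t = t, OF S, of x y] by (simp add: lie_diff_left lie_diff_right algebra_simps)
  have "killing (N x) y = 0" for y
  proof -
    have "killing (N x) y = trace (\<lambda>z. N (lie x (lie y z)) - lie x (N (lie y z)))"
      unfolding killing_def using der[of x] by simp
    also have "\<dots> = trace (\<lambda>z. N (lie x (lie y z))) - trace (\<lambda>z. lie x (N (lie y z)))"
      by (rule trace_diff)
    also have "trace (\<lambda>z. lie x (N (lie y z))) = trace (\<lambda>z. N (lie y (lie x z)))"
      by (rule trace_commute[OF lin_lie lin_comp[OF N lin_lie]])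
    also have "trace (\<lambda>z. N (lie x (lie y z))) - trace (\<lambda>z. N (lie y (lie x z)))
        = trace (\<lambda>z. N (lie (lie x y) z))"
      by (simp add: lie_lie lin_diff[OF N] trace_diff)
    finally show ?thesis using tr by simp
  qed
  then have "N x = 0" by (rule killing_zero)
  then show ?thesis using S(2)[OF x] by (simp add: N_def)
qed

text \<open>Split a joint eigenvector x of F into its components for \<open>lie t\<close>. For s in
  F the equation (ad s - a) x = 0 splits too, so each component is still an eigenvector of s, and by
  \<open>T_diagonalizable\<close> also of t.\<close>

lemma simultaneous_eigenvectors:
  "finite F \<Longrightarrow> F \<subseteq> T \<Longrightarrow> span {x. \<forall>t\<in>F. \<exists>c. lie t x = c *s x} = UNIV"
proof (induction F rule: finite_induct)
  case (insert t F)
  let ?E = "\<lambda>F. {x. \<forall>t\<in>F. \<exists>c. lie t x = c *s x}"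
  have "x \<in> span (?E (insert t F))" if x: "x \<in> ?E F" for x
  proof -
    have "x \<in> span (\<Union>c. genspace (lie t) c)" using span_genspaces[OF lin_lie] by simp
    then obtain D f where D: "finite D" "\<And>c. c \<in> D \<Longrightarrow> f c \<in> genspace (lie t) c" "x = sum f D"
      using span_Union_sum[of UNIV "genspace (lie t)" x] subspace_genspace[OF lin_lie] by metis
    have "f c \<in> ?E (insert t F)" if c: "c \<in> D" for c
    proof -
      have "\<exists>a. lie s (f c) = a *s f c" if s: "s \<in> F" for s
      proof -
        obtain a where a: "lie s x = a *s x" using x s by blast
        have sT: "s \<in> T" "t \<in> T" using insert.prems s by auto
        have mem: "lie s (f d) - a *s f d \<in> genspace (lie t) d" if "d \<in> D" for d
          using genspace_commute[OF lin_lie lie_commute[OF sT(2,1)] D(2)[OF that]] D(2)[OF that]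
          by (intro subspace_diff subspace_scale subspace_genspace lin_lie)
        have "(\<Sum>d\<in>D. lie s (f d) - a *s f d) = lie s x - a *s x"
          by (simp add: D(3) lie_sum_right scale_sum_right sum_subtractf)
        then have "lie s (f c) - a *s f c = 0"
          using genspace_independent[OF lin_lie D(1) mem _ c] a by simp
        then show ?thesis by auto
      qed
      moreover have "lie t (f c) = c *s f c"
        using T_diagonalizable[OF _ D(2)[OF c]] insert.prems by simp
      ultimately show ?thesis by auto
    qed
    then show ?thesis unfolding D(3) by (intro span_sum span_base)
  qed
  then have "span (?E F) \<subseteq> span (?E (insert t F))" by (intro span_minimal) auto
  then show ?case using insert by auto
qed simp

section \<open>The root space decomposition\<close>

definition weights :: "('g \<Rightarrow> 'k) set" where
  "weights = insert (\<lambda>_. 0) (roots T)"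

lemma weights_dual: "\<kappa> \<in> weights \<Longrightarrow> \<kappa> \<in> dual T"
  by (auto simp: weights_def roots_dual dual_zero)

lemma root_space_zero: "root_space T (\<lambda>_. 0) = T"
  using T_abelian centralizer_T by (auto simp: root_space_def)

lemma subspace_root_space: "subspace (root_space T \<gamma>)"
  by (rule subspaceI)
    (auto simp: root_space_def lie_zero_right lie_add_right lie_scale_right scale_right_distrib mult.commute)

lemma root_space_lie:
  assumes "x \<in> root_space T \<gamma>" "y \<in> root_space T \<mu>"
  shows "lie x y \<in> root_space T (\<lambda>h. \<gamma> h + \<mu> h)"
  using assms by (simp add: root_space_def lie_derivation lie_scale_left lie_scale_right scale_left_distrib)

lemma root_space_trivial:
  assumes "\<kappa> \<in> dual T" "\<kappa> \<notin> weights" "x \<in> root_space T \<kappa>"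
  shows "x = 0"
proof (rule ccontr)
  assume "x \<noteq> 0"
  then have "root_space T \<kappa> \<noteq> {0}" using assms(3) by blast
  then show False using assms by (auto simp: weights_def roots_def)
qed

lemma span_weight_spaces: "span (\<Union>\<kappa>\<in>weights. root_space T \<kappa>) = UNIV"
proof -
  let ?E = "{x. \<forall>t\<in>\<omega> ` {1..rank}. \<exists>c. lie t x = c *s x}"
  have "x \<in> (\<Union>\<kappa>\<in>weights. root_space T \<kappa>)" if "x \<in> ?E" for x
  proof (cases "x = 0")
    case True
    then show ?thesis using subspace_0[OF subspace_T] root_space_zero by (auto simp: weights_def)
  next
    case False
    from that have "\<forall>i\<in>{1..rank}. \<exists>c. lie (\<omega> i) x = c *s x" by blast
    then obtain c where c: "\<And>i. i \<in> {1..rank} \<Longrightarrow> lie (\<omega> i) x = c i *s x" by metis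
    define a where "a = (\<lambda>t. \<Sum>i=1..rank. \<alpha> i t * c i)"
    have eig: "lie t x = a t *s x" if "t \<in> T" for t
    proof -
      have "lie t x = lie (\<Sum>i=1..rank. \<alpha> i t *s \<omega> i) x"
        using T_expand[OF that] by simp
      also have "\<dots> = (\<Sum>i=1..rank. (\<alpha> i t * c i) *s x)"
        by (simp add: lie_sum_left lie_scale_left c)
      finally show ?thesis by (simp add: a_def scale_sum_left)
    qed
    show ?thesis
    proof (cases "\<exists>t\<in>T. a t \<noteq> 0")
      case True
      then show ?thesis using eigenvector_root[OF False eig] unfolding weights_def by blast
    next
      case False
      then have "x \<in> T" using eig by (intro centralizer_T) auto
      then show ?thesis using root_space_zero by (auto simp: weights_def)
    qed
  qed
  then have "span ?E \<subseteq> span (\<Union>\<kappa>\<in>weights. root_space T \<kappa>)" by (intro span_mono) blast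
  moreover have "span ?E = UNIV"
    by (rule simultaneous_eigenvectors) (use coweight_T in auto)
  ultimately show ?thesis by blast
qed

text \<open>Applying ad t - \<mu> t, for a t that separates \<kappa> from \<mu>, deletes the term at
  \<mu> and multiplies the one at \<kappa> by a nonzero scalar.\<close>

lemma weight_independent:
  "finite S \<Longrightarrow> S \<subseteq> dual T \<Longrightarrow> (\<And>\<kappa>. \<kappa> \<in> S \<Longrightarrow> f \<kappa> \<in> root_space T \<kappa>) \<Longrightarrow>
    sum f S = 0 \<Longrightarrow> \<kappa> \<in> S \<Longrightarrow> f \<kappa> = 0"
proof (induction S arbitrary: f \<kappa> rule: finite_induct)
  case (insert \<mu> S)
  have z: "f \<kappa> = 0" if \<kappa>: "\<kappa> \<in> S" for \<kappa>
  proof -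
    have "\<kappa> \<noteq> \<mu>" using \<kappa> insert.hyps by auto
    then obtain t where t: "t \<in> T" "\<kappa> t \<noteq> \<mu> t"
      using dual_eqI[of \<kappa> T \<mu>] insert.prems(1) \<kappa> by blast
    have "0 = lie t (sum f (insert \<mu> S)) - \<mu> t *s sum f (insert \<mu> S)"
      using insert.prems(3) by (simp add: lie_zero_right)
    also have "\<dots> = (\<Sum>\<nu>\<in>insert \<mu> S. lie t (f \<nu>) - \<mu> t *s f \<nu>)"
      by (simp only: lie_sum_right scale_sum_right sum_subtractf)
    also have "\<dots> = (\<Sum>\<nu>\<in>insert \<mu> S. (\<nu> t - \<mu> t) *s f \<nu>)"
      by (rule sum.cong) (use insert.prems(2) t(1) in \<open>auto simp: root_space_def scale_left_diff_distrib\<close>)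
    also have "\<dots> = (\<Sum>\<nu>\<in>S. (\<nu> t - \<mu> t) *s f \<nu>)"
      using insert.hyps by simp
    finally have "(\<Sum>\<nu>\<in>S. (\<nu> t - \<mu> t) *s f \<nu>) = 0" by simp
    moreover have "(\<nu> t - \<mu> t) *s f \<nu> \<in> root_space T \<nu>" if "\<nu> \<in> S" for \<nu>
      using insert.prems(2) that by (intro subspace_scale subspace_root_space) auto
    ultimately have "(\<kappa> t - \<mu> t) *s f \<kappa> = 0"
      using insert.IH[of "\<lambda>\<nu>. (\<nu> t - \<mu> t) *s f \<nu>" \<kappa>] insert.prems(1) \<kappa> by blast
    then show ?thesis using t(2) by simp
  qed
  then have "f \<mu> = 0" using insert.prems(3) insert.hyps by simp
  then show ?case using z insert.prems(4) by auto
qed simp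

lemma finite_weights: "finite weights"
proof -
  have "\<forall>\<gamma>\<in>roots T. \<exists>x. x \<in> root_space T \<gamma> \<and> x \<noteq> 0" using root_vector by metis
  then obtain f where f: "\<And>\<gamma>. \<gamma> \<in> roots T \<Longrightarrow> f \<gamma> \<in> root_space T \<gamma> \<and> f \<gamma> \<noteq> 0" by metis
  have ind: "c \<gamma> = 0" if "finite F" "F \<subseteq> roots T" "(\<Sum>\<gamma>\<in>F. c \<gamma> *s f \<gamma>) = 0" "\<gamma> \<in> F" for F c \<gamma>
  proof -
    have "c \<mu> *s f \<mu> \<in> root_space T \<mu>" if "\<mu> \<in> F" for \<mu>
      using f[of \<mu>] that \<open>F \<subseteq> roots T\<close> by (intro subspace_scale subspace_root_space) auto
    moreover have "F \<subseteq> dual T" using that(2) roots_dual by blast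
    ultimately have "c \<gamma> *s f \<gamma> = 0"
      using weight_independent[OF that(1) _ _ that(3,4)] by blast
    moreover have "f \<gamma> \<noteq> 0" using f[of \<gamma>] that by blast
    ultimately show ?thesis by simp
  qed
  have "inj_on f (roots T)" and "independent (f ` roots T)"
    by (rule independent_family, fact ind)+
  then have "finite (roots T)" using finiteI_independent finite_imageD by blast
  then show ?thesis by (simp add: weights_def)
qed

lemma finite_roots: "finite (roots T)"
  using finite_weights by (simp add: weights_def)

lemma weight_decomposition:
  obtains f where "\<And>\<kappa>. f \<kappa> \<in> root_space T \<kappa>" "x = sum f weights"
proof -
  have "x \<in> span (\<Union>\<kappa>\<in>weights. root_space T \<kappa>)" using span_weight_spaces by simp
  then obtain F f where F: "finite F" "F \<subseteq> weights" "\<And>\<kappa>. \<kappa> \<in> F \<Longrightarrow> f \<kappa> \<in> root_space T \<kappa>" "x = sum f F"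
    by (rule span_Union_sum[where V = "root_space T", OF subspace_root_space]) blast
  let ?g = "\<lambda>\<kappa>. if \<kappa> \<in> F then f \<kappa> else 0"
  have "sum ?g weights = sum f F"
    using F(2) finite_weights by (intro sum.mono_neutral_cong_right) auto
  moreover have "?g \<kappa> \<in> root_space T \<kappa>" for \<kappa>
    using F(3) subspace_0[OF subspace_root_space] by auto
  ultimately show ?thesis using F(4) by (intro that[of ?g]) auto
qed

text \<open>Invariance moves h from one argument to the other with the opposite sign, so \<kappa> h
  + \<mu> h annihilates the value of the form.\<close>

lemma killing_orthogonal:
  assumes x: "x \<in> root_space T \<kappa>" and y: "y \<in> root_space T \<mu>" and h: "h \<in> T" "\<kappa> h + \<mu> h \<noteq> 0"
  shows "killing x y = 0"
proof -
  have "\<kappa> h * killing x y = killing (lie h x) y"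
    using x h by (simp add: root_space_def killing_scale_left)
  also have "\<dots> = - killing (lie x h) y"
    using killing_scale_left[of "-1" "lie x h" y] lie_anti[of h x] by simp
  also have "\<dots> = - (\<mu> h * killing x y)"
    using y h by (simp add: killing_invariant root_space_def killing_scale_right)
  finally have "(\<kappa> h + \<mu> h) * killing x y = 0" by (simp add: algebra_simps)
  then show ?thesis using h by simp
qed

text \<open>Nondegeneracy gives z that pairs nontrivially with x, and only a component y of weight
  -\<gamma> can contribute. The bracket is nonzero because killing h [x, y] = \<gamma> h * killing x
  y.\<close>

lemma opposite_root_vector:
  assumes \<gamma>: "\<gamma> \<in> roots T" and x: "x \<in> root_space T \<gamma>" "x \<noteq> 0"
  obtains y where "y \<in> root_space T (\<lambda>h. - \<gamma> h)" "lie x y \<in> T" "lie x y \<noteq> 0"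
proof -
  obtain z where z: "killing x z \<noteq> 0" using killing_zero x(2) by blast
  obtain f where f: "\<And>\<kappa>. f \<kappa> \<in> root_space T \<kappa>" "z = sum f weights"
    by (rule weight_decomposition[of z]) blast
  have "\<exists>\<kappa>\<in>weights. killing x (f \<kappa>) \<noteq> 0"
    using z unfolding f(2) killing_sum_right by (meson sum.neutral)
  then obtain \<kappa> where \<kappa>: "\<kappa> \<in> weights" "killing x (f \<kappa>) \<noteq> 0" by blast
  have *: "\<gamma> h + \<kappa> h = 0" if "h \<in> T" for h
    using killing_orthogonal[OF x(1) f(1) that] \<kappa>(2) by blast
  have y: "f \<kappa> \<in> root_space T (\<lambda>h. - \<gamma> h)"
    using f(1)[of \<kappa>] * by (auto simp: root_space_def add_eq_0_iff)
  have "lie x (f \<kappa>) \<in> root_space T (\<lambda>_. 0)"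
    using root_space_lie[OF x(1) y] by simp
  then have T: "lie x (f \<kappa>) \<in> T" using root_space_zero by simp
  obtain h where h: "h \<in> T" "\<gamma> h \<noteq> 0"
    using rho_T root_rho_nonzero[OF \<gamma>] by blast
  have "killing h (lie x (f \<kappa>)) = \<gamma> h * killing x (f \<kappa>)"
    using x(1) h(1) by (simp add: killing_invariant[symmetric] root_space_def killing_scale_left)
  then have "lie x (f \<kappa>) \<noteq> 0" using h \<kappa> killing_zero_right[of h] by auto
  then show ?thesis using that y T by blast
qed

end

subsection \<open>Reflections and bases\<close>

context based_simple_lie_algebra
begin

section \<open>Root strings and reflections\<close>

lemma root_vector_nilpotent:
  assumes x: "x \<in> root_space T \<beta>" and s: "s \<in> T" "\<beta> s \<noteq> 0"
  shows "\<exists>n. (lie x ^^ n) v = 0"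
proof (rule shift_nilpotent[OF lin_lie[of s] lin_lie s(2)])
  fix d y assume y: "y \<in> genspace (lie s) d"
  have "x \<in> genspace (lie s) (\<beta> s)"
    using x s(1) by (auto simp: genspace_def root_space_def intro!: exI[of _ 1])
  from lie_genspace[OF this y] show "lie x y \<in> genspace (lie s) (d + \<beta> s)"
    by (simp add: add.commute)
qed

lemma funpow_root_space:
  assumes "x \<in> root_space T \<beta>" "v \<in> root_space T \<gamma>"
  shows "(lie x ^^ n) v \<in> root_space T (\<lambda>h. \<gamma> h + of_nat n * \<beta> h)"
proof (induction n)
  case (Suc n)
  from root_space_lie[OF assms(1) this] show ?case by (simp add: algebra_simps)
qed (use assms in simp)

text \<open>
  If \<open>\<beta>\<close> vanished on \<open>lie x y\<close>, then \<open>x\<close>, \<open>y\<close> and \<open>lie x y\<close> would span a Heisenberg algebra whose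
  centre acts by a nonzero scalar on a string of root spaces, where \<open>x\<close> and \<open>y\<close> are nilpotent.
\<close>

lemma root_bracket_nonzero:
  assumes \<beta>: "\<beta> \<in> roots T" and x: "x \<in> root_space T \<beta>" and y: "y \<in> root_space T (\<lambda>h. - \<beta> h)"
    and t: "lie x y \<in> T" "lie x y \<noteq> 0"
  shows "\<beta> (lie x y) \<noteq> 0"
proof
  let ?t = "lie x y"
  assume 0: "\<beta> ?t = 0"
  obtain i where i: "i \<in> {1..rank}" "\<alpha> i ?t \<noteq> 0" using T_zero[OF t(1)] t(2) by blast
  let ?c = "\<alpha> i ?t"
  have r: "rho \<in> T" "\<beta> rho \<noteq> 0" "- \<beta> rho \<noteq> 0" using rho_T root_rho_nonzero[OF \<beta>] by auto
  obtain v0 where v0: "v0 \<in> root_space T (\<alpha> i)" "v0 \<noteq> 0"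
    using root_vector[OF simple_root[OF i(1)]] .
  obtain p where p: "(lie x ^^ p) v0 \<noteq> 0" "lie x ((lie x ^^ p) v0) = 0"
    by (rule last_nonzero[OF v0(2) root_vector_nilpotent[OF x r(1,2)]])
  define v where "v = (lie x ^^ p) v0"
  have tv: "lie ?t ((lie y ^^ n) v) = ?c *s (lie y ^^ n) v" for n
    using funpow_root_space[OF y funpow_root_space[OF x v0(1), of p], of n] t(1) 0
    by (simp add: v_def root_space_def)
  have xy: "lie x ((lie y ^^ Suc n) v) = (of_nat (Suc n) * ?c) *s (lie y ^^ n) v" for n
  proof (induction n)
    case 0
    then show ?case using lie_derivation[of x y v] tv[of 0] p by (simp add: v_def lie_zero_right)
  next
    case (Suc n)
    have "lie x ((lie y ^^ Suc (Suc n)) v)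
        = lie ?t ((lie y ^^ Suc n) v) + lie y (lie x ((lie y ^^ Suc n) v))"
      using lie_derivation[of x y "(lie y ^^ Suc n) v"] by simp
    also have "\<dots> = (?c + of_nat (Suc n) * ?c) *s (lie y ^^ Suc n) v"
      unfolding tv Suc by (simp add: lie_scale_right scale_left_distrib)
    finally show ?case by (simp add: algebra_simps)
  qed
  obtain n where n: "(lie y ^^ n) v \<noteq> 0" "lie y ((lie y ^^ n) v) = 0"
    using last_nonzero[OF _ root_vector_nilpotent[OF y r(1,3)], of v] p(1) v_def by blast
  have "(of_nat (Suc n) * ?c) *s (lie y ^^ n) v = 0"
    using xy[of n] n(2) by (simp add: lie_zero_right)
  then have "of_nat (Suc n) * ?c = 0" using n(1) by simp
  then show False using i(2) of_nat_neq_0[of n, where 'a = 'k] by (simp del: of_nat_Suc)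
qed

text \<open>Raise a vector of weight \<gamma> by e to a highest vector w of weight \<gamma> + p
  \<beta>, and let n be its \<open>sl2\<close>-weight. Then k = n - 2 p, and f^(n - p) w is a
  nonzero vector of the reflected weight. This covers k >= 0; exchanging e and f covers the
  rest.\<close>

lemma root_string_half:
  assumes e: "e \<in> root_space T \<beta>" and f: "f \<in> root_space T (\<lambda>h. - \<beta> h)"
    and h: "lie e f \<in> T" "\<beta> (lie e f) = 2" and \<beta>: "\<beta> \<in> dual T" and \<gamma>: "\<gamma> \<in> roots T"
  obtains k :: int where "\<gamma> (lie e f) = of_int k"
    "0 \<le> k \<Longrightarrow> (\<lambda>x. \<gamma> x - of_int k * \<beta> x) \<in> weights"
proof -
  obtain v where v: "v \<in> root_space T \<gamma>" "v \<noteq> 0" using root_vector[OF \<gamma>] .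
  have nz: "\<beta> (lie e f) \<noteq> 0" "- \<beta> (lie e f) \<noteq> 0" using h(2) by auto
  obtain p where p: "(lie e ^^ p) v \<noteq> 0" "lie e ((lie e ^^ p) v) = 0"
    by (rule last_nonzero[OF v(2) root_vector_nilpotent[OF e h(1) nz(1)]])
  define w where "w = (lie e ^^ p) v"
  have w: "w \<in> root_space T (\<lambda>h. \<gamma> h + of_nat p * \<beta> h)"
    unfolding w_def by (rule funpow_root_space[OF e v(1)])
  have hf: "lie (lie e f) f = (- 2) *s f" using f h by (simp add: root_space_def)
  have hw: "lie (lie e f) w = (\<gamma> (lie e f) + of_nat p * 2) *s w"
    using w h by (simp add: root_space_def)
  obtain n where n: "\<gamma> (lie e f) + of_nat p * 2 = of_nat n" "\<And>j. j \<le> n \<Longrightarrow> (lie f ^^ j) w \<noteq> 0"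
    using highest_weight_integral[OF hf _ _ hw root_vector_nilpotent[OF f h(1) nz(2)]] p
    unfolding w_def by blast
  have k: "\<gamma> (lie e f) = of_int (int n - 2 * int p)" using n(1) by (simp add: algebra_simps)
  have "(\<lambda>x. \<gamma> x - of_int (int n - 2 * int p) * \<beta> x) \<in> weights" if "0 \<le> int n - 2 * int p"
  proof (rule ccontr)
    assume nw: "\<not> ?thesis"
    \<comment> \<open>k >= 0 means n >= 2 p, so the natural subtraction is exact.\<close>
    define j where "j = n - p"
    have j: "j \<le> n" "of_nat j = (of_nat n - of_nat p :: 'k)" using that by (auto simp: j_def)
    have "(lie f ^^ j) w \<in> root_space T (\<lambda>x. \<gamma> x - of_int (int n - 2 * int p) * \<beta> x)"
      using funpow_root_space[OF f w, of j] j(2) by (simp add: algebra_simps)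
    moreover have "(\<lambda>x. \<gamma> x - of_int (int n - 2 * int p) * \<beta> x) \<in> dual T"
      using dual_plus[OF roots_dual[OF \<gamma>] dual_smult[OF \<beta>, of "- of_int (int n - 2 * int p)"]]
      by (simp only: mult_minus_left add_uminus_conv_diff)
    ultimately have "(lie f ^^ j) w = 0" using root_space_trivial nw by blast
    then show False using n(2)[OF j(1)] by simp
  qed
  then show ?thesis using k that by blast
qed

text \<open>\<open>root_bracket_nonzero\<close> allows y to be rescaled so that \<beta> takes the
  value 2 at h. When \<gamma> h is negative, the string is followed in the other direction: the
  triple f, x, -h with root -\<beta> leads to the same reflected weight.\<close>

lemma reflection:
  assumes \<beta>: "\<beta> \<in> roots T"
  obtains h where "h \<in> T" "\<beta> h = 2" "\<And>\<gamma>. \<gamma> \<in> roots T \<Longrightarrow> (\<lambda>x. \<gamma> x - \<gamma> h * \<beta> x) \<in> roots T"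
proof -
  obtain x where x: "x \<in> root_space T \<beta>" "x \<noteq> 0" using root_vector[OF \<beta>] .
  obtain y where y: "y \<in> root_space T (\<lambda>h. - \<beta> h)" "lie x y \<in> T" "lie x y \<noteq> 0"
    by (rule opposite_root_vector[OF \<beta> x])
  have nz: "\<beta> (lie x y) \<noteq> 0" by (rule root_bracket_nonzero[OF \<beta> x(1) y])
  have \<beta>d: "\<beta> \<in> dual T" by (rule roots_dual[OF \<beta>])
  define f where "f = (2 / \<beta> (lie x y)) *s y"
  define h where "h = lie x f"
  have f: "f \<in> root_space T (\<lambda>h. - \<beta> h)"
    unfolding f_def by (intro subspace_scale subspace_root_space y)
  have h_eq: "h = (2 / \<beta> (lie x y)) *s lie x y" by (simp add: h_def f_def lie_scale_right)
  have h: "h \<in> T" "\<beta> h = 2"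
    unfolding h_eq using nz by (auto intro: subspace_scale subspace_T y simp: dual_scale[OF \<beta>d y(2)])
  let ?\<beta>' = "\<lambda>x. - \<beta> x"
  have \<beta>': "?\<beta>' \<in> dual T" using dual_smult[OF \<beta>d, of "-1"] by simp
  have h': "lie f x = - h" using lie_anti[of f x] by (simp add: h_def)
  have h'T: "lie f x \<in> T" unfolding h' by (intro subspace_neg subspace_T h)
  have neg: "\<phi> (lie f x) = - \<phi> h" if "\<phi> \<in> dual T" for \<phi>
    using dual_scale[OF that h(1), of "-1"] by (simp add: h')
  have "(\<lambda>x. \<gamma> x - \<gamma> h * \<beta> x) \<in> roots T" if \<gamma>: "\<gamma> \<in> roots T" for \<gamma>
  proof -
    note \<gamma>d = roots_dual[OF \<gamma>]
    obtain k :: int where k: "\<gamma> h = of_int k"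
      "0 \<le> k \<Longrightarrow> (\<lambda>x. \<gamma> x - of_int k * \<beta> x) \<in> weights"
      using root_string_half[OF x(1) f _ _ \<beta>d \<gamma>] h unfolding h_def[symmetric] by blast
    have x': "x \<in> root_space T (\<lambda>h. - ?\<beta>' h)" using x(1) by simp
    have two: "?\<beta>' (lie f x) = 2" using neg[OF \<beta>d] h by simp
    obtain k' :: int where k': "\<gamma> (lie f x) = of_int k'"
      "0 \<le> k' \<Longrightarrow> (\<lambda>x. \<gamma> x - of_int k' * ?\<beta>' x) \<in> weights"
      using root_string_half[OF f x' h'T two \<beta>' \<gamma>] by blast
    have "(of_int k' :: 'k) = of_int (- k)" using k'(1) k(1) neg[OF \<gamma>d] by simp
    then have "k' = - k" by (simp only: of_int_eq_iff)
    then have w: "(\<lambda>x. \<gamma> x - \<gamma> h * \<beta> x) \<in> weights" using k k'(2) by (cases "0 \<le> k") auto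
    have "(\<lambda>x. \<gamma> x - \<gamma> h * \<beta> x) \<noteq> (\<lambda>_. 0)"
    proof
      assume 0: "(\<lambda>x. \<gamma> x - \<gamma> h * \<beta> x) = (\<lambda>_. 0)"
      have "\<gamma> h - \<gamma> h * \<beta> h = 0" using 0 by meson
      then have "\<gamma> h = 0" using h(2) by simp
      then have "\<gamma> = (\<lambda>_. 0)" using 0 by simp
      then show False using roots_nonzero[OF \<gamma>] by simp
    qed
    then show ?thesis using w by (simp add: weights_def)
  qed
  then show ?thesis using that h by blast
qed

lemma root_uminus:
  assumes "\<gamma> \<in> roots T" shows "(\<lambda>x. - \<gamma> x) \<in> roots T"
proof -
  obtain h where "\<gamma> h = 2" "(\<lambda>x. \<gamma> x - \<gamma> h * \<gamma> x) \<in> roots T"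
    using reflection[OF assms] assms by metis
  then show ?thesis by simp
qed

section \<open>Change of base\<close>

lemma based: "simple_roots T \<beta> \<Longrightarrow> based_simple_lie_algebra scale lie T \<beta>"
  by unfold_locales (rule cartan)

text \<open>The base is a parameter, so that positivity for two bases can be compared within one
  context.\<close>

definition positive :: "(nat \<Rightarrow> 'g \<Rightarrow> 'k) \<Rightarrow> ('g \<Rightarrow> 'k) \<Rightarrow> bool" where
  "positive \<beta> \<gamma> \<longleftrightarrow> (\<exists>c :: nat \<Rightarrow> int. (\<forall>i. 0 \<le> c i) \<and> (\<forall>h\<in>T. \<gamma> h = (\<Sum>i=1..rank. of_int (c i) * \<beta> i h)))"

lemma coeff_coweight:
  assumes "i \<in> {1..rank}" shows "(\<Sum>j=1..rank. a j * \<alpha> j (\<omega> i)) = a i"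
proof -
  have "(\<Sum>j=1..rank. a j * \<alpha> j (\<omega> i)) = (\<Sum>j=1..rank. if j = i then a i else 0)"
    by (rule sum.cong) (use assms simple_coweight in auto)
  then show ?thesis using assms by simp
qed

lemma root_coweight:
  assumes "\<gamma> \<in> roots T" "i \<in> {1..rank}" shows "\<gamma> (\<omega> i) = of_int (root_coeff \<gamma> i)"
  using root_coeff(1)[OF assms(1) coweight_T[OF assms(2)]] coeff_coweight[OF assms(2)] by simp

text \<open>The new base is the image of \<alpha> under the reflection s at \<alpha> i, which
  preserves the roots and hence carries a combination that is a root to a root. As s changes only
  the coefficient at i, a positive root of the new base that involves another simple root stays
  positive for \<alpha>; any other one is a nonnegative multiple of -\<alpha> i.\<close>

lemma reflected_base:
  assumes i: "i \<in> {1..rank}"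
  obtains \<beta> where "simple_roots T \<beta>"
    "\<And>n :: nat \<Rightarrow> nat. (\<lambda>h. \<Sum>j=1..rank. of_nat (n j) * \<alpha> j h) \<in> roots T \<Longrightarrow>
        (\<lambda>h. \<Sum>j=1..rank. of_nat (n j) * \<beta> j h) \<in> roots T"
    "\<And>\<gamma>. \<gamma> \<in> roots T \<Longrightarrow> positive \<beta> \<gamma> \<Longrightarrow> positive \<alpha> \<gamma> \<and> \<gamma> \<noteq> \<alpha> i \<or>
        (\<exists>c::int\<ge>0. \<forall>h\<in>T. \<gamma> h = - (of_int c * \<alpha> i h))"
proof -
  obtain u where u: "u \<in> T" "\<alpha> i u = 2"
    "\<And>\<gamma>. \<gamma> \<in> roots T \<Longrightarrow> (\<lambda>x. \<gamma> x - \<gamma> u * \<alpha> i x) \<in> roots T"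
    by (rule reflection[OF simple_root[OF i]]) blast
  define s where "s = (\<lambda>\<gamma> x. \<gamma> x - \<gamma> u * \<alpha> i x)"
  have s_root: "s \<gamma> \<in> roots T" if "\<gamma> \<in> roots T" for \<gamma> using u(3)[OF that] by (simp add: s_def)
  have ss: "s (s \<gamma>) = \<gamma>" for \<gamma> using u(2) by (simp add: s_def fun_eq_iff algebra_simps)
  have s_sum: "s (\<lambda>h. \<Sum>j=1..rank. a j * \<phi> j h) = (\<lambda>h. \<Sum>j=1..rank. a j * s (\<phi> j) h)" for a \<phi>
    by (simp add: s_def fun_eq_iff algebra_simps sum_subtractf sum_distrib_right sum_distrib_left)
  have s_cong: "s \<phi> h = s \<psi> h" if "\<And>h. h \<in> T \<Longrightarrow> \<phi> h = \<psi> h" "h \<in> T" for \<phi> \<psi> h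
    using that u(1) by (simp add: s_def)
  define \<beta> where "\<beta> = (\<lambda>j. s (\<alpha> j))"
  have "simple_roots T \<beta>"
    unfolding simple_roots_def rank_def[symmetric]
  proof (intro conjI ballI allI impI)
    fix j assume "j \<in> {1..rank}"
    then show "\<beta> j \<in> roots T" by (simp add: \<beta>_def s_root simple_root)
  next
    fix c j assume c: "\<forall>h\<in>T. (\<Sum>j=1..rank. c j * \<beta> j h) = 0" and j: "j \<in> {1..rank}"
    define \<phi> where "\<phi> = (\<lambda>h. \<Sum>j=1..rank. c j * \<alpha> j h)"
    have "s \<phi> h = 0" if "h \<in> T" for h
      unfolding \<phi>_def s_sum using c that by (simp add: \<beta>_def)
    then have "s (s \<phi>) h = 0" if "h \<in> T" for h
      using s_cong[of "s \<phi>" "\<lambda>_. 0" h] that by (simp add: s_def)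
    then have "\<phi> (\<omega> j) = 0" unfolding ss using coweight_T[OF j] by blast
    then show "c j = 0" using coeff_coweight[OF j] by (simp add: \<phi>_def)
  next
    fix \<gamma> assume \<gamma>: "\<gamma> \<in> roots T"
    note rc = root_coeff[OF s_root[OF \<gamma>]]
    have "\<gamma> h = (\<Sum>j=1..rank. of_int (root_coeff (s \<gamma>) j) * \<beta> j h)" if "h \<in> T" for h
    proof -
      have "s (s \<gamma>) h = s (\<lambda>h. \<Sum>j=1..rank. of_int (root_coeff (s \<gamma>) j) * \<alpha> j h) h"
        by (rule s_cong[OF rc(1) that])
      then show ?thesis by (simp only: ss s_sum \<beta>_def)
    qed
    then show "\<exists>c :: nat \<Rightarrow> int. (\<forall>h\<in>T. \<gamma> h = (\<Sum>j=1..rank. of_int (c j) * \<beta> j h)) \<and>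
        ((\<forall>i\<in>{1..rank}. 0 \<le> c i) \<or> (\<forall>i\<in>{1..rank}. c i \<le> 0))"
      using rc(3) by (intro exI[of _ "root_coeff (s \<gamma>)"]) auto
  qed
  moreover have "(\<lambda>h. \<Sum>j=1..rank. of_nat (n j) * \<beta> j h) \<in> roots T"
    if "(\<lambda>h. \<Sum>j=1..rank. of_nat (n j) * \<alpha> j h) \<in> roots T" for n :: "nat \<Rightarrow> nat"
    using s_root[OF that] by (simp only: s_sum \<beta>_def)
  moreover have "positive \<alpha> \<gamma> \<and> \<gamma> \<noteq> \<alpha> i \<or> (\<exists>c::int\<ge>0. \<forall>h\<in>T. \<gamma> h = - (of_int c * \<alpha> i h))"
    if \<gamma>: "\<gamma> \<in> roots T" and pos: "positive \<beta> \<gamma>" for \<gamma>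
  proof -
    obtain c :: "nat \<Rightarrow> int" where c: "\<And>i. 0 \<le> c i"
      "\<And>h. h \<in> T \<Longrightarrow> \<gamma> h = (\<Sum>j=1..rank. of_int (c j) * \<beta> j h)"
      using pos by (auto simp: positive_def)
    have \<gamma>_eq: "\<gamma> h = (\<Sum>j=1..rank. of_int (c j) * \<alpha> j h) - (\<Sum>j=1..rank. of_int (c j) * \<alpha> j u) * \<alpha> i h"
      if "h \<in> T" for h
      using c(2)[OF that] by (simp add: \<beta>_def s_def algebra_simps sum_subtractf sum_distrib_left)
    show ?thesis
    proof (cases "\<exists>j\<in>{1..rank}. j \<noteq> i \<and> c j \<noteq> 0")
      case True
      then obtain j where j: "j \<in> {1..rank}" "j \<noteq> i" "0 < c j" using c(1) by (metis order_le_less)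
      have "of_int (root_coeff \<gamma> j) = (of_int (c j) :: 'k)"
        using \<gamma>_eq[OF coweight_T[OF j(1)]] coeff_coweight[OF j(1)] root_coweight[OF \<gamma> j(1)]
          simple_coweight[OF j(1) i] j(2) by simp
      then have rj: "0 < root_coeff \<gamma> j" using j(3) by simp
      then have "\<forall>k. 0 \<le> root_coeff \<gamma> k" using root_coeff(3)[OF \<gamma>] by (metis leD)
      then have "positive \<alpha> \<gamma>" using root_coeff(1)[OF \<gamma>] by (auto simp: positive_def)
      moreover have "\<gamma> \<noteq> \<alpha> i"
        using root_coweight[OF \<gamma> j(1)] rj simple_coweight[OF j(1) i] j(2) by auto
      ultimately show ?thesis by blast
    next
      case False
      then have z: "c j = 0" if "j \<in> {1..rank}" "j \<noteq> i" for j using that by blast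
      have sum_i: "(\<Sum>j=1..rank. of_int (c j) * \<alpha> j h) = of_int (c i) * \<alpha> i h" for h
      proof -
        have "(\<Sum>j=1..rank. of_int (c j) * \<alpha> j h) = (\<Sum>j=1..rank. if j = i then of_int (c i) * \<alpha> i h else 0)"
          by (rule sum.cong) (use z in auto)
        then show ?thesis using i by simp
      qed
      have "\<gamma> h = - (of_int (c i) * \<alpha> i h)" if "h \<in> T" for h
        unfolding \<gamma>_eq[OF that] sum_i u(2) by simp
      then show ?thesis using c(1) by blast
    qed
  qed
  ultimately show ?thesis by (rule that)
qed

text \<open>Among the bases whose combination with coefficients n is a root, take one with the
  fewest positive roots of negative value at H. If some \<beta> i had a negative value, reflecting
  in it would remove \<beta> i from these roots, and the only roots that could become positive are
  nonnegative multiples of -\<beta> i, whose values are not negative.\<close>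

lemma dominant_base:
  fixes n :: "nat \<Rightarrow> nat"
  assumes H: "H \<in> T" and v: "\<And>\<gamma>. \<gamma> \<in> roots T \<Longrightarrow> \<gamma> H = of_int (v \<gamma>)"
    and n: "(\<lambda>h. \<Sum>j=1..rank. of_nat (n j) * \<alpha> j h) \<in> roots T"
  obtains \<beta> where "simple_roots T \<beta>" "(\<lambda>h. \<Sum>j=1..rank. of_nat (n j) * \<beta> j h) \<in> roots T"
    "\<And>i. i \<in> {1..rank} \<Longrightarrow> 0 \<le> v (\<beta> i)"
proof -
  define P where "P = (\<lambda>\<beta>. simple_roots T \<beta> \<and> (\<lambda>h. \<Sum>j=1..rank. of_nat (n j) * \<beta> j h) \<in> roots T)"
  define N where "N = (\<lambda>\<beta>. {\<gamma> \<in> roots T. positive \<beta> \<gamma> \<and> v \<gamma> < 0})"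
  have "P \<alpha>" using simple_roots n by (simp add: P_def)
  then obtain \<beta> where \<beta>: "P \<beta>" and min: "\<And>\<beta>'. P \<beta>' \<Longrightarrow> card (N \<beta>) \<le> card (N \<beta>')"
    using ex_has_least_nat[of P \<alpha> "\<lambda>\<beta>. card (N \<beta>)"] by auto
  interpret B: based_simple_lie_algebra scale lie T \<beta>
    using \<beta> by (intro based) (simp add: P_def)
  have "0 \<le> v (\<beta> i)" if i: "i \<in> {1..rank}" for i
  proof (rule ccontr)
    assume neg: "\<not> 0 \<le> v (\<beta> i)"
    note \<beta>i = B.simple_root[OF i]
    obtain \<beta>' where \<beta>': "simple_roots T \<beta>'"
      "\<And>n :: nat \<Rightarrow> nat. (\<lambda>h. \<Sum>j=1..rank. of_nat (n j) * \<beta> j h) \<in> roots T \<Longrightarrow>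
          (\<lambda>h. \<Sum>j=1..rank. of_nat (n j) * \<beta>' j h) \<in> roots T"
      "\<And>\<gamma>. \<gamma> \<in> roots T \<Longrightarrow> B.positive \<beta>' \<gamma> \<Longrightarrow> B.positive \<beta> \<gamma> \<and> \<gamma> \<noteq> \<beta> i \<or>
          (\<exists>c::int\<ge>0. \<forall>h\<in>T. \<gamma> h = - (of_int c * \<beta> i h))"
      by (rule B.reflected_base[OF i]) blast
    have "P \<beta>'" using \<beta>' \<beta> by (auto simp: P_def)
    have "N \<beta>' \<subseteq> N \<beta> - {\<beta> i}"
    proof
      fix \<gamma> assume "\<gamma> \<in> N \<beta>'"
      then have \<gamma>: "\<gamma> \<in> roots T" "positive \<beta>' \<gamma>" "v \<gamma> < 0" by (auto simp: N_def)
      have "\<not> (\<exists>c::int\<ge>0. \<forall>h\<in>T. \<gamma> h = - (of_int c * \<beta> i h))"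
      proof
        assume "\<exists>c::int\<ge>0. \<forall>h\<in>T. \<gamma> h = - (of_int c * \<beta> i h)"
        then obtain c :: int where c: "0 \<le> c" "\<gamma> H = - (of_int c * \<beta> i H)" using H by blast
        then have "(of_int (v \<gamma>) :: 'k) = of_int (- (c * v (\<beta> i)))"
          using v[OF \<gamma>(1)] v[OF \<beta>i] by simp
        then have "v \<gamma> = - (c * v (\<beta> i))" by (simp only: of_int_eq_iff)
        then show False using c(1) neg \<gamma>(3) mult_nonneg_nonpos[of c "v (\<beta> i)"] by simp
      qed
      then show "\<gamma> \<in> N \<beta> - {\<beta> i}" using \<beta>'(3)[OF \<gamma>(1,2)] \<gamma> by (auto simp: N_def)
    qed
    moreover have "\<beta> i \<in> N \<beta>"
    proof -
      have "positive \<beta> (\<beta> i)" unfolding positive_def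
      proof (intro exI[of _ "\<lambda>j. if j = i then 1 else 0"] conjI ballI allI)
        fix h
        have "(\<Sum>j=1..rank. of_int (if j = i then 1 else 0) * \<beta> j h) = (\<Sum>j=1..rank. if j = i then \<beta> i h else 0)"
          by (rule sum.cong) auto
        then show "\<beta> i h = (\<Sum>j=1..rank. of_int (if j = i then 1 else 0) * \<beta> j h)" using i by simp
      qed simp
      then show ?thesis using \<beta>i neg by (simp add: N_def)
    qed
    moreover have "finite (N \<beta>)" using finite_roots by (simp add: N_def)
    ultimately have "card (N \<beta>') < card (N \<beta>)" by (intro psubset_card_mono) auto
    then show False using min[OF \<open>P \<beta>'\<close>] by simp
  qed
  then show ?thesis using \<beta> that by (auto simp: P_def)
qed

end

subsection \<open>The highest root\<close>

context based_simple_lie_algebra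
begin

lemma root_coeff_simple:
  assumes "i \<in> {1..rank}" "j \<in> {1..rank}"
  shows "root_coeff (\<alpha> i) j = (if i = j then 1 else 0)"
proof -
  have "of_int (root_coeff (\<alpha> i) j) = \<alpha> i (\<omega> j)"
    using root_coweight[OF simple_root[OF assms(1)] assms(2)] by simp
  also have "\<dots> = of_int (if i = j then 1 else 0)" using simple_coweight[OF assms(2,1)] by simp
  finally show ?thesis by (simp only: of_int_eq_iff)
qed

lemma height_simple:
  assumes i: "i \<in> {1..rank}" shows "height (\<alpha> i) = 1"
proof -
  have "height (\<alpha> i) = (\<Sum>j=1..rank. if j = i then 1 else 0)"
    unfolding height_def using root_coeff_simple[OF i] by (intro sum.cong) auto
  then show ?thesis using i by simp
qed

lemma root_coeff_plus:
  assumes "\<gamma> \<in> roots T" "\<mu> \<in> roots T" "(\<lambda>h. \<gamma> h + \<mu> h) \<in> roots T" "i \<in> {1..rank}"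
  shows "root_coeff (\<lambda>h. \<gamma> h + \<mu> h) i = root_coeff \<gamma> i + root_coeff \<mu> i"
proof -
  have "of_int (root_coeff (\<lambda>h. \<gamma> h + \<mu> h) i) = (of_int (root_coeff \<gamma> i + root_coeff \<mu> i) :: 'k)"
    using root_coweight[OF assms(3,4)] root_coweight[OF assms(1,4)] root_coweight[OF assms(2,4)] by simp
  then show ?thesis by (simp only: of_int_eq_iff)
qed

lemma height_plus:
  assumes "\<gamma> \<in> roots T" "\<mu> \<in> roots T" "(\<lambda>h. \<gamma> h + \<mu> h) \<in> roots T"
  shows "height (\<lambda>h. \<gamma> h + \<mu> h) = height \<gamma> + height \<mu>"
  unfolding height_def using root_coeff_plus[OF assms] by (simp add: sum.distrib)

lemma root_coeff_sign:
  assumes \<gamma>: "\<gamma> \<in> roots T"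
  shows "0 < height \<gamma> \<Longrightarrow> 0 \<le> root_coeff \<gamma> i" "height \<gamma> < 0 \<Longrightarrow> root_coeff \<gamma> i \<le> 0"
proof -
  show "0 \<le> root_coeff \<gamma> i" if "0 < height \<gamma>"
  proof (rule ccontr)
    assume "\<not> ?thesis"
    then have "\<forall>i. root_coeff \<gamma> i \<le> 0" using root_coeff(3)[OF \<gamma>] by (metis not_le)
    then have "height \<gamma> \<le> 0" unfolding height_def by (intro sum_nonpos) simp
    then show False using that by simp
  qed
  show "root_coeff \<gamma> i \<le> 0" if "height \<gamma> < 0"
  proof (rule ccontr)
    assume "\<not> ?thesis"
    then have "\<forall>i. 0 \<le> root_coeff \<gamma> i" using root_coeff(3)[OF \<gamma>] by (metis not_le order_less_imp_le)
    then have "0 \<le> height \<gamma>" unfolding height_def by (intro sum_nonneg) simp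
    then show False using that by simp
  qed
qed

text \<open>In classical terms U(n-) x, the module generated by x over the negative part. The
  inductive form provides the induction by which it is shown to be an ideal.\<close>

inductive_set lowering_closure :: "'g \<Rightarrow> 'g set" for x where
  base: "x \<in> lowering_closure x"
| zero: "0 \<in> lowering_closure x"
| add: "v \<in> lowering_closure x \<Longrightarrow> w \<in> lowering_closure x \<Longrightarrow> v + w \<in> lowering_closure x"
| scale: "v \<in> lowering_closure x \<Longrightarrow> c *s v \<in> lowering_closure x"
| lower: "v \<in> lowering_closure x \<Longrightarrow> \<gamma> \<in> roots T \<Longrightarrow> height \<gamma> < 0 \<Longrightarrow> y \<in> root_space T \<gamma> \<Longrightarrow>
    lie y v \<in> lowering_closure x"

lemma subspace_lowering_closure: "subspace (lowering_closure x)"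
  by (rule subspaceI) (auto intro: lowering_closure.intros)

text \<open>The dominance order. It carries its own coefficients because it also compares weights
  that are not roots, such as 0.\<close>

definition below :: "('g \<Rightarrow> 'k) \<Rightarrow> ('g \<Rightarrow> 'k) \<Rightarrow> bool" where
  "below \<kappa> \<delta> \<longleftrightarrow> (\<exists>c::nat \<Rightarrow> int. (\<forall>i. 0 \<le> c i) \<and> (\<forall>h\<in>T. \<kappa> h = \<delta> h - (\<Sum>i=1..rank. of_int (c i) * \<alpha> i h)))"

text \<open>Bracketing with a negative root vector subtracts a nonnegative combination of simple
  roots, so every step stays below \<delta>.\<close>

lemma lowering_closure_weights:
  assumes x: "x \<in> root_space T \<delta>" and \<delta>: "\<delta> \<in> roots T"
  shows "v \<in> lowering_closure x \<Longrightarrow> v \<in> span (\<Union>\<kappa>\<in>{\<kappa>\<in>weights. below \<kappa> \<delta>}. root_space T \<kappa>)"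
proof (induction rule: lowering_closure.induct)
  case base
  have "below \<delta> \<delta>" unfolding below_def by (intro exI[of _ "\<lambda>_. 0"]) simp
  then show ?case using x \<delta> by (intro span_base) (auto simp: weights_def)
next
  case (lower v \<gamma> y)
  let ?S = "\<Union>\<kappa>\<in>{\<kappa>\<in>weights. below \<kappa> \<delta>}. root_space T \<kappa>"
  show ?case
  proof (rule span_image_invariant[OF lin_lie _ lower.IH])
    fix w assume "w \<in> ?S"
    then obtain \<kappa> where \<kappa>: "\<kappa> \<in> weights" "below \<kappa> \<delta>" "w \<in> root_space T \<kappa>" by blast
    have yw: "lie y w \<in> root_space T (\<lambda>h. \<gamma> h + \<kappa> h)" by (rule root_space_lie[OF lower.hyps(4) \<kappa>(3)])
    have d: "(\<lambda>h. \<gamma> h + \<kappa> h) \<in> dual T"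
      by (intro dual_plus weights_dual \<kappa> roots_dual lower.hyps)
    show "lie y w \<in> span ?S"
    proof (cases "(\<lambda>h. \<gamma> h + \<kappa> h) \<in> weights")
      case True
      obtain c :: "nat \<Rightarrow> int" where c: "\<And>i. 0 \<le> c i"
        "\<And>h. h \<in> T \<Longrightarrow> \<kappa> h = \<delta> h - (\<Sum>i=1..rank. of_int (c i) * \<alpha> i h)"
        using \<kappa>(2) by (auto simp: below_def)
      have "below (\<lambda>h. \<gamma> h + \<kappa> h) \<delta>" unfolding below_def
      proof (intro exI[of _ "\<lambda>i. c i - root_coeff \<gamma> i"] conjI allI ballI)
        show "0 \<le> c i - root_coeff \<gamma> i" for i
          using c(1)[of i] root_coeff_sign(2)[OF lower.hyps(2,3), of i] by simp
        show "\<gamma> h + \<kappa> h = \<delta> h - (\<Sum>i=1..rank. of_int (c i - root_coeff \<gamma> i) * \<alpha> i h)" if "h \<in> T" for h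
          using c(2)[OF that] root_coeff(1)[OF lower.hyps(2) that]
          by (simp add: algebra_simps sum_subtractf)
      qed
      then show ?thesis using yw True by (intro span_base) auto
    next
      case False
      then have "lie y w = 0" by (rule root_space_trivial[OF d _ yw])
      then show ?thesis by (simp add: span_zero)
    qed
  qed
qed (auto intro: span_zero span_add span_scale)

text \<open>
  A root vector \<open>x\<close> of maximal height generates \<open>UNIV\<close> as an ideal, and this ideal is spanned by
  iterated brackets of \<open>x\<close> with negative root vectors; hence every root lies below the root of \<open>x\<close>.
\<close>

lemma highest_root_exists:
  obtains \<delta> where "\<delta> \<in> roots T" "\<And>\<gamma> i. \<gamma> \<in> roots T \<Longrightarrow> root_coeff \<gamma> i \<le> root_coeff \<delta> i"
proof -
  have 1: "1 \<in> {1..rank}" using rank_pos by simp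
  have fin: "finite (height ` roots T)" "height ` roots T \<noteq> {}"
    using finite_roots simple_root[OF 1] by auto
  have "Max (height ` roots T) \<in> height ` roots T" using fin by (rule Max_in)
  then obtain \<delta> where \<delta>: "\<delta> \<in> roots T" "Max (height ` roots T) = height \<delta>" by blast
  have max: "height \<gamma> \<le> height \<delta>" if "\<gamma> \<in> roots T" for \<gamma>
    using Max_ge[OF fin(1), of "height \<gamma>"] that \<delta>(2) by simp
  note \<delta> = \<delta>(1)
  have pos: "0 < height \<delta>" using max[OF simple_root[OF 1]] height_simple[OF 1] by simp
  obtain x where x: "x \<in> root_space T \<delta>" "x \<noteq> 0" using root_vector[OF \<delta>] .
  let ?V = "lowering_closure x"
  have V: "subspace ?V" by (rule subspace_lowering_closure)
  have "lie z v \<in> ?V" if "v \<in> ?V" for v z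
    using that
  proof (induction arbitrary: z rule: lowering_closure.induct)
    case base
    obtain f where f: "\<And>\<kappa>. f \<kappa> \<in> root_space T \<kappa>" "z = sum f weights"
      by (rule weight_decomposition[of z]) blast
    have "lie (f \<kappa>) x \<in> ?V" if \<kappa>: "\<kappa> \<in> weights" for \<kappa>
    proof (cases "\<kappa> = (\<lambda>_. 0)")
      case True
      then have "f \<kappa> \<in> T" using f(1)[of \<kappa>] root_space_zero by simp
      then have "lie (f \<kappa>) x = \<delta> (f \<kappa>) *s x" using x(1) by (simp add: root_space_def)
      then show ?thesis by (auto intro: lowering_closure.intros)
    next
      case False
      then have \<kappa>r: "\<kappa> \<in> roots T" using \<kappa> by (simp add: weights_def)
      show ?thesis
      proof (cases "height \<kappa> < 0")
        case True
        then show ?thesis by (rule lowering_closure.lower[OF lowering_closure.base \<kappa>r _ f(1)])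
      next
        case False
        then have hp: "0 < height \<kappa>" using height_nonzero[OF \<kappa>r] by simp
        have mem: "lie (f \<kappa>) x \<in> root_space T (\<lambda>h. \<kappa> h + \<delta> h)" by (rule root_space_lie[OF f(1) x(1)])
        have rho: "\<kappa> rho + \<delta> rho = of_int (height \<kappa> + height \<delta>)"
          using root_rho[OF \<kappa>r] root_rho[OF \<delta>] by simp
        have "(\<lambda>h. \<kappa> h + \<delta> h) \<notin> roots T"
          using height_plus[OF \<kappa>r \<delta>] max hp by fastforce
        moreover have "(\<lambda>h. \<kappa> h + \<delta> h) \<noteq> (\<lambda>_. 0)"
        proof
          assume "(\<lambda>h. \<kappa> h + \<delta> h) = (\<lambda>_. 0)"
          then have "\<kappa> rho + \<delta> rho = 0" by meson
          then have "height \<kappa> + height \<delta> = 0" unfolding rho of_int_eq_0_iff .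
          then show False using pos hp by simp
        qed
        ultimately have "lie (f \<kappa>) x = 0"
          using root_space_trivial[OF dual_plus[OF roots_dual[OF \<kappa>r] roots_dual[OF \<delta>]] _ mem]
          by (simp add: weights_def)
        then show ?thesis by (simp add: lowering_closure.zero)
      qed
    qed
    then show ?case unfolding f(2) lie_sum_left by (intro subspace_sum V)
  next
    case (lower v \<gamma> y)
    \<comment> \<open>The first summand is the induction hypothesis at \<open>lie z y\<close>, which
      is why z is kept arbitrary.\<close>
    have "lie z (lie y v) = lie (lie z y) v + lie y (lie z v)" by (rule lie_derivation)
    then show ?case
      using lowering_closure.add[OF lower.IH lowering_closure.lower[OF lower.IH lower.hyps(2-4)]] by simp
  qed (auto simp: lie_zero_right lie_add_right lie_scale_right intro: lowering_closure.intros)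
  then have "ideal ?V" unfolding ideal_def using V by blast
  moreover have "?V \<noteq> {0}" using x(2) lowering_closure.base[of x] by blast
  ultimately have UNIV: "?V = UNIV" using ideal_trivial by blast
  have "root_coeff \<gamma> i \<le> root_coeff \<delta> i" if \<gamma>: "\<gamma> \<in> roots T" for \<gamma> i
  proof (cases "i \<in> {1..rank}")
    case i: True
    let ?Q = "{\<kappa>\<in>weights. below \<kappa> \<delta>}"
    obtain y where y: "y \<in> root_space T \<gamma>" "y \<noteq> 0" using root_vector[OF \<gamma>] .
    have "y \<in> span (\<Union>\<kappa>\<in>?Q. root_space T \<kappa>)"
      using lowering_closure_weights[OF x(1) \<delta>, of y] UNIV by simp
    then obtain F f where F: "finite F" "F \<subseteq> ?Q" "\<And>\<kappa>. \<kappa> \<in> F \<Longrightarrow> f \<kappa> \<in> root_space T \<kappa>" "y = sum f F"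
      by (rule span_Union_sum[where V = "root_space T", OF subspace_root_space]) blast
    have "\<gamma> \<in> F"
    proof (rule ccontr)
      assume nF: "\<gamma> \<notin> F"
      \<comment> \<open>Otherwise y and its own components would give a relation between distinct
        weight spaces.\<close>
      define g where "g = (\<lambda>\<kappa>. if \<kappa> = \<gamma> then - y else f \<kappa>)"
      have "sum g F = sum f F" using nF by (intro sum.cong) (auto simp: g_def)
      then have "sum g (insert \<gamma> F) = 0" using F nF by (simp add: g_def)
      moreover have "insert \<gamma> F \<subseteq> dual T" using F(2) weights_dual roots_dual[OF \<gamma>] by auto
      moreover have "g \<kappa> \<in> root_space T \<kappa>" if "\<kappa> \<in> insert \<gamma> F" for \<kappa>
        using that F(3) y(1) subspace_neg[OF subspace_root_space y(1)] by (auto simp: g_def)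
      ultimately have "g \<gamma> = 0" using weight_independent[of "insert \<gamma> F" g \<gamma>] F(1) by blast
      then show False using y(2) by (simp add: g_def)
    qed
    then have "below \<gamma> \<delta>" using F(2) by blast
    then obtain c :: "nat \<Rightarrow> int" where c: "\<And>i. 0 \<le> c i"
        "\<And>h. h \<in> T \<Longrightarrow> \<gamma> h = \<delta> h - (\<Sum>i=1..rank. of_int (c i) * \<alpha> i h)"
      by (auto simp: below_def)
    have "of_int (root_coeff \<gamma> i) = (of_int (root_coeff \<delta> i - c i) :: 'k)"
      using c(2)[OF coweight_T[OF i]] root_coweight[OF \<gamma> i] root_coweight[OF \<delta> i] coeff_coweight[OF i]
      by simp
    then have "root_coeff \<gamma> i = root_coeff \<delta> i - c i" by (simp only: of_int_eq_iff)
    then show ?thesis using c(1)[of i] by simp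
  next
    case False
    then show ?thesis using root_coeff(2)[OF \<gamma>] root_coeff(2)[OF \<delta>] by simp
  qed
  then show ?thesis using that \<delta> by blast
qed

lemma highest_root:
  shows "highest_root \<in> roots T" and "\<gamma> \<in> roots T \<Longrightarrow> root_coeff \<gamma> i \<le> root_coeff highest_root i"
proof -
  obtain \<delta> where \<delta>: "\<delta> \<in> roots T" "\<And>\<gamma> i. \<gamma> \<in> roots T \<Longrightarrow> root_coeff \<gamma> i \<le> root_coeff \<delta> i"
    by (rule highest_root_exists) blast
  have "highest_root = \<delta>" unfolding highest_root_def
  proof (rule the_equality)
    show "\<delta> \<in> roots T \<and> (\<forall>\<gamma>\<in>roots T. \<forall>i\<in>{1..rank}. root_coeff \<gamma> i \<le> root_coeff \<delta> i)"
      using \<delta> by blast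
    fix \<delta>' assume \<delta>': "\<delta>' \<in> roots T \<and> (\<forall>\<gamma>\<in>roots T. \<forall>i\<in>{1..rank}. root_coeff \<gamma> i \<le> root_coeff \<delta>' i)"
    then have d: "\<delta>' \<in> roots T" and le: "root_coeff \<delta> i \<le> root_coeff \<delta>' i" if "i \<in> {1..rank}" for i
      using \<delta>(1) that by blast+
    show "\<delta>' = \<delta>"
    proof (rule root_eqI)
      show "\<delta>' \<in> roots T" "\<delta> \<in> roots T" using \<delta>' \<delta> by blast+
      fix i assume i: "i \<in> {1..rank}"
      show "root_coeff \<delta>' i = root_coeff \<delta> i"
        by (rule antisym[OF \<delta>(2) le[OF i]]) (use \<delta>' in blast)
    qed
  qed
  then show "highest_root \<in> roots T" "\<gamma> \<in> roots T \<Longrightarrow> root_coeff \<gamma> i \<le> root_coeff highest_root i"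
    using \<delta> by blast+
qed

text \<open>The highest root dominates \<alpha> i, whose coefficient at i is 1; hence the conversion
  \<open>nat\<close> in \<open>mark\<close> is exact.\<close>

lemma mark_pos: "i \<in> {0..rank} \<Longrightarrow> 1 \<le> mark i"
proof (cases "i = 0")
  case False
  assume "i \<in> {0..rank}"
  with False have i: "i \<in> {1..rank}" by simp
  have "1 \<le> root_coeff highest_root i"
    using highest_root(2)[OF simple_root[OF i], of i] root_coeff_simple[OF i i] by simp
  then show ?thesis using False by (simp add: mark_def)
qed (simp add: mark_def)

lemma mark_highest_root: "i \<in> {1..rank} \<Longrightarrow> int (mark i) = root_coeff highest_root i"
  using mark_pos[of i] by (auto simp: mark_def)

text \<open>The form in which \<open>dominant_base\<close> carries the highest root to another
  base.\<close>

lemma highest_root_marks: "(\<lambda>h. \<Sum>j=1..rank. of_nat (mark j) * \<alpha> j h) \<in> roots T"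
proof -
  have "(\<lambda>h. \<Sum>j=1..rank. of_nat (mark j) * \<alpha> j h) = highest_root"
  proof (rule dual_eqI)
    show "(\<lambda>h. \<Sum>j=1..rank. of_nat (mark j) * \<alpha> j h) \<in> dual T" by (intro dual_sum_fun simple_dual)
    show "highest_root \<in> dual T" by (intro roots_dual highest_root)
    fix h assume h: "h \<in> T"
    have "of_nat (mark j) = (of_int (root_coeff highest_root j) :: 'k)" if "j \<in> {1..rank}" for j
      using mark_highest_root[OF that] by (metis of_int_of_nat_eq)
    then show "(\<Sum>j=1..rank. of_nat (mark j) * \<alpha> j h) = highest_root h"
      using root_coeff(1)[OF highest_root(1) h] by simp
  qed
  then show ?thesis using highest_root(1) by simp
qed

lemma root_coeff_bounds:
  assumes \<gamma>: "\<gamma> \<in> roots T"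
  shows "root_coeff \<gamma> i \<le> int (mark i)" "- int (mark i) \<le> root_coeff \<gamma> i"
proof -
  have le: "root_coeff \<mu> i \<le> int (mark i)" if "\<mu> \<in> roots T" for \<mu>
  proof (cases "i \<in> {1..rank}")
    case True
    then show ?thesis using highest_root(2)[OF that, of i] mark_highest_root[OF True] by simp
  qed (simp add: root_coeff(2)[OF that])
  show "root_coeff \<gamma> i \<le> int (mark i)" by (rule le[OF \<gamma>])
  show "- int (mark i) \<le> root_coeff \<gamma> i"
  proof (cases "i \<in> {1..rank}")
    case True
    have "of_int (root_coeff (\<lambda>x. - \<gamma> x) i) = (of_int (- root_coeff \<gamma> i) :: 'k)"
      using root_coweight[OF root_uminus[OF \<gamma>] True] root_coweight[OF \<gamma> True] by simp
    then have "root_coeff (\<lambda>x. - \<gamma> x) i = - root_coeff \<gamma> i" by (simp only: of_int_eq_iff)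
    then show ?thesis using le[OF root_uminus[OF \<gamma>]] by simp
  qed (simp add: root_coeff(2)[OF \<gamma>])
qed

text \<open>The centralizer lies in the generalized null space of \<open>lie rho\<close>, which is
  \<open>T\<close>. By comparison, every regular element has a centralizer of dimension at most
  \<open>rank\<close>.\<close>

lemma centralizer_rho: "dim (centralizer rho) \<le> rank"
proof -
  have "centralizer rho \<subseteq> genspace (lie rho) 0"
    by (auto simp: centralizer_def genspace_def intro: exI[of _ 1])
  then show ?thesis unfolding rank_def genspace_rho_zero by (rule dim_subset)
qed

text \<open>
  If the component of \<open>e\<close> at some simple root \<open>\<alpha> i\<close> were zero, \<open>lie e\<close> would map the Borel
  subalgebra into the span \<open>u\<close> of the other positive root spaces, whose dimension is smaller by
  more than \<open>rank\<close>; the centralizer of \<open>e\<close> would then be larger than that of \<open>rho\<close>.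
\<close>

lemma regular_degree:
  assumes reg: "regular e" and e: "e = sum f (roots T)" "\<And>\<gamma>. f \<gamma> \<in> root_space T \<gamma>"
    and H: "H \<in> T" and f: "\<And>\<gamma>. \<gamma> \<in> roots T \<Longrightarrow> f \<gamma> \<noteq> 0 \<Longrightarrow> \<gamma> H = of_int N" and N: "0 < N"
    and v: "\<And>i. i \<in> {1..rank} \<Longrightarrow> \<alpha> i H = of_int (v i)" "\<And>i. i \<in> {1..rank} \<Longrightarrow> 0 \<le> v i"
    and i: "i \<in> {1..rank}"
  shows "\<alpha> i H = of_int N"
proof (rule ccontr)
  assume ne: "\<alpha> i H \<noteq> of_int N"
  define P where "P = {\<gamma> \<in> roots T. 0 < height \<gamma>}"
  define u where "u = span (\<Union>\<gamma>\<in>P - {\<alpha> i}. root_space T \<gamma>)"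
  have fP: "\<gamma> \<in> P - {\<alpha> i}" if \<gamma>: "\<gamma> \<in> roots T" "f \<gamma> \<noteq> 0" for \<gamma>
  proof -
    have "of_int N = (\<Sum>j=1..rank. of_int (root_coeff \<gamma> j) * \<alpha> j H)"
      using f[OF \<gamma>] root_coeff(1)[OF \<gamma>(1) H] by simp
    also have "\<dots> = of_int (\<Sum>j=1..rank. root_coeff \<gamma> j * v j)" using v(1) by simp
    finally have "N = (\<Sum>j=1..rank. root_coeff \<gamma> j * v j)" by (simp only: of_int_eq_iff)
    \<comment> \<open>All simple roots are nonnegative at H, so a negative root cannot take the
      positive value N.\<close>
    moreover have "(\<Sum>j=1..rank. root_coeff \<gamma> j * v j) \<le> 0" if "height \<gamma> < 0"
      using root_coeff_sign(2)[OF \<gamma>(1) that] v(2) by (intro sum_nonpos mult_nonpos_nonneg) auto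
    ultimately have "0 < height \<gamma>" using N height_nonzero[OF \<gamma>(1)] by linarith
    moreover have "\<gamma> \<noteq> \<alpha> i" using f[OF \<gamma>] ne by auto
    ultimately show ?thesis using \<gamma>(1) by (simp add: P_def)
  qed
  note hi = height_simple[OF i]
  define b where "b = span (\<Union>\<kappa>\<in>insert (\<lambda>_. 0) P. root_space T \<kappa>)"
  have eb: "lie e y \<in> u" if "y \<in> b" for y
    unfolding u_def
  proof (rule span_image_invariant[OF lin_lie _ that[unfolded b_def]])
    fix y assume "y \<in> (\<Union>\<kappa>\<in>insert (\<lambda>_. 0) P. root_space T \<kappa>)"
    then obtain \<kappa> where \<kappa>: "\<kappa> \<in> insert (\<lambda>_. 0) P" "y \<in> root_space T \<kappa>" by blast
    have "lie (f \<gamma>) y \<in> u" if \<gamma>: "\<gamma> \<in> roots T" for \<gamma>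
    proof (cases "f \<gamma> = 0")
      case True
      then show ?thesis by (simp add: lie_zero_left u_def span_zero)
    next
      case False
      have \<gamma>P: "\<gamma> \<in> P - {\<alpha> i}" by (rule fP[OF \<gamma> False])
      have mem: "lie (f \<gamma>) y \<in> root_space T (\<lambda>h. \<gamma> h + \<kappa> h)" by (rule root_space_lie[OF e(2) \<kappa>(2)])
      show ?thesis
      proof (cases "\<kappa> = (\<lambda>_. 0)")
        case True
        then show ?thesis using mem \<gamma>P unfolding u_def by (intro span_base) auto
      next
        case False
        then have \<kappa>P: "\<kappa> \<in> roots T" "0 < height \<kappa>" using \<kappa>(1) by (auto simp: P_def)
        have d: "(\<lambda>h. \<gamma> h + \<kappa> h) \<in> dual T" by (intro dual_plus roots_dual \<gamma> \<kappa>P)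
        show ?thesis
        proof (cases "(\<lambda>h. \<gamma> h + \<kappa> h) \<in> roots T")
          case True
          have "2 \<le> height (\<lambda>h. \<gamma> h + \<kappa> h)"
            using height_plus[OF \<gamma> \<kappa>P(1) True] \<gamma>P \<kappa>P(2) by (simp add: P_def)
          then have "(\<lambda>h. \<gamma> h + \<kappa> h) \<in> P - {\<alpha> i}" using True hi by (auto simp: P_def)
          then show ?thesis using mem unfolding u_def by (intro span_base) blast
        next
          case False
          have "(\<lambda>h. \<gamma> h + \<kappa> h) \<noteq> (\<lambda>_. 0)"
          proof
            assume "(\<lambda>h. \<gamma> h + \<kappa> h) = (\<lambda>_. 0)"
            then have "\<gamma> rho + \<kappa> rho = 0" by meson
            then have "(of_int (height \<gamma> + height \<kappa>) :: 'k) = 0"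
              using root_rho[OF \<gamma>] root_rho[OF \<kappa>P(1)] by simp
            then show False unfolding of_int_eq_0_iff using \<gamma>P \<kappa>P(2) by (simp add: P_def)
          qed
          then have "lie (f \<gamma>) y = 0"
            using root_space_trivial[OF d _ mem] False by (simp add: weights_def)
          then show ?thesis by (simp add: u_def span_zero)
        qed
      qed
    qed
    then show "lie e y \<in> span (\<Union>\<gamma>\<in>P - {\<alpha> i}. root_space T \<gamma>)"
      unfolding e(1) lie_sum_left u_def by (intro span_sum)
  qed
  obtain x where x: "x \<in> root_space T (\<alpha> i)" "x \<noteq> 0" using root_vector[OF simple_root[OF i]] .
  have \<alpha>P: "\<alpha> i \<in> P" using simple_root[OF i] hi by (simp add: P_def)
  obtain B where B: "B \<subseteq> T" "independent B" "T \<subseteq> span B" "card B = dim T"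
    by (rule basis_exists[of T]) blast
  have spanB: "span B = T" using B(1,3) subspace_T by (simp add: span_minimal subset_antisym)
  have xT: "x \<notin> T"
  proof
    assume "x \<in> T"
    then have "lie rho x = 0" by (rule T_abelian[OF rho_T])
    moreover have "lie rho x = x" using x(1) rho_T simple_rho[OF i] by (simp add: root_space_def)
    ultimately show False using x(2) by simp
  qed
  let ?D = "insert x B"
  have D: "independent ?D" using xT spanB B(2) by (simp add: independent_insertI)
  obtain C where C: "C \<subseteq> u" "independent C" "u \<subseteq> span C" "card C = dim u"
    by (rule basis_exists[of u]) blast
  have spanC: "span C = u" using C(1,3) by (simp add: span_minimal subset_antisym u_def)
  have int: "span C \<inter> span ?D = {0}"
  proof -
    have "z = 0" if z: "z \<in> u" "z \<in> span ?D" for z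
    proof -
      obtain k where k: "z - k *s x \<in> T" using z(2) spanB by (auto simp: span_breakdown_eq)
      obtain F g where F: "finite F" "F \<subseteq> P - {\<alpha> i}" "\<And>\<kappa>. \<kappa> \<in> F \<Longrightarrow> g \<kappa> \<in> root_space T \<kappa>" "z = sum g F"
        using z(1) unfolding u_def
        by (rule span_Union_sum[where V = "root_space T", OF subspace_root_space]) blast
      \<comment> \<open>The component z - k x in \<open>T\<close>, the vector k x of weight \<alpha>
        i and the components of -z add up to 0 and have distinct weights, so the first two
        vanish.\<close>
      define G where "G = (\<lambda>\<kappa>. if \<kappa> = (\<lambda>_. 0) then z - k *s x else if \<kappa> = \<alpha> i then k *s x else - g \<kappa>)"
      have nF: "(\<lambda>_. 0) \<notin> insert (\<alpha> i) F" "\<alpha> i \<notin> F"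
        using F(2) roots_nonzero[of "\<lambda>_. 0"] roots_nonzero[OF simple_root[OF i]] by (auto simp: P_def)
      have sF: "sum G F = - z"
      proof -
        have "sum G F = (\<Sum>\<kappa>\<in>F. - g \<kappa>)" using nF by (intro sum.cong) (auto simp: G_def)
        then show ?thesis by (simp add: sum_negf F(4))
      qed
      have G0: "G (\<lambda>_. 0) = z - k *s x" by (simp add: G_def)
      have Gi: "G (\<alpha> i) = k *s x" using nF by (auto simp: G_def)
      have s: "sum G (insert (\<lambda>_. 0) (insert (\<alpha> i) F)) = 0"
        using F(1) nF by (simp add: sF G0 Gi)
      have Gm: "G \<kappa> \<in> root_space T \<kappa>" if "\<kappa> \<in> insert (\<lambda>_. 0) (insert (\<alpha> i) F)" for \<kappa>
      proof -
        note mem = that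
        consider "\<kappa> = (\<lambda>_. 0)" | "\<kappa> = \<alpha> i" | "\<kappa> \<in> F" using mem by blast
        then show ?thesis
        proof cases
          case 1
          then show ?thesis using k root_space_zero by (simp add: G0)
        next
          case 2
          then show ?thesis using x(1) by (simp add: Gi subspace_scale subspace_root_space)
        next
          case 3
          then have "G \<kappa> = - g \<kappa>" using nF by (auto simp: G_def)
          then show ?thesis using F(3)[OF 3] by (simp add: subspace_neg subspace_root_space)
        qed
      qed
      have "insert (\<lambda>_. 0) (insert (\<alpha> i) F) \<subseteq> dual T"
        using F(2) roots_dual dual_zero simple_dual[OF i] by (auto simp: P_def)
      then have "G (\<lambda>_. 0) = 0" "G (\<alpha> i) = 0"
        using weight_independent[OF _ _ Gm s] F(1) by blast+
      then show "z = 0" using G0 Gi by simp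
    qed
    then show ?thesis using spanC span_zero by auto
  qed
  have ind: "independent (C \<union> ?D)" by (rule independent_Un[OF C(2) int D])
  have fin: "finite C" "finite ?D" by (rule finiteI_independent[OF C(2)], rule finiteI_independent[OF D])
  have "C \<inter> ?D \<subseteq> {0}" using int span_superset[of C] span_superset[of ?D] by blast
  moreover have "0 \<notin> C" using C(2) dependent_zero by blast
  ultimately have "C \<inter> ?D = {}" by auto
  moreover have "x \<notin> B" using xT B(1) by blast
  ultimately have card: "card (C \<union> ?D) = dim u + (rank + 1)"
    using fin B(4) C(4) by (simp only: card_Un_disjoint) (simp add: rank_def)
  have "u \<subseteq> b" unfolding u_def b_def by (rule span_mono) auto
  moreover have "T \<subseteq> b"
  proof
    fix t assume "t \<in> T"
    then have "t \<in> root_space T (\<lambda>_. 0)" using root_space_zero by simp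
    then show "t \<in> b" unfolding b_def by (intro span_base) blast
  qed
  moreover have "x \<in> b" unfolding b_def using x(1) \<alpha>P by (intro span_base) auto
  ultimately have "C \<union> ?D \<subseteq> b" using C(1) B(1) by auto
  then have "dim u + (rank + 1) \<le> dim b"
    using independent_card_le_dim[OF _ ind, of b] card by simp
  also have "\<dots> \<le> dim {y \<in> b. lie e y = 0} + dim u"
    by (rule dim_kernel_bound[OF lin_lie _ eb]) (simp_all add: b_def)
  also have "dim {y \<in> b. lie e y = 0} \<le> dim (centralizer e)"
    by (rule dim_subset) (auto simp: centralizer_def)
  finally have "rank + 1 \<le> dim (centralizer e)" by simp
  moreover have "dim (centralizer e) \<le> dim (centralizer rho)" using reg by (simp add: regular_def)
  ultimately show False using centralizer_rho by simp
qed

end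

subsection \<open>Kac labels\<close>

lemma primitive_rootD:
  assumes "primitive_root_of_unity m z"
  shows "0 < m" "z ^ m = 1" "0 < j \<Longrightarrow> j < m \<Longrightarrow> z ^ j \<noteq> 1"
  using assms unfolding primitive_root_of_unity_def by blast+

lemma primitive_root_dvd:
  assumes z: "primitive_root_of_unity m z" and "z ^ k = 1"
  shows "m dvd k"
proof -
  have "z ^ (m * (k div m) + k mod m) = z ^ (k mod m)"
    by (simp only: power_add power_mult primitive_rootD(2)[OF z] power_one mult_1_left)
  then have "z ^ (k mod m) = 1" using assms(2) by (simp only: mult_div_mod_eq)
  moreover have "k mod m < m" using primitive_rootD(1)[OF z] by (rule mod_less_divisor)
  ultimately have "\<not> 0 < k mod m" using primitive_rootD(3)[OF z] by blast
  then show ?thesis by (simp add: dvd_eq_mod_eq_0)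
qed

lemma primitive_root_dvd_int:
  assumes z: "primitive_root_of_unity m z" and k: "z powi k = 1"
  shows "int m dvd k"
proof (cases "0 \<le> k")
  case True
  then have "m dvd nat k" using primitive_root_dvd[OF z] k by (simp add: power_int_def)
  then show ?thesis using True by (simp add: nat_dvd_iff flip: int_dvd_int_iff)
next
  case False
  then have "z ^ nat (- k) = 1" using k by (simp add: power_int_def power_inverse)
  then have "m dvd nat (- k)" by (rule primitive_root_dvd[OF z])
  then have "int m dvd - k" using False by (simp flip: int_dvd_int_iff)
  then show ?thesis by simp
qed

text \<open>
  Here \<open>c\<close> are the coefficients of a root, \<open>n\<close> the marks and \<open>p\<close> the Kac labels; the quantity
  \<open>n i * d - m * c i\<close> with \<open>d = (\<Sum>j\<in>J. c j * p j)\<close> is the value of the root at the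
  grading element \<open>H\<close> below.
\<close>

context
  fixes J :: "nat set" and c n p :: "nat \<Rightarrow> int" and i :: nat and m d :: int
  assumes J: "finite J" "i \<in> J" and p: "\<And>j. 0 \<le> p j" "2 \<le> p i"
    and n: "\<And>j. j \<in> J \<Longrightarrow> 0 \<le> n j" "1 \<le> n i"
    and c: "\<And>j. j \<in> J \<Longrightarrow> c j \<le> n j" "\<And>j. j \<in> J \<Longrightarrow> - n j \<le> c j"
    and sign: "(\<forall>j\<in>J. 0 \<le> c j) \<or> (\<forall>j\<in>J. c j \<le> 0)"
    and m: "m = (\<Sum>j\<in>J. n j * p j)" and d: "d = (\<Sum>j\<in>J. c j * p j)"
begin

lemma label_sum_ge: "2 * n i \<le> m"
proof -
  have "n i * p i \<le> m" unfolding m using J p n by (intro member_le_sum) auto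
  moreover have "n i * 2 \<le> n i * p i" using p n by (intro mult_left_mono) auto
  ultimately show ?thesis by simp
qed

text \<open>The absolute value of d is at most m. For nonnegative coefficients d = 1, and c i * p i
  <= 1 with p i >= 2 forces c i = 0. For nonpositive ones d = 1 - m; the numbers n j + c j are
  nonnegative, and their sum weighted by the p j is 1, which forces c i = - n i.\<close>

lemma label_degree_one:
  assumes "m dvd d - 1" shows "n i * d - m * c i = n i"
proof -
  have m2: "2 \<le> m" using label_sum_ge n(2) by linarith
  have dm: "d \<le> m" "- m \<le> d"
  proof -
    show "d \<le> m" unfolding d m using c(1) p by (intro sum_mono mult_right_mono) auto
    have "(\<Sum>j\<in>J. (- n j) * p j) \<le> d" unfolding d using c(2) p by (intro sum_mono mult_right_mono) auto
    then show "- m \<le> d" by (simp add: m sum_negf)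
  qed
  from assms obtain k where k: "d - 1 = m * k" by (auto simp: dvd_def)
  show ?thesis using sign
  proof
    assume c0: "\<forall>j\<in>J. 0 \<le> c j"
    have "0 \<le> d" unfolding d using c0 p by (intro sum_nonneg) auto
    have "k = 0"
    proof (rule ccontr)
      assume "k \<noteq> 0"
      then consider "1 \<le> k" | "k \<le> -1" by linarith
      then show False
      proof cases
        case 1
        then have "m * 1 \<le> m * k" using m2 by (intro mult_left_mono) auto
        then show False using k dm by linarith
      next
        case 2
        then have "m * k \<le> m * (-1)" using m2 by (intro mult_left_mono) auto
        then show False using k m2 \<open>0 \<le> d\<close> by linarith
      qed
    qed
    then have d1: "d = 1" using k by simp
    have "c i * p i \<le> d" unfolding d using J c0 p by (intro member_le_sum) auto
    moreover have "c i * 2 \<le> c i * p i" using c0 J p by (intro mult_left_mono) auto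
    ultimately have "c i = 0" using d1 c0 J(2) by fastforce
    then show ?thesis using d1 by simp
  next
    assume c0: "\<forall>j\<in>J. c j \<le> 0"
    have "d \<le> 0" unfolding d using c0 p by (intro sum_nonpos) (auto intro: mult_nonpos_nonneg)
    have "k = - 1"
    proof (rule ccontr)
      assume "k \<noteq> - 1"
      then consider "0 \<le> k" | "k \<le> -2" by linarith
      then show False
      proof cases
        case 1
        then have "m * 0 \<le> m * k" using m2 by (intro mult_left_mono) auto
        then show False using k \<open>d \<le> 0\<close> by linarith
      next
        case 2
        then have "m * k \<le> m * (-2)" using m2 by (intro mult_left_mono) auto
        then show False using k m2 dm by linarith
      qed
    qed
    then have d1: "d = 1 - m" using k by simp
    have "(n i + c i) * p i \<le> (\<Sum>j\<in>J. (n j + c j) * p j)"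
    proof (rule member_le_sum[OF J(2) _ J(1)])
      fix j assume "j \<in> J - {i}"
      then show "0 \<le> (n j + c j) * p j" using c(2)[of j] p(1)[of j] by (intro mult_nonneg_nonneg) auto
    qed
    also have "\<dots> = 1" using d1 unfolding d m by (simp add: sum.distrib algebra_simps)
    finally have "(n i + c i) * p i \<le> 1" .
    moreover have "(n i + c i) * 2 \<le> (n i + c i) * p i" using c(2)[OF J(2)] p by (intro mult_left_mono) auto
    ultimately have "(n i + c i) * 2 \<le> 1" by linarith
    then have "c i = - n i" using c(2)[OF J(2)] by simp
    then show ?thesis by (simp add: d1 right_diff_distrib mult.commute)
  qed
qed

text \<open>Write m = n i * p i + R. The terms with p i cancel in n i * d - m * c i, and what is
  left is at most n i * R. Since n i * p i >= 2, R is at most m - 2.\<close>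

lemma label_degree_bound: "n i * d - m * c i \<le> n i * (m - 2)"
proof -
  define R where "R = (\<Sum>j\<in>J - {i}. n j * p j)"
  have mR: "m = n i * p i + R" unfolding m R_def using J by (simp add: sum.remove)
  have dR: "d = c i * p i + (\<Sum>j\<in>J - {i}. c j * p j)" unfolding d using J by (simp add: sum.remove)
  have R: "0 \<le> R" unfolding R_def using n p by (intro sum_nonneg) auto
  have "n i * 2 \<le> n i * (n i * p i)"
  proof -
    have "1 * 2 \<le> n i * p i" using n(2) p(2) by (intro mult_mono) auto
    then show ?thesis using n(2) by (intro mult_left_mono) auto
  qed
  then have nR: "n i * R \<le> n i * (m - 2)" using mR by (simp add: algebra_simps)
  show ?thesis using sign
  proof
    assume c0: "\<forall>j\<in>J. 0 \<le> c j"
    have "(\<Sum>j\<in>J - {i}. c j * p j) \<le> R"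
      unfolding R_def using c(1) p by (intro sum_mono mult_right_mono) auto
    then have "n i * d \<le> n i * (c i * p i + R)" unfolding dR using n by (intro mult_left_mono) auto
    then have "n i * d - m * c i \<le> n i * R - c i * R" unfolding mR by (simp add: algebra_simps)
    moreover have "0 \<le> c i * R" using c0 J R by simp
    ultimately show ?thesis using nR by linarith
  next
    assume c0: "\<forall>j\<in>J. c j \<le> 0"
    have "(\<Sum>j\<in>J - {i}. c j * p j) \<le> 0"
      using c0 p by (intro sum_nonpos) (auto intro: mult_nonpos_nonneg)
    then have "n i * d \<le> n i * (c i * p i)" unfolding dR using n by (intro mult_left_mono) auto
    then have "n i * d - m * c i \<le> (- c i) * R" unfolding mR by (simp add: algebra_simps)
    moreover have "(- c i) * R \<le> n i * R" using c(2)[OF J(2)] R by (intro mult_right_mono) auto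
    ultimately show ?thesis using nR by linarith
  qed
qed

end

section \<open>From Kac labels to the grading by H\<close>

context based_simple_lie_algebra
begin

lemma label_degree_simple: "i \<in> {1..rank} \<Longrightarrow> label_degree p (\<alpha> i) = int (p i)"
proof -
  assume i: "i \<in> {1..rank}"
  have "label_degree p (\<alpha> i) = (\<Sum>j=1..rank. if j = i then int (p i) else 0)"
    unfolding label_degree_def using root_coeff_simple[OF i] by (intro sum.cong) auto
  then show ?thesis using i by simp
qed

text \<open>On simple root vectors, g^n = id makes n * p i divisible by m for i >= 1. Expanding n *
  m by the definition of m extends this to i = 0, and since the labels have gcd 1, m divides
  n.\<close>

lemma kac_order:
  assumes z: "primitive_root_of_unity (label_order p) z" and gcd: "Gcd (p ` {0..rank}) = 1"
    and g: "kac_automorphism z p g" and n: "0 < n" "g ^^ n = id"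
  shows "label_order p \<le> n"
proof -
  let ?m = "label_order p"
  have g': "lin g" "\<And>\<gamma> x. \<gamma> \<in> roots T \<Longrightarrow> x \<in> root_space T \<gamma> \<Longrightarrow> g x = z powi label_degree p \<gamma> *s x"
    using g by (auto simp: kac_automorphism_def inner_automorphism_linear)
  have simple: "?m dvd n * p i" if i: "i \<in> {1..rank}" for i
  proof (rule primitive_root_dvd[OF z])
    obtain x where x: "x \<in> root_space T (\<alpha> i)" "x \<noteq> 0" using root_vector[OF simple_root[OF i]] .
    have gx: "g x = z ^ p i *s x" using g'(2)[OF simple_root[OF i] x(1)] by (simp add: label_degree_simple[OF i])
    have "(g ^^ k) x = (z ^ p i) ^ k *s x" for k
      by (induction k) (simp_all add: gx lin_scale[OF g'(1)] mult.commute)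
    then have "(z ^ p i) ^ n *s x = 1 *s x" using n(2) by (metis id_apply scale_one)
    then have "(z ^ p i) ^ n = 1" using x(2) by (simp only: scale_cancel_right simp_thms)
    then show "z ^ (n * p i) = 1" by (simp add: power_mult[symmetric] mult.commute)
  qed
  have "n * ?m = n * p 0 + (\<Sum>i=1..rank. n * (mark i * p i))"
    unfolding label_order_def
    by (simp add: sum.atLeast_Suc_atMost mark_def sum_distrib_left algebra_simps)
  moreover have "?m dvd (\<Sum>i=1..rank. n * (mark i * p i))"
  proof (rule dvd_sum)
    fix i assume "i \<in> {1..rank}"
    from dvd_mult[OF simple[OF this], of "mark i"] show "?m dvd n * (mark i * p i)"
      by (simp only: mult.left_commute)
  qed
  ultimately have "?m dvd n * p 0" by (metis dvd_add_left_iff dvd_triv_right)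
  then have "?m dvd n * p i" if "i \<in> {0..rank}" for i
    using simple[of i] that by (cases "i = 0") auto
  then have "?m dvd Gcd ((*) n ` p ` {0..rank})" by (intro Gcd_greatest) auto
  also have "\<dots> = n" by (simp add: Gcd_mult gcd)
  finally show ?thesis using n(1) by (rule dvd_imp_le)
qed

text \<open>g acts by a scalar on each weight space, so g e = z e can be compared componentwise. The
  component in \<open>T\<close> vanishes because m >= 2 makes z different from 1.\<close>

lemma kac_eigenvector:
  assumes z: "primitive_root_of_unity (label_order p) z" and m: "2 \<le> label_order p"
    and g: "kac_automorphism z p g" and e: "g e = z *s e"
  obtains f where "e = sum f (roots T)" "\<And>\<gamma>. f \<gamma> \<in> root_space T \<gamma>"
    "\<And>\<gamma>. \<gamma> \<in> roots T \<Longrightarrow> f \<gamma> \<noteq> 0 \<Longrightarrow> int (label_order p) dvd label_degree p \<gamma> - 1"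
proof -
  have g': "lin g" "\<And>\<gamma> x. \<gamma> \<in> roots T \<Longrightarrow> x \<in> root_space T \<gamma> \<Longrightarrow> g x = z powi label_degree p \<gamma> *s x"
      "\<And>h. h \<in> T \<Longrightarrow> g h = h"
    using g by (auto simp: kac_automorphism_def inner_automorphism_linear)
  have z0: "z \<noteq> 0"
  proof
    assume "z = 0"
    then show False using primitive_rootD(1,2)[OF z] by (simp add: zero_power)
  qed
  have z1: "z \<noteq> 1" using primitive_rootD(3)[OF z, of 1] m by simp
  obtain f where f: "\<And>\<kappa>. f \<kappa> \<in> root_space T \<kappa>" "e = sum f weights"
    by (rule weight_decomposition[of e]) blast
  define a where "a = (\<lambda>\<kappa>. if \<kappa> = (\<lambda>_. 0) then 1 else z powi label_degree p \<kappa>)"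
  have gf: "g (f \<kappa>) = a \<kappa> *s f \<kappa>" if "\<kappa> \<in> weights" for \<kappa>
    using that g'(2)[OF _ f(1)] g'(3) f(1)[of \<kappa>] root_space_zero by (auto simp: a_def weights_def)
  have "g e - z *s e = (\<Sum>\<kappa>\<in>weights. a \<kappa> *s f \<kappa> - z *s f \<kappa>)"
    by (simp add: f(2) lin_sum[OF g'(1)] gf sum_subtractf scale_sum_right)
  also have "\<dots> = (\<Sum>\<kappa>\<in>weights. (a \<kappa> - z) *s f \<kappa>)" by (simp add: scale_left_diff_distrib)
  finally have "(\<Sum>\<kappa>\<in>weights. (a \<kappa> - z) *s f \<kappa>) = 0" using e by simp
  moreover have "(a \<kappa> - z) *s f \<kappa> \<in> root_space T \<kappa>" for \<kappa>
    by (intro subspace_scale subspace_root_space f)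
  moreover have "weights \<subseteq> dual T" using weights_dual by blast
  ultimately have 0: "(a \<kappa> - z) *s f \<kappa> = 0" if "\<kappa> \<in> weights" for \<kappa>
    using weight_independent[OF finite_weights, of "\<lambda>\<kappa>. (a \<kappa> - z) *s f \<kappa>" \<kappa>] that by blast
  have "f (\<lambda>_. 0) = 0" using 0[of "\<lambda>_. 0"] z1 by (auto simp: a_def weights_def)
  moreover have "(\<lambda>_. 0) \<notin> roots T" using roots_nonzero by blast
  ultimately have "e = sum f (roots T)" using f(2) finite_roots by (simp add: weights_def)
  moreover have "int (label_order p) dvd label_degree p \<gamma> - 1" if \<gamma>: "\<gamma> \<in> roots T" "f \<gamma> \<noteq> 0" for \<gamma>
  proof (rule primitive_root_dvd_int[OF z])
    have "a \<gamma> = z" using 0[of \<gamma>] \<gamma> by (auto simp: weights_def)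
    then have "z powi label_degree p \<gamma> = z" using roots_nonzero[OF \<gamma>(1)] by (simp add: a_def)
    then show "z powi (label_degree p \<gamma> - 1) = 1" using z0 by (simp add: power_int_diff)
  qed
  ultimately show ?thesis using that f(1) by blast
qed

lemma regular_label_bound:
  assumes z: "primitive_root_of_unity (label_order p) z"
    and g: "kac_automorphism z p g" and e: "g e = z *s e" "regular e"
    and le: "label_order p \<le> coxeter_number" and i: "i \<in> {0..rank}"
  shows "p i \<le> 1"
proof (rule ccontr)
  assume "\<not> p i \<le> 1"
  then have pi: "2 \<le> int (p i)" by simp
  let ?m = "int (label_order p)" and ?n = "\<lambda>j. int (mark j)"
  define q where "q = (\<lambda>j. ?n i * int (p j) - (if j = i then ?m else 0))"
  \<comment> \<open>The field carries no order, so the value of a root at H is kept as an integer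
    too; \<open>vH\<close> shows that the two agree.\<close>
  define v where "v = (\<lambda>\<gamma>. ?n i * label_degree p \<gamma> - ?m * root_coeff \<gamma> i)"
  define H where "H = (\<Sum>j=1..rank. of_int (q j) *s \<omega> j)"
  have n1: "1 \<le> ?n i" using mark_pos[OF i] by simp
  have m: "?m = (\<Sum>j=0..rank. ?n j * int (p j))" by (simp add: label_order_def)
  \<comment> \<open>The affine index 0 is adjoined with coefficient 0 and mark 1, so that i = 0 is
    treated like the other nodes.\<close>
  have deg: "label_degree p \<gamma> = (\<Sum>j=0..rank. root_coeff \<gamma> j * int (p j))" if "\<gamma> \<in> roots T" for \<gamma>
    unfolding label_degree_def using root_coeff(2)[OF that, of 0] by (simp add: sum.atLeast_Suc_atMost)
  have c: "\<And>j. root_coeff \<gamma> j \<le> ?n j" "\<And>j. - ?n j \<le> root_coeff \<gamma> j"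
    "(\<forall>j\<in>{0..rank}. 0 \<le> root_coeff \<gamma> j) \<or> (\<forall>j\<in>{0..rank}. root_coeff \<gamma> j \<le> 0)"
    if "\<gamma> \<in> roots T" for \<gamma>
    using root_coeff_bounds[OF that] root_coeff(3)[OF that] by auto
  have v_one: "v \<gamma> = ?n i" if "\<gamma> \<in> roots T" "?m dvd label_degree p \<gamma> - 1" for \<gamma>
    unfolding v_def
    by (rule label_degree_one[where J = "{0..rank}" and p = "\<lambda>j. int (p j)"])
      (use i pi n1 c[OF that(1)] m deg[OF that(1)] that(2) in auto)
  have v_le: "v \<gamma> \<le> ?n i * (?m - 2)" if "\<gamma> \<in> roots T" for \<gamma>
    unfolding v_def
    by (rule label_degree_bound[where J = "{0..rank}" and p = "\<lambda>j. int (p j)"])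
      (use i pi n1 c[OF that(1)] m deg[OF that(1)] in auto)
  have HT: "H \<in> T" unfolding H_def by (rule coweight_sum_T)
  have vH: "\<gamma> H = of_int (v \<gamma>)" if \<gamma>: "\<gamma> \<in> roots T" for \<gamma>
  proof -
    have aH: "\<alpha> j H = of_int (q j)" if "j \<in> {1..rank}" for j
      unfolding H_def by (rule simple_coweight_sum[OF that])
    have "\<gamma> H = (\<Sum>j=1..rank. of_int (root_coeff \<gamma> j) * \<alpha> j H)" by (rule root_coeff(1)[OF \<gamma> HT])
    also have "\<dots> = of_int (\<Sum>j=1..rank. root_coeff \<gamma> j * q j)"
      by (simp add: aH)
    also have "(\<Sum>j=1..rank. root_coeff \<gamma> j * q j) = (\<Sum>j=0..rank. root_coeff \<gamma> j * q j)"
      using root_coeff(2)[OF \<gamma>, of 0] by (simp add: sum.atLeast_Suc_atMost)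
    also have "\<dots> = (\<Sum>j=0..rank. ?n i * (root_coeff \<gamma> j * int (p j)) - (if j = i then ?m * root_coeff \<gamma> i else 0))"
      by (rule sum.cong) (auto simp: q_def algebra_simps)
    also have "\<dots> = v \<gamma>"
      unfolding v_def deg[OF \<gamma>] using i by (simp add: sum_subtractf sum_distrib_left)
    finally show ?thesis .
  qed
  have "2 * ?n i \<le> ?m"
  proof -
    have "?n i * int (p i) \<le> ?m" unfolding m using i by (intro member_le_sum) auto
    moreover have "?n i * 2 \<le> ?n i * int (p i)" using pi by (intro mult_left_mono) auto
    ultimately show ?thesis by simp
  qed
  then have m2: "2 \<le> label_order p" using n1 by linarith
  obtain f where f: "e = sum f (roots T)" "\<And>\<gamma>. f \<gamma> \<in> root_space T \<gamma>"
    "\<And>\<gamma>. \<gamma> \<in> roots T \<Longrightarrow> f \<gamma> \<noteq> 0 \<Longrightarrow> ?m dvd label_degree p \<gamma> - 1"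
    by (rule kac_eigenvector[OF z m2 g e(1)]) blast
  obtain \<beta> where \<beta>: "simple_roots T \<beta>" "(\<lambda>h. \<Sum>j=1..rank. of_nat (mark j) * \<beta> j h) \<in> roots T"
    "\<And>j. j \<in> {1..rank} \<Longrightarrow> 0 \<le> v (\<beta> j)"
    by (rule dominant_base[where H = H and v = v and n = mark, OF HT vH highest_root_marks]) blast+
  interpret B: based_simple_lie_algebra scale lie T \<beta> by (rule based[OF \<beta>(1)])
  have \<beta>H: "\<beta> j H = of_int (?n i)" if "j \<in> {1..rank}" for j
  proof (rule B.regular_degree[OF e(2) f(1,2) HT])
    show "\<gamma> H = of_int (?n i)" if "\<gamma> \<in> roots T" "f \<gamma> \<noteq> 0" for \<gamma>
      using vH[OF that(1)] v_one[OF that(1) f(3)[OF that]] by simp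
    show "0 < ?n i" using n1 by simp
    show "\<beta> j H = of_int (v (\<beta> j))" "0 \<le> v (\<beta> j)" if "j \<in> {1..rank}" for j
      using vH[OF B.simple_root[OF that]] \<beta>(3)[OF that] by auto
  qed (rule that)
  \<comment> \<open>The old marks on the new base: as every \<beta> j takes the value n i at H, this
    root takes n i times the sum of the marks from 1 on, which is one less than the Coxeter
    number.\<close>
  define \<delta> where "\<delta> = (\<lambda>h. \<Sum>j=1..rank. of_nat (mark j) * \<beta> j h)"
  have \<delta>: "\<delta> \<in> roots T" using \<beta>(2) by (simp add: \<delta>_def)
  have "of_int (v \<delta>) = (of_int (?n i * (\<Sum>j=1..rank. ?n j)) :: 'k)"
    using vH[OF \<delta>] \<beta>H by (simp add: \<delta>_def sum_distrib_left mult.commute)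
  then have "v \<delta> = ?n i * (\<Sum>j=1..rank. ?n j)" by (simp only: of_int_eq_iff)
  moreover have "(\<Sum>j=1..rank. ?n j) = int coxeter_number - 1"
    by (simp add: coxeter_number_def sum.atLeast_Suc_atMost mark_def)
  ultimately have "?n i * (int coxeter_number - 1) \<le> ?n i * (?m - 2)" using v_le[OF \<delta>] by simp
  then have "int coxeter_number - 1 \<le> ?m - 2" using n1 by (simp add: mult_le_cancel_left_pos)
  then show False using le by linarith
qed

text \<open>The conjugation s moves everything to the normal form g: a power of \<theta> that is the
  identity is so for g, the eigenvector e = s x comes from the eigenvector x of g, and x inherits
  regularity.\<close>

lemma N_regular_labels:
  assumes fin: "finite_order \<theta>" and labels: "kac_labels z p \<theta>" and reg: "N_regular z \<theta>"
    and le: "aut_order \<theta> \<le> coxeter_number" and i: "i \<in> {0..rank}"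
  shows "p i \<le> 1"
proof -
  from labels obtain g s where z: "primitive_root_of_unity (label_order p) z"
    and gcd: "Gcd (p ` {0..rank}) = 1" and g: "kac_automorphism z p g"
    and s: "lie_automorphism s" and conj: "\<theta> \<circ> s = s \<circ> g"
    by (auto simp: kac_labels_def)
  have s': "lin s" "bij s" using s by (auto simp: lie_automorphism_def)
  have conj': "\<theta> (s x) = s (g x)" for x using conj by (metis comp_apply)
  have "0 < aut_order \<theta> \<and> \<theta> ^^ aut_order \<theta> = id"
    unfolding aut_order_def by (rule LeastI_ex) (use fin in \<open>auto simp: finite_order_def\<close>)
  then have n: "0 < aut_order \<theta>" "\<theta> ^^ aut_order \<theta> = id" by auto
  have pow: "(\<theta> ^^ k) (s x) = s ((g ^^ k) x)" for k x
    by (induction k) (simp_all add: conj')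
  have "g ^^ aut_order \<theta> = id"
  proof
    fix x
    have "s ((g ^^ aut_order \<theta>) x) = s x" using pow[of "aut_order \<theta>" x] n(2) by simp
    then show "(g ^^ aut_order \<theta>) x = id x" using s'(2) by (simp add: bij_def inj_eq)
  qed
  then have "label_order p \<le> aut_order \<theta>" by (rule kac_order[OF z gcd g n(1)])
  with le have le': "label_order p \<le> coxeter_number" by simp
  obtain e where e: "\<theta> e = z *s e" "regular e"
    using reg by (auto simp: N_regular_def graded_part_def)
  obtain x where x: "e = s x" using s'(2) by (metis bij_pointE)
  have "s (g x) = s (z *s x)" using e(1) by (simp add: x conj' lin_scale[OF s'(1)])
  then have "g x = z *s x" using s'(2) by (simp add: bij_def inj_eq)
  moreover have "regular x" using regular_automorphism[OF s] e(2) x by simp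
  ultimately show ?thesis using regular_label_bound[OF z g _ _ le' i] by blast
qed

end

theorem corollary7p11:
  fixes scale :: "'k::{alg_closed_field, field_char_0} \<Rightarrow> 'g::ab_group_add \<Rightarrow> 'g"
    and lie :: "'g \<Rightarrow> 'g \<Rightarrow> 'g"
    and T :: "'g set"
    and \<alpha> :: "nat \<Rightarrow> 'g \<Rightarrow> 'k"
    and \<theta> :: "'g \<Rightarrow> 'g"
    and p :: "nat \<Rightarrow> nat"
    and \<zeta> :: 'k
  assumes "based_simple_lie_algebra scale lie T \<alpha>"
    and "\<theta> \<in> lie_algebra.inner_automorphisms scale lie"
    and "lie_algebra.finite_order \<theta>"
    and "based_simple_lie_algebra.kac_labels scale lie T \<alpha> \<zeta> p \<theta>"
    and "lie_algebra.N_regular scale lie \<zeta> \<theta>"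
    and "lie_algebra.aut_order \<theta> \<le> based_simple_lie_algebra.coxeter_number scale lie T \<alpha>"
  shows "\<forall>i\<in>{0..based_simple_lie_algebra.rank scale T}. p i \<le> 1"
proof -
  interpret based_simple_lie_algebra scale lie T \<alpha> by (rule assms(1))
  show ?thesis using N_regular_labels assms(3-6) by blast
qed

end
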